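(* Let $\mathcal X$ be a complex Banach space, $0<p,q<\infty$, $s\in\mathbb R$, $\tau\ge0$, $a>\max\{1/p,1/q\}$, and let $(r_l)_{l\ge0}\subset[0,1)$ satisfy $c2^{-l}\le1-r_l\le C2^{-l}$ for some constants $0<c\le C$. Then the five (quasi-)norms $\|f\|_1,\dots,\|f\|_5$ below are pairwise comparable: there is a constant $K\ge1$ (independent of $f$) such that $K^{-1}\|f\|_j\le\|f\|_k\le K\|f\|_j$ for all $j,k\in\{1,\dots,5\}$ and all $f\in\mathcal A(\mathcal X)$ (with the convention that both sides may be $+\infty$). In particular $\|f\|_3$ and $\|f\|_4$ are, up to constants, independent of the choice of $(r_l)$.
   Context: $\mathbb D$ unit disc, $\mathbb T$ unit circle, $\zeta_x=e^{2\pi ix}$; $dx$ normalized arc length; $|I|$ normalized length of an arc; $|\zeta_x-\zeta_y|$ the arc-length distance, i.e. the distance from $x-y$ to $\mathbb Z$. $\mathcal A(\mathcal X)$: analytic $f:\mathbb D\to\mathcal X$; $f_r(\zeta)=f(r\zeta)$, $f_l=f_{r_l}$. Dyadic arcs $\mathcal D(\mathbb T)$: images of $[2^{-j}k,2^{-j}(k+1))$, $j\ge0$, $0\le k<2^j$; for $I\in\mathcal D(\mathbb T)$ with $|I|=2^{-j}$, $\operatorname{rk}(I)=j$. Stolz angle $\Gamma(\zeta_x)$: convex hull of $\{\zeta_x\}\cup\{|w|=1/2\}$; truncated angle $\Gamma_I(\zeta_x)=\{w\in\Gamma(\zeta_x):1-|w|\le|I|\}$. Peetre maximal function: for $a>0$,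 $f^*_{r,a}(\zeta_x)=\sup_{\zeta_y\in\mathbb T}\|f_r(\zeta_y)\|_{\mathcal X}\big(1+\frac{|\zeta_x-\zeta_y|}{1-r}\big)^{-a}$, and $f^*_{l,a}=f^*_{r_l,a}$. The quasi-norms (each a supremum over $I\in\mathcal D(\mathbb T)$ of $|I|^{-\tau}(\int_{I}[\,\cdot\,]^{p/q}dx)^{1/p}$ with the bracket below evaluated at $\zeta_x$): $\|f\|_1$: $[\int_{\Gamma_I(\zeta_x)}(1-|w|)^{-2-sq}\|f(w)\|_{\mathcal X}^qdA(w)]$; $\|f\|_2$: $[\int_{1-|I|}^1(1-r)^{-1-sq}\|f_r(\zeta_x)\|_{\mathcal X}^qdr]$; $\|f\|_3$: $[\sum_{l=\operatorname{rk}(I)}^\infty2^{slq}\|f_l(\zeta_x)\|^q_{\mathcal X}]$; $\|f\|_4$: $[\sum_{l=\operatorname{rk}(I)}^\infty2^{slq}f^*_{l,a}(\zeta_x)^q]$; $\|f\|_5$: $[\int_{1-|I|}^1(1-r)^{-1-sq}f^*_{r,a}(\zeta_x)^qdr]$. *)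

theory Defs
  imports "HOL-Analysis.Analysis"
begin

class scaleC =
  fixes scaleC :: "complex \<Rightarrow> 'a \<Rightarrow> 'a" (infixr \<open>*\<^sub>C\<close> 75)

class complex_banach = banach + scaleC +
  assumes scaleC_add_right: "a *\<^sub>C (x + y) = a *\<^sub>C x + a *\<^sub>C y"
    and scaleC_add_left: "(a + b) *\<^sub>C x = a *\<^sub>C x + b *\<^sub>C x"
    and scaleC_scaleC: "a *\<^sub>C (b *\<^sub>C x) = (a * b) *\<^sub>C x"
    and scaleC_one: "1 *\<^sub>C x = x"
    and scaleR_scaleC: "r *\<^sub>R x = complex_of_real r *\<^sub>C x"
    and norm_scaleC: "norm (a *\<^sub>C x) = cmod a * norm x"

definition analytic_disc :: "(complex \<Rightarrow> 'a::complex_banach) \<Rightarrow> bool" where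
  "analytic_disc f \<longleftrightarrow>
     (\<forall>z \<in> ball 0 1. \<exists>D. (f has_derivative (\<lambda>h. h *\<^sub>C D)) (at z))"

definition zeta :: "real \<Rightarrow> complex" where
  "zeta x = cis (2 * pi * x)"

text \<open>Arc-length distance \<open>|\<zeta>_x - \<zeta>_y|\<close>: the distance from \<open>x - y\<close> to \<open>\<int>\<close>.\<close>
definition tdist :: "real \<Rightarrow> real \<Rightarrow> real" where
  "tdist x y = min (frac (x - y)) (1 - frac (x - y))"

text \<open>Dyadic arc of rank \<open>j\<close> and position \<open>k\<close> (as a subset of the parameter interval [0,1)).\<close>
definition dyadic :: "nat \<Rightarrow> nat \<Rightarrow> real set" where
  "dyadic j k = {real k / 2 ^ j ..< (real k + 1) / 2 ^ j}"

definition epow :: "ennreal \<Rightarrow> real \<Rightarrow> ennreal" where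
  "epow x t = (if x = \<infinity> then \<infinity> else ennreal (enn2real x powr t))"

definition stolz :: "complex \<Rightarrow> complex set" where
  "stolz \<zeta> = convex hull (insert \<zeta> (sphere 0 (1/2)))"

definition stolz_trunc :: "real \<Rightarrow> complex \<Rightarrow> complex set" where
  "stolz_trunc h \<zeta> = {w \<in> stolz \<zeta>. 1 - norm w \<le> h}"

definition peetre :: "(complex \<Rightarrow> 'a::complex_banach) \<Rightarrow> real \<Rightarrow> real \<Rightarrow> real \<Rightarrow> ennreal" where
  "peetre f a r x = (SUP y \<in> {0..<1}.
      ennreal (norm (f (complex_of_real r * zeta y)) * (1 + tdist x y / (1 - r)) powr (- a)))"

definition dyadic_norm :: "real \<Rightarrow> real \<Rightarrow> real \<Rightarrow> (real \<Rightarrow> nat \<Rightarrow> ennreal) \<Rightarrow> ennreal" where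
  "dyadic_norm p q \<tau> G = (SUP j. SUP k \<in> {..<2 ^ j}.
      ennreal (2 powr (real j * \<tau>)) *
      epow (\<integral>\<^sup>+ x. epow (G x j) (p / q) * indicator (dyadic j k) x \<partial>lborel) (1 / p))"

definition norm1 :: "real \<Rightarrow> real \<Rightarrow> real \<Rightarrow> real \<Rightarrow> (complex \<Rightarrow> 'a::complex_banach) \<Rightarrow> ennreal" where
  "norm1 p q s \<tau> f = dyadic_norm p q \<tau> (\<lambda>x j.
     \<integral>\<^sup>+ w. ennreal ((1 - norm w) powr (- 2 - s * q) * norm (f w) powr q)
             * indicator (stolz_trunc (2 powr (- real j)) (zeta x)) w \<partial>lborel)"

definition norm2 :: "real \<Rightarrow> real \<Rightarrow> real \<Rightarrow> real \<Rightarrow> (complex \<Rightarrow> 'a::complex_banach) \<Rightarrow> ennreal" where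
  "norm2 p q s \<tau> f = dyadic_norm p q \<tau> (\<lambda>x j.
     \<integral>\<^sup>+ r. ennreal ((1 - r) powr (- 1 - s * q) * norm (f (complex_of_real r * zeta x)) powr q)
             * indicator {1 - 2 powr (- real j) ..< 1} r \<partial>lborel)"

definition norm3 :: "(nat \<Rightarrow> real) \<Rightarrow> real \<Rightarrow> real \<Rightarrow> real \<Rightarrow> real \<Rightarrow> (complex \<Rightarrow> 'a::complex_banach) \<Rightarrow> ennreal" where
  "norm3 rs p q s \<tau> f = dyadic_norm p q \<tau> (\<lambda>x j.
     \<Sum>l. (if j \<le> l then ennreal (2 powr (s * real l * q) * norm (f (complex_of_real (rs l) * zeta x)) powr q)
           else 0))"

definition norm4 :: "(nat \<Rightarrow> real) \<Rightarrow> real \<Rightarrow> real \<Rightarrow> real \<Rightarrow> real \<Rightarrow> real \<Rightarrow> (complex \<Rightarrow> 'a::complex_banach) \<Rightarrow> ennreal" where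
  "norm4 rs a p q s \<tau> f = dyadic_norm p q \<tau> (\<lambda>x j.
     \<Sum>l. (if j \<le> l then ennreal (2 powr (s * real l * q)) * epow (peetre f a (rs l) x) q
           else 0))"

definition norm5 :: "real \<Rightarrow> real \<Rightarrow> real \<Rightarrow> real \<Rightarrow> real \<Rightarrow> (complex \<Rightarrow> 'a::complex_banach) \<Rightarrow> ennreal" where
  "norm5 a p q s \<tau> f = dyadic_norm p q \<tau> (\<lambda>x j.
     \<integral>\<^sup>+ r. ennreal ((1 - r) powr (- 1 - s * q)) * epow (peetre f a r x) q
             * indicator {1 - 2 powr (- real j) ..< 1} r \<partial>lborel)"

definition the_norms :: "(nat \<Rightarrow> real) \<Rightarrow> real \<Rightarrow> real \<Rightarrow> real \<Rightarrow> real \<Rightarrow> real \<Rightarrow> nat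
    \<Rightarrow> (complex \<Rightarrow> 'a::complex_banach) \<Rightarrow> ennreal" where
  "the_norms rs a p q s \<tau> i f =
     (if i = 1 then norm1 p q s \<tau> f
      else if i = 2 then norm2 p q s \<tau> f
      else if i = 3 then norm3 rs p q s \<tau> f
      else if i = 4 then norm4 rs a p q s \<tau> f
      else norm5 a p q s \<tau> f)"

end

theory Submission
  imports Defs "HOL-Complex_Analysis.Complex_Analysis"
begin

text \<open>All five quantities are compared with one built from the weighted suprema
  \<open>P l x = sup |f v| (1 + 2\<^sup>l |v - \<zeta>\<^sub>x|)\<^sup>-\<^sup>a\<close> over the circles \<open>|v| = R l\<close>. The maximum principle for
  \<open>f v / (1 - cnj w v)\<^sup>N\<close> bounds \<open>|f w|\<close> by \<open>P\<close> at a slightly deeper level, which dominates the quasi-norms.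
  Conversely \<open>f\<close> oscillates little on boxes of side \<open>\<delta> 2\<^sup>-\<^sup>l\<close>, so \<open>P l\<close> is at most a weighted supremum of the
  infima of \<open>|f|\<close> over such boxes plus a small multiple of \<open>P (l + M)\<close>. The latter can be absorbed once \<open>f\<close> is
  known to grow at most polynomially in \<open>1 / (1 - |v|)\<close>, and this follows from finiteness of the quasi-norm
  by the subharmonicity of \<open>|f|\<^sup>t\<close>, \<open>t > 0\<close>. The infima are controlled pointwise by each quasi-norm without a
  maximal function. The weights are removed by an inequality for sums over the dyadic tree, which holds
  for \<open>a > max (1 / p) (1 / q)\<close> and takes the place of the Fefferman--Stein maximal theorem.\<close>

section \<open>Norming functionals and scalar reduction\<close>

text \<open>Since \<open>p / q\<close> may lie on either side of 1, no single convexity or duality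
  argument covers all cases, and the bracket mixes all levels before the outer power is taken. After
  raising to the power \<open>q\<close> the weights decay with exponent \<open>b = a * q\<close>,
  and the outer power is \<open>\<theta> = p / q\<close>; the assumption on \<open>a\<close> says
  exactly \<open>b > 1\<close> and \<open>b * \<theta> > 1\<close>, summability of the weights
  before and after the outer power. The parameter \<open>\<tau>\<close> enters only through a factor
  depending on the rank, so each comparison is either pointwise or between arcs of the same rank.
  Upper bounds hold for the weighted suprema over any admissible radii, lower bounds only for radii
  suited to the quasi-norm: the given ones for \<open>norm3\<close> and \<open>norm4\<close>, fixed
  ones for the others. Any two quasi-norms are compared through radii suited to the larger side, and
  the suprema for different radii are never compared directly. In the absorption both sides might be
  infinite; the growth of \<open>f\<close> rules this out, and its constant, which depends on
  \<open>f\<close>, disappears in a limit.\<close>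

definition sublinear :: "('a::real_vector \<Rightarrow> real) \<Rightarrow> bool" where
  "sublinear p \<longleftrightarrow> (\<forall>x y. p (x + y) \<le> p x + p y) \<and> (\<forall>t>0. \<forall>x. p (t *\<^sub>R x) = t * p x)"

lemma sublinear_zero: "sublinear p \<Longrightarrow> p 0 = 0"
proof -
  assume "sublinear p"
  then have "p (2 *\<^sub>R 0) = 2 * p 0" unfolding sublinear_def by (meson zero_less_numeral)
  then show ?thesis by simp
qed

lemma sublinear_neg_le: "sublinear p \<Longrightarrow> - p (- x) \<le> p x"
proof -
  assume p: "sublinear p"
  then have "p (x + - x) \<le> p x + p (- x)" unfolding sublinear_def by blast
  then show ?thesis using sublinear_zero[OF p] by simp
qed

text \<open>A minimal sublinear functional is linear because this construction cannot decrease it. This gives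
  Hahn--Banach without extending functionals from subspaces.\<close>

lemma sublinear_dent:
  fixes p :: "'a::real_vector \<Rightarrow> real" and y :: 'a
  assumes p: "sublinear p"
  defines "q \<equiv> \<lambda>x. INF t\<in>{0..}. p (x + t *\<^sub>R y) - t * p y"
  shows "sublinear q" "q x \<le> p x" "q (- y) \<le> - p y"
proof -
  have hom: "p (t *\<^sub>R x) = t * p x" if "t \<ge> 0" for t x
    using p that sublinear_zero[OF p] unfolding sublinear_def by (cases "t = 0") auto
  have sub: "p (x + y) \<le> p x + p y" for x y
    using p unfolding sublinear_def by auto
  have lb: "- p (- x) \<le> p (x + t *\<^sub>R y) - t * p y" if "t \<ge> 0" for x t
    using sub[of "x + t *\<^sub>R y" "- x"] hom[OF that, of y] by simp
  have bdd: "bdd_below ((\<lambda>t. p (x + t *\<^sub>R y) - t * p y) ` {0..})" for x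
    using lb by (intro bdd_belowI2[where m="- p (- x)"]) auto
  have qle: "q x \<le> p (x + t *\<^sub>R y) - t * p y" if "t \<ge> 0" for x t
    unfolding q_def by (rule cINF_lower[OF bdd]) (use that in auto)
  have qge: "c \<le> q x" if "\<And>t. t \<ge> 0 \<Longrightarrow> c \<le> p (x + t *\<^sub>R y) - t * p y" for x c
    unfolding q_def by (rule cINF_greatest) (use that in auto)
  show "q x \<le> p x" using qle[of 0 x] by simp
  show "q (- y) \<le> - p y" using qle[of 1 "- y"] sublinear_zero[OF p] by simp
  have add: "q (x + x') \<le> q x + q x'" for x x'
  proof -
    have "q (x + x') - q x' \<le> p (x + t *\<^sub>R y) - t * p y" if t: "t \<ge> 0" for t
    proof -
      have "q (x + x') - (p (x + t *\<^sub>R y) - t * p y) \<le> q x'"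
      proof (rule qge)
        fix t' :: real assume "t' \<ge> 0"
        then show "q (x + x') - (p (x + t *\<^sub>R y) - t * p y) \<le> p (x' + t' *\<^sub>R y) - t' * p y"
          using qle[of "t + t'" "x + x'"] sub[of "x + t *\<^sub>R y" "x' + t' *\<^sub>R y"] t
          by (simp add: algebra_simps)
      qed
      then show ?thesis by linarith
    qed
    from qge[OF this] show ?thesis by fastforce
  qed
  have le: "s * q x \<le> q (s *\<^sub>R x)" if s: "s > 0" for s x
  proof (rule qge)
    fix t :: real assume t: "t \<ge> 0"
    have "s * q x \<le> s * (p (x + (t / s) *\<^sub>R y) - (t / s) * p y)"
      using qle[of "t / s" x] s t by simp
    also have "\<dots> = p (s *\<^sub>R (x + (t / s) *\<^sub>R y)) - t * p y"
      using s by (subst hom) (auto simp: algebra_simps)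
    finally show "s * q x \<le> p (s *\<^sub>R x + t *\<^sub>R y) - t * p y"
      using s by (simp add: algebra_simps)
  qed
  have "q (s *\<^sub>R x) = s * q x" if s: "s > 0" for s x
  proof -
    have "(1 / s) * q (s *\<^sub>R x) \<le> q x" using le[of "1 / s" "s *\<^sub>R x"] s by simp
    then have "q (s *\<^sub>R x) \<le> s * q x" using s by (simp add: field_simps)
    then show ?thesis using le[OF s, of x] by simp
  qed
  then show "sublinear q" using add unfolding sublinear_def by blast
qed


text \<open>Zorn's lemma for the reversed pointwise order. A nonempty chain is bounded by its
  pointwise infimum, which is finite because \<open>- p (- x)\<close> lies below the value at
  \<open>x\<close> of every sublinear functional dominated by \<open>p\<close>.\<close>

lemma minimal_sublinear_exists:
  fixes p :: "'a::real_vector \<Rightarrow> real"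
  assumes p: "sublinear p"
  obtains m where "sublinear m" "\<And>x. m x \<le> p x"
    "\<And>q. sublinear q \<Longrightarrow> (\<And>x. q x \<le> m x) \<Longrightarrow> q = m"
proof -
  define A where "A = {q. sublinear q \<and> (\<forall>x. q x \<le> p x)}"
  define P where "P = (\<lambda>a b :: 'a \<Rightarrow> real. \<forall>x. b x \<le> a x)"
  have po: "partial_order_on A (relation_of P A)"
  proof (rule partial_order_on_relation_ofI)
    show "P a c" if "P a b" "P b c" for a b c
      using that unfolding P_def by (meson order_trans)
    show "a = b" if "P a b" "P b a" for a b
      using that unfolding P_def by (auto simp: fun_eq_iff intro!: order_antisym)
  qed (auto simp: P_def)
  have "\<exists>m\<in>A. \<forall>a\<in>A. P m a \<longrightarrow> a = m"
  proof (rule predicate_Zorn[OF po])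
    fix C assume C: "C \<in> Chains (relation_of P A)"
    show "\<exists>u\<in>A. \<forall>a\<in>C. P a u"
    proof (cases "C = {}")
      case True
      then show ?thesis using p unfolding A_def by auto
    next
      case False
      have CA: "C \<subseteq> A" and tot: "\<And>a b. a \<in> C \<Longrightarrow> b \<in> C \<Longrightarrow> P a b \<or> P b a"
        using C unfolding Chains_def relation_of_def by auto
      define u where "u = (\<lambda>x. INF q\<in>C. q x)"
      have bdd: "bdd_below ((\<lambda>q. q x) ` C)" for x
      proof (rule bdd_belowI2[where m="- p (- x)"])
        fix q assume "q \<in> C"
        then have "sublinear q" "q (- x) \<le> p (- x)" using CA unfolding A_def by auto
        then show "- p (- x) \<le> q x" using sublinear_neg_le[of q x] by linarith
      qed
      have ule: "u x \<le> q x" if "q \<in> C" for q x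
        unfolding u_def by (rule cINF_lower[OF bdd that])
      have uge: "c \<le> u x" if "\<And>q. q \<in> C \<Longrightarrow> c \<le> q x" for c x
        unfolding u_def by (rule cINF_greatest[OF False that])
      have "sublinear q" if "q \<in> C" for q using that CA unfolding A_def by auto
      then have sub: "q (x + y) \<le> q x + q y" and hom: "t > 0 \<Longrightarrow> q (t *\<^sub>R x) = t * q x"
        if "q \<in> C" for q t x y
        using that unfolding sublinear_def by blast+
      have "u (x + y) \<le> u x + u y" for x y
      proof -
        have "u (x + y) - u y \<le> a x" if a: "a \<in> C" for a
        proof -
          have "u (x + y) - a x \<le> u y"
          proof (rule uge)
            fix b assume b: "b \<in> C"
            have "\<exists>c\<in>C. c x \<le> a x \<and> c y \<le> b y"
              using tot[OF a b] a b unfolding P_def by auto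
            then obtain c where c: "c \<in> C" "c x \<le> a x" "c y \<le> b y" by auto
            have "u (x + y) \<le> c x + c y" using ule[OF c(1), of "x + y"] sub[OF c(1), of x y] by linarith
            then show "u (x + y) - a x \<le> b y" using c by linarith
          qed
          then show ?thesis by linarith
        qed
        from uge[OF this] show ?thesis by fastforce
      qed
      moreover have "u (t *\<^sub>R x) = t * u x" if t: "t > 0" for t x
      proof (rule antisym)
        have "u (t *\<^sub>R x) / t \<le> u x"
        proof (rule uge)
          fix q assume q: "q \<in> C"
          then show "u (t *\<^sub>R x) / t \<le> q x"
            using ule[OF q, of "t *\<^sub>R x"] hom[OF q t, of x] t by (simp add: field_simps)
        qed
        then show "u (t *\<^sub>R x) \<le> t * u x" using t by (simp add: field_simps)
        show "t * u x \<le> u (t *\<^sub>R x)"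
        proof (rule uge)
          fix q assume q: "q \<in> C"
          then show "t * u x \<le> q (t *\<^sub>R x)"
            using ule[OF q, of x] hom[OF q t, of x] t by simp
        qed
      qed
      ultimately have "sublinear u" unfolding sublinear_def by auto
      moreover have "u x \<le> p x" for x
      proof -
        obtain q where "q \<in> C" using False by auto
        then have "u x \<le> q x" "q x \<le> p x" using ule[of q x] CA unfolding A_def by auto
        then show ?thesis by linarith
      qed
      ultimately have "u \<in> A" unfolding A_def by auto
      then show ?thesis using ule unfolding P_def by auto
    qed
  qed
  then obtain m where "m \<in> A" "\<And>a. a \<in> A \<Longrightarrow> P m a \<Longrightarrow> a = m" by blast
  then show ?thesis
  proof (intro that[of m])
    fix q assume q: "sublinear q" "\<And>x. q x \<le> m x"
    then have "q \<in> A" using \<open>m \<in> A\<close> unfolding A_def by (auto intro: order_trans[OF q(2)])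
    then show "q = m" using q(2) \<open>\<And>a. a \<in> A \<Longrightarrow> P m a \<Longrightarrow> a = m\<close> unfolding P_def by blast
  qed (auto simp: A_def)
qed

text \<open>The norm is first dented along \<open>v\<close>, which makes the value at
  \<open>- v\<close> at most \<open>- norm v\<close>; a minimal functional below the dented one
  inherits this, so its value at \<open>v\<close> is at least \<open>norm v\<close>.\<close>

lemma real_norming_functional:
  fixes v :: "'a::real_normed_vector"
  obtains m :: "'a \<Rightarrow> real" where "\<And>x y. m (x + y) = m x + m y" "\<And>t x. m (t *\<^sub>R x) = t * m x"
    "\<And>x. m x \<le> norm x" "m v = norm v"
proof -
  have n: "sublinear (norm :: 'a \<Rightarrow> real)" unfolding sublinear_def by (auto intro: norm_triangle_ineq)
  define q where "q = (\<lambda>x. INF t\<in>{0..}. norm (x + t *\<^sub>R v) - t * norm v)"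
  have q: "sublinear q" "\<And>x. q x \<le> norm x" "q (- v) \<le> - norm v"
    unfolding q_def by (fact sublinear_dent[OF n])+
  obtain m where m: "sublinear m" "\<And>x. m x \<le> q x"
    "\<And>q'. sublinear q' \<Longrightarrow> (\<And>x. q' x \<le> m x) \<Longrightarrow> q' = m"
    using minimal_sublinear_exists[OF q(1)] by metis
  \<comment> \<open>Denting the minimal \<open>m\<close> along \<open>y\<close> returns
    \<open>m\<close> itself, so the dent property at \<open>- y\<close> holds for \<open>m\<close>:
    a minimal sublinear functional is odd, and hence additive.\<close>
  have neg: "m (- y) = - m y" for y
  proof -
    have "(\<lambda>x. INF t\<in>{0..}. m (x + t *\<^sub>R y) - t * m y) = m"
      by (rule m(3)[OF sublinear_dent(1)[OF m(1)] sublinear_dent(2)[OF m(1)]])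
    from fun_cong[OF this, of "- y"] have "m (- y) \<le> - m y"
      using sublinear_dent(3)[OF m(1), of y] by linarith
    then show ?thesis using sublinear_neg_le[OF m(1), of "y"] by linarith
  qed
  have sub: "m (x + y) \<le> m x + m y" for x y using m(1) unfolding sublinear_def by auto
  have add: "m (x + y) = m x + m y" for x y
    using sub[of x y] sub[of "x + y" "- y"] neg[of y] by simp
  have hom: "m (t *\<^sub>R x) = t * m x" for t x
  proof -
    have pos: "m (t *\<^sub>R x) = t * m x" if "t > 0" for t x using m(1) that unfolding sublinear_def by auto
    consider "t > 0" | "t = 0" | "t < 0" by linarith
    then show ?thesis
    proof cases
      case 3
      then show ?thesis using pos[of "- t" x] neg[of "t *\<^sub>R x"] by simp
    qed (use pos sublinear_zero[OF m(1)] in auto)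
  qed
  have le: "m x \<le> norm x" for x using m(2) q(2) order_trans by blast
  have "norm v \<le> m v" using neg[of v] m(2)[of "- v"] q(3) by linarith
  then have "m v = norm v" using le[of v] by simp
  then show ?thesis using that add hom le by blast
qed

text \<open>The real functional is the real part of the complex linear one
  \<open>m x - i m (i x)\<close>. The bound on the modulus comes from multiplying \<open>x\<close>
  by the conjugate of the value, which makes the value real and brings it under the bound for
  \<open>m\<close>.\<close>

lemma norming_functional:
  fixes v :: "'a::complex_banach"
  obtains \<phi> :: "'a \<Rightarrow> complex" where "\<And>x y. \<phi> (x + y) = \<phi> x + \<phi> y" "\<And>c x. \<phi> (c *\<^sub>C x) = c * \<phi> x"
    "\<And>x. cmod (\<phi> x) \<le> norm x" "cmod (\<phi> v) = norm v"
proof -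
  obtain m :: "'a \<Rightarrow> real" where add: "\<And>x y. m (x + y) = m x + m y" and hom: "\<And>t x. m (t *\<^sub>R x) = t * m x"
    and le: "\<And>x. m x \<le> norm x" and v: "m v = norm v"
    using real_norming_functional[of v] by blast
  define \<phi> where "\<phi> = (\<lambda>x. Complex (m x) (- m (\<i> *\<^sub>C x)))"
  have padd: "\<phi> (x + y) = \<phi> x + \<phi> y" for x y
    unfolding \<phi>_def by (simp add: add scaleC_add_right complex_eq_iff)
  have phom: "\<phi> (c *\<^sub>C x) = c * \<phi> x" for c x
  proof -
    have dec: "c *\<^sub>C x = Re c *\<^sub>R x + Im c *\<^sub>R (\<i> *\<^sub>C x)" for c and x :: 'a
      by (simp add: scaleR_scaleC scaleC_scaleC scaleC_add_left[symmetric] complex_eq[symmetric] mult.commute)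
    have mc: "m (c *\<^sub>C x) = Re c * m x + Im c * m (\<i> *\<^sub>C x)" for c x
      by (subst dec) (simp add: add hom)
    have "m (\<i> *\<^sub>C c *\<^sub>C x) = - Im c * m x + Re c * m (\<i> *\<^sub>C x)"
      using mc[of "\<i> * c" x] by (simp add: scaleC_scaleC)
    then show ?thesis unfolding \<phi>_def using mc[of c x] by (simp add: complex_eq_iff)
  qed
  have ple: "cmod (\<phi> x) \<le> norm x" for x
  proof (cases "\<phi> x = 0")
    case False
    have "cmod (\<phi> x) ^ 2 = Re (cnj (\<phi> x) * \<phi> x)" by (metis Re_complex_of_real complex_norm_square mult.commute)
    also have "\<dots> = m (cnj (\<phi> x) *\<^sub>C x)" unfolding phom[symmetric] by (simp add: \<phi>_def)
    also have "\<dots> \<le> cmod (\<phi> x) * norm x" using le[of "cnj (\<phi> x) *\<^sub>C x"] by (simp add: norm_scaleC)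
    finally show ?thesis using False by (simp add: power2_eq_square)
  qed simp
  have "norm v \<le> cmod (\<phi> v)" using complex_Re_le_cmod[of "\<phi> v"] v unfolding \<phi>_def by simp
  then show ?thesis using that padd phom ple by (metis antisym)
qed

lemma functional_holomorphic:
  fixes f :: "complex \<Rightarrow> 'a::complex_banach"
  assumes f: "analytic_disc f"
    and add: "\<And>x y. \<phi> (x + y) = \<phi> x + \<phi> y" and hom: "\<And>c x. \<phi> (c *\<^sub>C x) = c * \<phi> x"
    and le: "\<And>x. cmod (\<phi> x) \<le> norm x"
  shows "(\<lambda>z. \<phi> (f z)) holomorphic_on ball 0 1"
proof -
  have bl: "bounded_linear \<phi>"
  proof (rule bounded_linear_intro[where K=1])
    show "\<phi> (r *\<^sub>R x) = r *\<^sub>R \<phi> x" for r x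
      unfolding scaleR_scaleC hom by (rule scaleR_conv_of_real[symmetric])
  qed (simp_all add: add le)
  have "\<exists>D. ((\<lambda>z. \<phi> (f z)) has_field_derivative D) (at z)" if z: "z \<in> ball 0 1" for z
  proof -
    obtain D where "(f has_derivative (\<lambda>h. h *\<^sub>C D)) (at z)"
      using f[unfolded analytic_disc_def, rule_format, OF z] by (rule exE)
    from bounded_linear.has_derivative[OF bl this]
    have "((\<lambda>z. \<phi> (f z)) has_derivative (\<lambda>h. h * \<phi> D)) (at z)" by (simp add: hom)
    then have "((\<lambda>z. \<phi> (f z)) has_field_derivative \<phi> D) (at z)"
      unfolding has_field_derivative_def by (simp add: mult.commute[of _ "\<phi> D"])
    then show ?thesis ..
  qed
  then show ?thesis by (simp add: holomorphic_on_open)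
qed

text \<open>The functional norms the value at the chosen \<open>w\<close> and is contractive
  elsewhere. So an estimate of \<open>norm (f w)\<close> by norms of \<open>f\<close> at other
  points follows from the scalar estimate for \<open>F\<close>.\<close>

lemma scalarize:
  fixes f :: "complex \<Rightarrow> 'a::complex_banach"
  assumes f: "analytic_disc f"
  obtains F where "F holomorphic_on ball 0 1" "\<And>z. cmod (F z) \<le> norm (f z)"
    "\<And>z z'. cmod (F z - F z') \<le> norm (f z - f z')" "cmod (F w) = norm (f w)"
proof -
  obtain \<phi> :: "'a \<Rightarrow> complex" where p: "\<And>x y. \<phi> (x + y) = \<phi> x + \<phi> y" "\<And>c x. \<phi> (c *\<^sub>C x) = c * \<phi> x"
    "\<And>x. cmod (\<phi> x) \<le> norm x" "cmod (\<phi> (f w)) = norm (f w)"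
    using norming_functional[of "f w"] by metis
  have "\<phi> x - \<phi> y = \<phi> (x - y)" for x y using p(1)[of "x - y" y] by simp
  then show ?thesis using that[of "\<lambda>z. \<phi> (f z)"] functional_holomorphic[OF f p(1-3)] p by simp
qed

text \<open>Here the functional norms a difference of two values, as a bound for the oscillation
  requires.\<close>

lemma scalarize_diff:
  fixes f :: "complex \<Rightarrow> 'a::complex_banach"
  assumes f: "analytic_disc f"
  obtains F where "F holomorphic_on ball 0 1" "\<And>z. cmod (F z) \<le> norm (f z)"
    "cmod (F w - F w') = norm (f w - f w')"
proof -
  obtain \<phi> :: "'a \<Rightarrow> complex" where p: "\<And>x y. \<phi> (x + y) = \<phi> x + \<phi> y" "\<And>c x. \<phi> (c *\<^sub>C x) = c * \<phi> x"
    "\<And>x. cmod (\<phi> x) \<le> norm x" "cmod (\<phi> (f w - f w')) = norm (f w - f w')"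
    using norming_functional[of "f w - f w'"] by metis
  have "\<phi> x - \<phi> y = \<phi> (x - y)" for x y using p(1)[of "x - y" y] by simp
  then show ?thesis using that[of "\<lambda>z. \<phi> (f z)"] functional_holomorphic[OF f p(1-3)] p by simp
qed

lemma analytic_disc_continuous:
  assumes "analytic_disc f" "S \<subseteq> ball 0 1"
  shows "continuous_on S f"
proof (rule continuous_at_imp_continuous_on, rule ballI)
  fix z assume "z \<in> S"
  then have "z \<in> ball 0 1" using assms(2) by blast
  from assms(1)[unfolded analytic_disc_def, rule_format, OF this]
  show "isCont f z" using has_derivative_continuous by blast
qed

text \<open>The divisor \<open>1 - cnj w * v\<close> has no zero in the disc and equals
  \<open>1 - (cmod w)\<^sup>2\<close> at \<open>v = w\<close>. A bound on the circle that
  deteriorates away from \<open>w\<close> thus becomes a bound at \<open>w\<close> in which the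
  weight is of the order of \<open>1 - cmod w\<close>.\<close>

lemma weighted_max_principle:
  fixes f :: "complex \<Rightarrow> 'a::complex_banach"
  assumes f: "analytic_disc f" and R: "R < 1" "cmod w < R"
    and B: "\<And>v. cmod v = R \<Longrightarrow> norm (f v) \<le> B * cmod (1 - cnj w * v) ^ N"
  shows "norm (f w) \<le> B * (1 - (cmod w)\<^sup>2) ^ N"
proof -
  obtain F where F: "F holomorphic_on ball 0 1" "\<And>z. cmod (F z) \<le> norm (f z)" "cmod (F w) = norm (f w)"
    using scalarize[OF f, of w] by metis
  have ne: "1 - cnj w * v \<noteq> 0" if "cmod v < 1" for v
  proof
    assume "1 - cnj w * v = 0"
    then have "cmod (cnj w * v) = 1" by simp
    moreover have "cmod w * cmod v < 1"
      using R that mult_left_le[of "cmod v" "cmod w"] by simp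
    ultimately show False by (simp add: norm_mult)
  qed
  let ?G = "\<lambda>v. F v / (1 - cnj w * v) ^ N"
  have hG: "?G holomorphic_on ball 0 1"
    using ne by (intro holomorphic_intros F) auto
  have "cmod (?G w) \<le> B"
  proof (rule maximum_modulus_frontier[of ?G "cball 0 R"])
    show "?G holomorphic_on interior (cball 0 R)"
      by (rule holomorphic_on_subset[OF hG]) (use R in auto)
    show "continuous_on (closure (cball 0 R)) ?G"
      using R by (intro holomorphic_on_imp_continuous_on holomorphic_on_subset[OF hG]) auto
    show "bounded (cball 0 R :: complex set)" by simp
    show "w \<in> cball 0 R" using R by simp
    fix z assume "z \<in> frontier (cball (0::complex) R)"
    then have z: "cmod z = R" by auto
    then have "cmod (F z) \<le> B * cmod (1 - cnj w * z) ^ N" using B[of z] F(2)[of z] by linarith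
    then show "cmod (?G z) \<le> B"
      using ne[of z] z R by (simp add: norm_divide norm_power field_simps)
  qed
  moreover have "cmod (1 - cnj w * w) = 1 - (cmod w)\<^sup>2"
  proof -
    have "1 - cnj w * w = complex_of_real (1 - (cmod w)\<^sup>2)"
      by (metis complex_norm_square mult.commute of_real_1 of_real_diff of_real_power)
    moreover have "1 - (cmod w)\<^sup>2 \<ge> 0" using R abs_square_le_1[of "cmod w"] by simp
    ultimately show ?thesis by (metis norm_of_real abs_of_nonneg)
  qed
  moreover have "0 < cmod (1 - cnj w * w)" using ne[of w] R by simp
  ultimately show ?thesis
    using F(3) by (simp add: norm_divide norm_power pos_divide_le_eq del: right_minus_eq)
qed

text \<open>The difference of the squares of the two moduli is
  \<open>(1 - (cmod v)\<^sup>2) * (1 - (cmod w)\<^sup>2)\<close>. With both bounds, a multiple of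
  \<open>2 ^ l * cmod (1 - cnj w * v)\<close> majorises \<open>1 + 2 ^ l * cmod (v - w)\<close> as
  soon as \<open>1 - cmod w\<close> is at least of order \<open>1 / 2 ^ l\<close>.\<close>

lemma cmod_one_minus_cnj_mult:
  assumes "cmod v \<le> 1" "cmod w \<le> 1"
  shows "cmod (v - w) \<le> cmod (1 - cnj w * v)" "1 - cmod w \<le> cmod (1 - cnj w * v)"
proof -
  have "(cmod (1 - cnj w * v))\<^sup>2 - (cmod (v - w))\<^sup>2 = (1 - (cmod v)\<^sup>2) * (1 - (cmod w)\<^sup>2)"
    unfolding cmod_power2 by (simp add: algebra_simps power2_eq_square)
  moreover have "\<dots> \<ge> 0" using assms by (simp add: abs_square_le_1)
  ultimately have "(cmod (v - w))\<^sup>2 \<le> (cmod (1 - cnj w * v))\<^sup>2" by linarith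
  then show "cmod (v - w) \<le> cmod (1 - cnj w * v)" by (rule power2_le_imp_le) simp
  have "cmod (cnj w * v) \<le> cmod w" using assms mult_left_le[of "cmod v" "cmod w"] by (simp add: norm_mult)
  then show "1 - cmod w \<le> cmod (1 - cnj w * v)"
    using norm_triangle_ineq2[of 1 "cnj w * v"] unfolding norm_one by linarith
qed

lemma analytic_disc_lipschitz:
  fixes f :: "complex \<Rightarrow> 'a::complex_banach"
  assumes f: "analytic_disc f" and sub: "cball v \<rho> \<subseteq> ball 0 1" and \<rho>: "\<rho> > 0"
    and A: "\<And>z. z \<in> cball v \<rho> \<Longrightarrow> norm (f z) \<le> A" and v': "cmod (v' - v) \<le> \<rho> / 2"
  shows "norm (f v' - f v) \<le> 2 * A / \<rho> * cmod (v' - v)"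
proof -
  obtain F where F: "F holomorphic_on ball 0 1" "\<And>z. cmod (F z) \<le> norm (f z)"
    "cmod (F v' - F v) = norm (f v' - f v)"
    using scalarize_diff[OF f, of v' v] by metis
  have bound: "cmod (deriv F z) \<le> 2 * A / \<rho>" if z: "z \<in> cball v (\<rho> / 2)" for z
  proof -
    have s: "cball z (\<rho> / 2) \<subseteq> cball v \<rho>"
    proof
      fix y assume "y \<in> cball z (\<rho> / 2)"
      then show "y \<in> cball v \<rho>" using z dist_triangle[of v y z] by (simp add: dist_commute)
    qed
    have "cmod ((deriv ^^ 1) F z) \<le> fact 1 * A / (\<rho> / 2) ^ 1"
    proof (rule Cauchy_inequality)
      show "F holomorphic_on ball z (\<rho> / 2)"
        by (rule holomorphic_on_subset[OF F(1)]) (use s sub ball_subset_cball in blast)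
      show "continuous_on (cball z (\<rho> / 2)) F"
        by (rule holomorphic_on_imp_continuous_on, rule holomorphic_on_subset[OF F(1)]) (use s sub in blast)
      fix x assume "cmod (z - x) = \<rho> / 2"
      then have "x \<in> cball v \<rho>" using s by (auto simp: dist_norm)
      then show "cmod (F x) \<le> A" using A F(2) order_trans by blast
    qed (use \<rho> in auto)
    then show ?thesis by (simp add: mult.commute)
  qed
  have "cmod (F v' - F v) \<le> 2 * A / \<rho> * cmod (v' - v)"
  proof (rule field_differentiable_bound)
    show "convex (cball v (\<rho> / 2))" by simp
    fix z assume z: "z \<in> cball v (\<rho> / 2)"
    then have "z \<in> ball 0 1" using sub \<rho> by (auto simp: subset_iff)
    then show "(F has_field_derivative deriv F z) (at z within cball v (\<rho> / 2))"
      using F(1) by (meson holomorphic_derivI open_ball has_field_derivative_at_within)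
    show "cmod (deriv F z) \<le> 2 * A / \<rho>" by (rule bound[OF z])
  qed (use v' \<rho> in \<open>auto simp: dist_norm norm_minus_commute\<close>)
  then show ?thesis using F(3) by simp
qed

section \<open>Subharmonicity of powers of the norm\<close>

lemma powr_add_le:
  fixes x y t :: real
  assumes "0 \<le> x" "0 \<le> y" "0 \<le> t"
  shows "(x + y) powr t \<le> 2 powr t * (x powr t + y powr t)"
proof -
  have "(x + y) powr t \<le> (2 * max x y) powr t"
    using assms by (intro powr_mono2) auto
  also have "\<dots> = 2 powr t * (max x y) powr t" using assms by (simp add: powr_mult)
  also have "(max x y) powr t \<le> x powr t + y powr t" by (auto simp: max_def)
  finally show ?thesis by simp
qed

text \<open>Induction on both coefficient lists: on the circle \<open>z * cnj z = 1\<close> lowers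
  both degrees at once, and conjugating a mixed term leaves its real part unchanged. It makes the
  real parts of polynomials closed under products, as \<open>Re u * Re v\<close> is half of
  \<open>Re (u * v) + Re (u * cnj v)\<close>.\<close>

lemma Re_poly_mult_cnj:
  "\<exists>r. \<forall>z. cmod z = 1 \<longrightarrow> Re (poly p z * cnj (poly q z)) = Re (poly r z)"
proof (induction p q rule: poly_induct2)
  case 0
  show ?case by (rule exI[of _ 0]) simp
next
  case (pCons a p b q)
  then obtain r where r: "\<And>z. cmod z = 1 \<Longrightarrow> Re (poly p z * cnj (poly q z)) = Re (poly r z)" by blast
  let ?r = "[:a * cnj b:] + smult (cnj a) (pCons 0 q) + smult (cnj b) (pCons 0 p) + r"
  have "Re (poly (pCons a p) z * cnj (poly (pCons b q) z)) = Re (poly ?r z)" if z: "cmod z = 1" for z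
  proof -
    have zz: "z * cnj z = 1" using z complex_norm_square[of z] by simp
    have "poly (pCons a p) z * cnj (poly (pCons b q) z) =
      a * cnj b + cnj (cnj a * (z * poly q z)) + cnj b * (z * poly p z)
        + (z * cnj z) * (poly p z * cnj (poly q z))"
      by (simp add: algebra_simps)
    also have "Re \<dots> = Re (poly ?r z)" unfolding zz using r[OF z] by (simp add: algebra_simps)
    finally show ?thesis .
  qed
  then show ?case by blast
qed

text \<open>Stone--Weierstrass for the real parts of polynomials, which on the circle are the real
  trigonometric polynomials. What matters about the approximants is that each is the real part of a
  function holomorphic inside.\<close>

lemma Re_poly_dense_circle:
  fixes h :: "complex \<Rightarrow> real"
  assumes h: "continuous_on (sphere 0 1) h" and e: "e > 0"
  obtains p where "\<And>z. cmod z = 1 \<Longrightarrow> \<bar>h z - Re (poly p z)\<bar> < e"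
proof -
  define P where "P = (\<lambda>h. \<exists>p. \<forall>z\<in>sphere 0 1. h z = Re (poly p z))"
  have "\<exists>g. P g \<and> (\<forall>z\<in>sphere 0 1. \<bar>h z - g z\<bar> < e)"
  proof (rule Stone_Weierstrass_HOL)
    show "P (\<lambda>x. c)" for c unfolding P_def by (intro exI[of _ "[:complex_of_real c:]"]) simp
    show "continuous_on (sphere 0 1) f" if f: "P f" for f
    proof -
      obtain p where p: "\<And>z. z \<in> sphere 0 1 \<Longrightarrow> f z = Re (poly p z)" using f unfolding P_def by auto
      have "continuous_on (sphere 0 1) (\<lambda>z. Re (poly p z))" by (intro continuous_intros)
      then show ?thesis by (rule continuous_on_eq) (use p in auto)
    qed
    show "P (\<lambda>x. f x + g x)" if fg: "P f \<and> P g" for f g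
    proof -
      obtain p where p: "\<And>z. z \<in> sphere 0 1 \<Longrightarrow> f z = Re (poly p z)" using fg unfolding P_def by auto
      obtain q where q: "\<And>z. z \<in> sphere 0 1 \<Longrightarrow> g z = Re (poly q z)" using fg unfolding P_def by auto
      show ?thesis unfolding P_def using p q by (intro exI[of _ "p + q"]) simp
    qed
    show "P (\<lambda>x. f x * g x)" if fg: "P f \<and> P g" for f g
    proof -
      obtain p where p: "\<And>z. z \<in> sphere 0 1 \<Longrightarrow> f z = Re (poly p z)" using fg unfolding P_def by auto
      obtain q where q: "\<And>z. z \<in> sphere 0 1 \<Longrightarrow> g z = Re (poly q z)" using fg unfolding P_def by auto
      obtain r where r: "\<And>z. cmod z = 1 \<Longrightarrow> Re (poly p z * cnj (poly q z)) = Re (poly r z)"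
        using Re_poly_mult_cnj by blast
      have "f z * g z = Re (poly (smult (1/2) (p * q + r)) z)" if "z \<in> sphere 0 1" for z
        using p[OF that] q[OF that] r[of z] that by (simp add: field_simps)
      then show ?thesis unfolding P_def by blast
    qed
    show "\<exists>f. P f \<and> f x \<noteq> f y" if "x \<in> sphere 0 1 \<and> y \<in> sphere 0 1 \<and> x \<noteq> y" for x y :: complex
    proof -
      have "P Re" unfolding P_def by (intro exI[of _ "[:0, 1:]"]) simp
      moreover have "P Im" unfolding P_def by (intro exI[of _ "[:0, - \<i>:]"]) simp
      ultimately show ?thesis using that complex_eq_iff by blast
    qed
  qed (use h e in auto)
  then obtain g p where gp: "\<forall>z\<in>sphere 0 1. \<bar>h z - g z\<bar> < e" "\<forall>z\<in>sphere 0 1. g z = Re (poly p z)"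
    unfolding P_def by blast
  show ?thesis
  proof (rule that)
    fix z :: complex assume "cmod z = 1"
    then have "z \<in> sphere 0 1" by simp
    then show "\<bar>h z - Re (poly p z)\<bar> < e" using gp by metis
  qed
qed

lemma continuous_zeta [continuous_intros]:
  "continuous_on A g \<Longrightarrow> continuous_on A (\<lambda>x. zeta (g x))"
  unfolding zeta_def by (intro continuous_intros)

lemma norm_zeta [simp]: "cmod (zeta x) = 1"
  by (simp add: zeta_def)

lemma circlepath_zeta: "circlepath z r x = z + r * zeta x"
  by (simp add: circlepath zeta_def cis_conv_exp mult_ac)

text \<open>The Cauchy kernel is replaced by its crude maximum \<open>1 / (1 - cmod w)\<close>. The
  loss is harmless, since the bound serves only points well inside a circle and polynomial growth
  estimates.\<close>

lemma Cauchy_circle_bound: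
  assumes H: "continuous_on (cball 0 1) H" "H holomorphic_on ball 0 1" and w: "cmod w < 1"
  shows "cmod (H w) \<le> 1 / (1 - cmod w) * integral {0..1} (\<lambda>x. cmod (H (zeta x)))"
proof -
  have "((\<lambda>u. H u / (u - w)) has_contour_integral (2 * of_real pi * \<i> * H w)) (circlepath 0 1)"
    using Cauchy_integral_circlepath[OF H(1,2)] w by simp
  then have I: "((\<lambda>x. H (zeta x) / (zeta x - w) * (2 * pi * \<i> * zeta x)) has_integral (2 * of_real pi * \<i> * H w)) {0..1}"
    unfolding has_contour_integral
    by (rule has_integral_eq[rotated]) (simp add: circlepath_zeta vector_derivative_circlepath zeta_def cis_conv_exp mult_ac)
  have int: "(\<lambda>x. cmod (H (zeta x))) integrable_on {0..1}"
    by (intro integrable_continuous_interval continuous_intros continuous_on_compose2[OF H(1)]) auto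
  have "cmod (2 * of_real pi * \<i> * H w) \<le> integral {0..1} (\<lambda>x. 2 * pi / (1 - cmod w) * cmod (H (zeta x)))"
  proof (subst integral_unique[OF I, symmetric], rule integral_norm_bound_integral)
    show "(\<lambda>x. 2 * pi / (1 - cmod w) * cmod (H (zeta x))) integrable_on {0..1}"
      by (rule integrable_on_mult_right[OF int])
    fix x
    have "1 - cmod w \<le> cmod (zeta x - w)" using norm_triangle_ineq2[of "zeta x" w] by simp
    then have "cmod (H (zeta x)) / cmod (zeta x - w) \<le> cmod (H (zeta x)) / (1 - cmod w)"
      using w by (intro divide_left_mono mult_pos_pos) auto
    then have "2 * pi * (cmod (H (zeta x)) / cmod (zeta x - w)) \<le> 2 * pi * (cmod (H (zeta x)) / (1 - cmod w))"
      by (intro mult_left_mono) auto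
    then show "cmod (H (zeta x) / (zeta x - w) * (2 * pi * \<i> * zeta x)) \<le> 2 * pi / (1 - cmod w) * cmod (H (zeta x))"
      by (simp add: norm_mult norm_divide mult_ac)
  qed (use I in \<open>auto simp: integrable_on_def\<close>)
  then have "2 * pi * cmod (H w) \<le> 2 * pi * (1 / (1 - cmod w) * integral {0..1} (\<lambda>x. cmod (H (zeta x))))"
    by (simp add: norm_mult)
  then show ?thesis by (subst (asm) mult_le_cancel_left_pos) auto
qed

text \<open>The subharmonicity of \<open>|F|\<^sup>t\<close> also for \<open>t < 1\<close>: \<open>log (|F| + \<epsilon>)\<close> on the circle is nearly the real
  part of a polynomial \<open>p\<close>, so that \<open>|F|\<close> is dominated by the zero-free \<open>exp p\<close>, of which any power is
  holomorphic.\<close>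

lemma circle_mean_scalar:
  assumes F: "continuous_on (cball 0 1) F" "F holomorphic_on ball 0 1" and w: "cmod w < 1" and t: "t > 0"
  shows "cmod (F w) powr t \<le> 2 powr t / (1 - cmod w) * integral {0..1} (\<lambda>x. cmod (F (zeta x)) powr t)"
proof -
  define I where "I = integral {0..1} (\<lambda>x. cmod (F (zeta x)) powr t)"
  have cF: "continuous_on {0..1} (\<lambda>x. cmod (F (zeta x)))"
    by (intro continuous_intros continuous_on_compose2[OF F(1)]) auto
  have cFt: "continuous_on {0..1} (\<lambda>x. cmod (F (zeta x)) powr t)"
    by (rule continuous_on_powr'[OF cF continuous_on_const]) (use t in auto)
  \<comment> \<open>The summand \<open>e\<close> keeps the logarithm continuous at zeros of
    \<open>F\<close> on the circle and is at the same time the approximation error. The error is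
    spent twice, for \<open>F\<close> against \<open>exp p\<close> and back, whence the factor
    \<open>exp (2 * t * e)\<close>, which tends to 1.\<close>
  have main: "cmod (F w) powr t \<le> exp (2 * t * e) * (2 powr t / (1 - cmod w) * (I + e powr t))" if e: "e > 0" for e
  proof -
    have pos: "cmod (F z) + e > 0" for z using e by (simp add: add_nonneg_pos)
    have "continuous_on (sphere 0 1) (\<lambda>z. ln (cmod (F z) + e))"
      using pos by (intro continuous_intros continuous_on_subset[OF F(1)]) (auto simp: less_imp_neq[OF pos, symmetric])
    then obtain p where p: "\<And>z. cmod z = 1 \<Longrightarrow> \<bar>ln (cmod (F z) + e) - Re (poly p z)\<bar> < e"
      using Re_poly_dense_circle e by blast
    let ?Q = "\<lambda>z. F z / exp (poly p z)"
    have "cmod (?Q w) \<le> exp e"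
    proof (rule maximum_modulus_frontier[of ?Q "cball 0 1"])
      show "?Q holomorphic_on interior (cball 0 1)" using F(2) by (auto intro!: holomorphic_intros)
      show "continuous_on (closure (cball 0 1)) ?Q" using F(1) by (auto intro!: continuous_intros)
      fix z :: complex assume "z \<in> frontier (cball 0 1)"
      then have z: "cmod z = 1" by auto
      have "cmod (F z) \<le> exp (ln (cmod (F z) + e))" using pos[of z] e by simp
      also have "\<dots> \<le> exp (e + Re (poly p z))" using p[OF z] by simp
      finally show "cmod (?Q z) \<le> exp e" by (simp add: norm_divide exp_add field_simps)
    qed (use w in auto)
    then have 1: "cmod (F w) \<le> exp (e + Re (poly p w))"
      by (simp add: norm_divide exp_add field_simps)
    let ?G = "\<lambda>z. exp (t * poly p z)"
    have 2: "cmod (?G w) \<le> 1 / (1 - cmod w) * integral {0..1} (\<lambda>x. cmod (?G (zeta x)))"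
      by (rule Cauchy_circle_bound[OF _ _ w]) (auto intro!: continuous_intros holomorphic_intros)
    have cG: "continuous_on {0..1} (\<lambda>x. cmod (?G (zeta x)))" by (intro continuous_intros)
    have 3: "integral {0..1} (\<lambda>x. cmod (?G (zeta x))) \<le>
        integral {0..1} (\<lambda>x. exp (t * e) * (2 powr t * (cmod (F (zeta x)) powr t + e powr t)))"
    proof (rule integral_le)
      show "(\<lambda>x. cmod (?G (zeta x))) integrable_on {0..1}" by (rule integrable_continuous_interval[OF cG])
      show "(\<lambda>x. exp (t * e) * (2 powr t * (cmod (F (zeta x)) powr t + e powr t))) integrable_on {0..1}"
        by (intro integrable_continuous_interval continuous_intros cFt)
      fix x :: real
      have "t * Re (poly p (zeta x)) \<le> t * (e + ln (cmod (F (zeta x)) + e))"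
        using p[of "zeta x"] t by (intro mult_left_mono) auto
      then have "cmod (?G (zeta x)) \<le> exp (t * e) * exp (t * ln (cmod (F (zeta x)) + e))"
        by (simp add: exp_add[symmetric] algebra_simps)
      also have "exp (t * ln (cmod (F (zeta x)) + e)) = (cmod (F (zeta x)) + e) powr t"
        using pos[of "zeta x"] by (simp add: powr_def)
      also have "\<dots> \<le> 2 powr t * (cmod (F (zeta x)) powr t + e powr t)"
        using e t by (intro powr_add_le) auto
      finally show "cmod (?G (zeta x)) \<le> exp (t * e) * (2 powr t * (cmod (F (zeta x)) powr t + e powr t))" by simp
    qed
    have 4: "integral {0..1} (\<lambda>x. exp (t * e) * (2 powr t * (cmod (F (zeta x)) powr t + e powr t)))
        = exp (t * e) * (2 powr t * (I + e powr t))"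
      using integral_add[OF integrable_continuous_interval[OF cFt] integrable_const_ivl[of "e powr t" 0 1]]
      unfolding I_def by simp
    have "cmod (F w) powr t \<le> exp (e + Re (poly p w)) powr t" using 1 t by (intro powr_mono2) auto
    also have "\<dots> = exp (t * e) * cmod (?G w)" by (simp add: powr_def exp_add[symmetric] algebra_simps)
    also have "\<dots> \<le> exp (t * e) * (1 / (1 - cmod w) * (exp (t * e) * (2 powr t * (I + e powr t))))"
      using 2 3 4 w by (intro mult_left_mono order_trans[OF 2]) auto
    also have "\<dots> = (exp (t * e) * exp (t * e)) * (2 powr t / (1 - cmod w) * (I + e powr t))" by (simp add: field_simps)
    also have "exp (t * e) * exp (t * e) = exp (2 * t * e)" by (simp add: exp_add[symmetric])
    finally show ?thesis .
  qed
  have "((\<lambda>e. exp (2 * t * e) * (2 powr t / (1 - cmod w) * (I + e powr t))) \<longlongrightarrow>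
      exp (2 * t * 0) * (2 powr t / (1 - cmod w) * (I + 0))) (at_right 0)"
  proof (intro tendsto_intros)
    have "((\<lambda>e. e powr t) \<longlongrightarrow> 0 powr t) (at_right (0::real))"
      by (rule tendsto_powr2[OF tendsto_ident_at tendsto_const]) (use t in \<open>auto simp: eventually_at_filter\<close>)
    then show "((\<lambda>e. e powr t) \<longlongrightarrow> 0) (at_right (0::real))" by simp
  qed
  then have "cmod (F w) powr t \<le> exp (2 * t * 0) * (2 powr t / (1 - cmod w) * (I + 0))"
    by (rule tendsto_lowerbound) (use main in \<open>auto simp: eventually_at_filter\<close>)
  then show ?thesis unfolding I_def by simp
qed

text \<open>The point \<open>w\<close> may lie off the centre: the average over discs keeps
  \<open>w\<close> fixed and moves the centre, and the growth estimate evaluates at points close to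
  the circle. The constant is that of the unit disc after rescaling.\<close>

lemma circle_mean:
  fixes f :: "complex \<Rightarrow> 'a::complex_banach"
  assumes f: "analytic_disc f" and sub: "cball z \<rho> \<subseteq> ball 0 1" and w: "cmod (w - z) < \<rho>" and t: "t > 0"
  shows "norm (f w) powr t \<le> 2 powr t * \<rho> / (\<rho> - cmod (w - z)) * integral {0..1} (\<lambda>x. norm (f (z + \<rho> * zeta x)) powr t)"
proof -
  have \<rho>: "\<rho> > 0" using w norm_ge_zero order_le_less_trans by blast
  obtain F where F: "F holomorphic_on ball 0 1" "\<And>z. cmod (F z) \<le> norm (f z)" "cmod (F w) = norm (f w)"
    using scalarize[OF f, of w] by metis
  let ?H = "\<lambda>u::complex. F (z + \<rho> * u)"
  have im: "(\<lambda>u::complex. z + \<rho> * u) ` cball 0 1 \<subseteq> ball 0 1"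
  proof -
    have "z + \<rho> * u \<in> cball z \<rho>" if "u \<in> cball 0 1" for u :: complex
      using that \<rho> by (auto simp: dist_norm norm_mult mult_left_le)
    then show ?thesis using sub by blast
  qed
  have hol: "?H holomorphic_on cball 0 1"
    by (rule holomorphic_on_compose_gen[OF _ F(1) im, unfolded o_def]) (intro holomorphic_intros)
  let ?w = "(w - z) / \<rho>"
  have cont: "continuous_on {0..1} (\<lambda>x. norm (F (z + \<rho> * zeta x)))" "continuous_on {0..1} (\<lambda>x. norm (f (z + \<rho> * zeta x)))"
    using im by (intro continuous_intros continuous_on_compose2[OF holomorphic_on_imp_continuous_on[OF F(1)]]
      continuous_on_compose2[OF analytic_disc_continuous[OF f order_refl]]; force)+
  have "cmod (?H ?w) powr t \<le> 2 powr t / (1 - cmod ?w) * integral {0..1} (\<lambda>x. cmod (?H (zeta x)) powr t)"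
  proof (rule circle_mean_scalar[OF _ _ _ t])
    show "continuous_on (cball 0 1) ?H" using hol by (rule holomorphic_on_imp_continuous_on)
    show "?H holomorphic_on ball 0 1" using hol by (rule holomorphic_on_subset) auto
  qed (use w \<rho> in \<open>auto simp: norm_divide\<close>)
  also have "?H ?w = F w" using \<rho> by simp
  also have "2 powr t / (1 - cmod ?w) * integral {0..1} (\<lambda>x. cmod (?H (zeta x)) powr t) \<le>
    2 powr t / (1 - cmod ?w) * integral {0..1} (\<lambda>x. norm (f (z + \<rho> * zeta x)) powr t)"
  proof (intro mult_left_mono integral_le integrable_continuous_interval continuous_on_powr' cont continuous_on_const powr_mono2 F(2))
    show "0 \<le> 2 powr t / (1 - cmod ?w)" using w \<rho> by (simp add: norm_divide)
  qed (use t in auto)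
  also have "2 powr t / (1 - cmod ?w) = 2 powr t * \<rho> / (\<rho> - cmod (w - z))"
    using \<rho> w by (simp add: norm_divide field_simps)
  finally show ?thesis using F(3) by simp
qed

section \<open>Weighted sums over dyadic trees\<close>

text \<open>Young's inequality for \<open>x / \<mu>\<close> and \<open>\<mu> * y\<close>, with
  \<open>\<mu>\<close> chosen so that the second term carries the factor \<open>\<eta>\<close>. Its
  purpose is to move a small multiple of the second term to the other side.\<close>

lemma Young_absorb:
  fixes \<theta> \<eta> :: real
  assumes "\<theta> > 1" "\<eta> > 0"
  obtains C where "C \<ge> 0" "\<And>x y. 0 \<le> x \<Longrightarrow> 0 \<le> y \<Longrightarrow> x * y \<le> C * x powr \<theta> + \<eta> * y powr (\<theta> / (\<theta> - 1))"
proof -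
  define r where "r = \<theta> / (\<theta> - 1)"
  have r: "r > 1" "1 / \<theta> + 1 / r = 1" using assms by (auto simp: r_def field_simps)
  define \<mu> where "\<mu> = \<eta> powr (1 / r)"
  have \<mu>: "\<mu> > 0" "\<mu> powr r = \<eta>" using assms r by (auto simp: \<mu>_def powr_powr)
  show ?thesis
  proof (rule that[of "(1 / \<mu>) powr \<theta>"])
    fix x y :: real assume xy: "0 \<le> x" "0 \<le> y"
    have "x * y = (1 / \<mu> * x) * (\<mu> * y)" using \<mu> by simp
    also have "\<dots> \<le> (1 / \<mu> * x) powr \<theta> / \<theta> + (\<mu> * y) powr r / r"
      using assms r xy \<mu> by (intro Youngs_inequality) auto
    also have "\<dots> \<le> (1 / \<mu> * x) powr \<theta> + (\<mu> * y) powr r"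
      using assms r by (intro add_mono) (simp_all add: divide_le_eq mult_le_cancel_left1)
    also have "\<dots> = (1 / \<mu>) powr \<theta> * x powr \<theta> + \<eta> * y powr r"
      using xy \<mu> by (simp add: powr_mult powr_divide)
    finally show "x * y \<le> (1 / \<mu>) powr \<theta> * x powr \<theta> + \<eta> * y powr (\<theta> / (\<theta> - 1))" unfolding r_def .
  qed simp
qed

text \<open>The discrete form of the relation between \<open>ds\<close> and
  \<open>d(s powr \<theta>)\<close>, by the weighted arithmetic-geometric mean of \<open>s'\<close>
  and \<open>s\<close>.\<close>

lemma diff_le_powr_diff:
  fixes s s' \<theta> :: real
  assumes "0 \<le> s'" "s' \<le> s" "0 < \<theta>" "\<theta> \<le> 1"
  shows "s - s' \<le> 1 / \<theta> * (s powr \<theta> - s' powr \<theta>) * s powr (1 - \<theta>)"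
proof (cases "s' = 0")
  case True
  then show ?thesis using assms mult_right_mono[of 1 "1 / \<theta>" s]
    by (cases "s = 0") (simp_all add: powr_add[symmetric] field_simps)
next
  case False
  then have pos: "s' > 0" "s > 0" using assms by auto
  have "s' powr \<theta> * s powr (1 - \<theta>) \<le> \<theta> * s' + (1 - \<theta>) * s"
    using Youngs_inequality_0[of \<theta> "1 - \<theta>" s' s] pos assms by simp
  moreover have "s powr \<theta> * s powr (1 - \<theta>) = s" using pos by (simp add: powr_add[symmetric])
  ultimately have "\<theta> * (s - s') \<le> (s powr \<theta> - s' powr \<theta>) * s powr (1 - \<theta>)" by (simp add: algebra_simps)
  then show ?thesis using assms by (simp add: field_simps)
qed

text \<open>The discrete form of \<open>d(m powr r) = r / (r - 1) * m * d(m powr (r - 1))\<close>,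
  again by a weighted arithmetic-geometric mean. With the factor \<open>a\<close> in front, a block
  average can stand in its place in the maximal inequality.\<close>

lemma powr_diff_le_mult:
  fixes a b r :: real
  assumes "0 \<le> b" "b \<le> a" "r > 1"
  shows "a powr r - b powr r \<le> r / (r - 1) * a * (a powr (r - 1) - b powr (r - 1))"
proof (cases "b = 0")
  case True
  have "a * a powr (r - 1) = a powr r" using assms powr_mult_base[of a "r - 1"] by simp
  moreover have "1 * a powr r \<le> r / (r - 1) * a powr r" using assms by (intro mult_right_mono) (auto simp: field_simps)
  ultimately show ?thesis using True assms by (simp add: mult.assoc)
next
  case False
  then have pos: "b > 0" "a > 0" using assms by auto
  have "(b powr r) powr ((r - 1) / r) * (a powr r) powr (1 / r) \<le> (r - 1) / r * b powr r + 1 / r * a powr r"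
    using pos assms by (intro Youngs_inequality_0) (auto simp: field_simps)
  then have "b powr (r - 1) * a \<le> (r - 1) / r * b powr r + 1 / r * a powr r"
    using pos assms by (simp add: powr_powr)
  then have "r * (b powr (r - 1) * a) \<le> r * ((r - 1) / r * b powr r + 1 / r * a powr r)"
    using assms by (intro mult_left_mono) auto
  also have "\<dots> = (r - 1) * b powr r + a powr r" using assms by (simp add: field_simps)
  finally have "(r - 1) * (a powr r - b powr r) \<le> r * (a powr r - b powr (r - 1) * a)" by (simp add: algebra_simps)
  moreover have "a * a powr (r - 1) = a powr r" using pos assms powr_mult_base[of a "r - 1"] by simp
  moreover have "r * a * (a powr (r - 1) - b powr (r - 1)) = r * (a * a powr (r - 1) - b powr (r - 1) * a)"
    by (simp add: algebra_simps)
  ultimately have "(r - 1) * (a powr r - b powr r) \<le> r * a * (a powr (r - 1) - b powr (r - 1))"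
    by (simp only:)
  then have "(a powr r - b powr r) \<le> (r * a * (a powr (r - 1) - b powr (r - 1))) / (r - 1)"
    using assms by (subst pos_le_divide_eq) (auto simp: mult.commute)
  then show ?thesis by simp
qed

text \<open>The node \<open>k\<close> of level \<open>L\<close> has the children \<open>2 k\<close> and \<open>2 k + 1\<close>; seen from level \<open>N\<close> it is the set of the
  \<open>2\<^sup>N\<^sup>-\<^sup>L\<close> leaves \<open>i\<close> with \<open>i div 2 ^ (N - L) = k\<close>.\<close>

definition block :: "nat \<Rightarrow> nat \<Rightarrow> nat \<Rightarrow> nat set" where
  "block N L k = {i. i < 2 ^ N \<and> i div 2 ^ (N - L) = k}"

lemma finite_block [simp]: "finite (block N L k)"
  by (rule finite_subset[of _ "{..<2 ^ N}"]) (auto simp: block_def)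

lemma div_level_less: "L \<le> N \<Longrightarrow> i < 2 ^ N \<Longrightarrow> i div 2 ^ (N - L) < (2::nat) ^ L"
  by (rule less_mult_imp_div_less) (simp flip: power_add)

lemma div_level_div: "l \<le> L \<Longrightarrow> L \<le> N \<Longrightarrow> i div 2 ^ (N - L) div 2 ^ (L - l) = i div (2::nat) ^ (N - l)"
  by (simp flip: div_mult2_eq power_add)

lemma card_block:
  assumes "L \<le> N" "k < 2 ^ L"
  shows "card (block N L k) = 2 ^ (N - L)"
proof -
  let ?m = "2 ^ (N - L) :: nat"
  have N: "2 ^ N = 2 ^ L * ?m" using assms by (simp flip: power_add)
  have "block N L k = {k * ?m..<(k + 1) * ?m}"
  proof (rule set_eqI)
    fix i
    have "i div ?m = k \<longleftrightarrow> k * ?m \<le> i \<and> i < (k + 1) * ?m"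
      by (auto simp: div_nat_eqI mult.commute dividend_less_times_div dividend_less_div_times intro: div_nat_eqI)
    moreover have "(k + 1) * ?m \<le> 2 ^ N" unfolding N using assms by (intro mult_right_mono) auto
    ultimately show "i \<in> block N L k \<longleftrightarrow> i \<in> {k * ?m..<(k + 1) * ?m}" unfolding block_def by auto
  qed
  then show ?thesis by (simp add: algebra_simps)
qed

lemma sum_blocks:
  fixes h :: "nat \<Rightarrow> nat \<Rightarrow> real"
  assumes "L \<le> N"
  shows "(\<Sum>i<2 ^ N. h (i div 2 ^ (N - L)) i) = (\<Sum>k<2 ^ L. \<Sum>i\<in>block N L k. h k i)"
proof -
  have "(\<Sum>i<2 ^ N. h (i div 2 ^ (N - L)) i) =
     (\<Sum>k<2 ^ L. \<Sum>i\<in>{i \<in> {..<2 ^ N}. i div 2 ^ (N - L) = k}. h (i div 2 ^ (N - L)) i)"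
    by (rule sum.group[symmetric]) (use assms div_level_less in auto)
  also have "\<dots> = (\<Sum>k<2 ^ L. \<Sum>i\<in>block N L k. h k i)"
    unfolding block_def by (intro sum.cong) auto
  finally show ?thesis .
qed

lemma sum_div_level:
  fixes h :: "nat \<Rightarrow> real"
  assumes "L \<le> N"
  shows "(\<Sum>i<2 ^ N. h (i div 2 ^ (N - L))) = (\<Sum>k<2 ^ L. 2 ^ (N - L) * h k)"
  using sum_blocks[OF assms, of "\<lambda>k i. h k"] by (simp add: card_block[OF assms])

text \<open>The parent of \<open>k\<close> is \<open>k div 2\<close>, and the value above the root
  counts as 0, so that the increments along a branch add up to \<open>F\<close> itself.\<close>

definition incr :: "(nat \<Rightarrow> nat \<Rightarrow> real) \<Rightarrow> nat \<Rightarrow> nat \<Rightarrow> real" where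
  "incr F L k = F L k - (case L of 0 \<Rightarrow> 0 | Suc l \<Rightarrow> F l (k div 2))"

lemma telescope_incr: "(\<Sum>l\<le>L. incr F l (k div 2 ^ (L - l))) = F L k"
proof (induction L arbitrary: k)
  case 0
  show ?case by (simp add: incr_def)
next
  case (Suc L)
  have "(\<Sum>l\<le>L. incr F l (k div 2 ^ (Suc L - l))) = (\<Sum>l\<le>L. incr F l (k div 2 div 2 ^ (L - l)))"
    by (intro sum.cong refl) (simp add: Suc_diff_le div_mult2_eq[symmetric])
  then show ?case using Suc[of "k div 2"] by (simp add: incr_def)
qed

lemma sum_incr:
  "(\<Sum>i<2 ^ N. F N i) = (\<Sum>L\<le>N. \<Sum>k<2 ^ L. 2 ^ (N - L) * incr F L k)"
proof -
  have "(\<Sum>i<2 ^ N. F N i) = (\<Sum>i<2 ^ N. \<Sum>L\<le>N. incr F L (i div 2 ^ (N - L)))"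
    by (simp only: telescope_incr)
  also have "\<dots> = (\<Sum>L\<le>N. \<Sum>i<2 ^ N. incr F L (i div 2 ^ (N - L)))"
    by (rule sum.swap)
  finally have "(\<Sum>i<2 ^ N. F N i) = (\<Sum>L\<le>N. \<Sum>i<2 ^ N. incr F L (i div 2 ^ (N - L)))" .
  then show ?thesis by (simp add: sum_div_level)
qed

lemma abs_div_diff_le:
  fixes a b n :: nat
  shows "\<bar>real (a div n) - real (b div n)\<bar> \<le> \<bar>real a - real b\<bar>"
proof -
  have *: "real (a div n) - real (b div n) \<le> real a - real b" if "b \<le> a" for a b :: nat
  proof (cases "n = 0")
    case False
    have "a div n + b \<le> b div n + a"
    proof -
      have "a div n = (b + (a - b)) div n" using that by simp
      also have "\<dots> \<le> b div n + (a - b)"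
      proof -
        have "(b + (a - b)) div n \<le> (b + (a - b) * n) div n"
          using False by (intro div_le_mono) auto
        then show ?thesis using False by simp
      qed
      finally show ?thesis using that by linarith
    qed
    then show ?thesis by linarith
  qed (use that in simp)
  have m: "b div n \<le> a div n" if "b \<le> a" for a b using that by (rule div_le_mono)
  show ?thesis
  proof (cases "b \<le> a")
    case True
    then show ?thesis using *[OF True] m[OF True] by linarith
  next
    case False
    then have "a \<le> b" by simp
    then show ?thesis using *[of a b] m[of a b] by linarith
  qed
qed

lemma abs_div_diff_le_one:
  fixes a b n :: nat
  assumes "\<bar>real a - real b\<bar> < real n"
  shows "\<bar>real (a div n) - real (b div n)\<bar> \<le> 1"
proof -
  have *: "a div n \<le> b div n + 1" if "a < b + n" for a b
  proof -
    have "a div n \<le> (b + n) div n" using that by (intro div_le_mono) auto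
    then show ?thesis using that assms by (cases "n = 0") auto
  qed
  show ?thesis using *[of a b] *[of b a] assms by linarith
qed

text \<open>A substitute for a maximal function that is linear in the increments: it dominates every
  weighted value of \<open>F\<close> when the increments are nonnegative, and it can still be summed
  over the leaves term by term.\<close>

definition tree_maximal :: "(real \<Rightarrow> real) \<Rightarrow> (nat \<Rightarrow> nat \<Rightarrow> real) \<Rightarrow> nat \<Rightarrow> nat \<Rightarrow> real" where
  "tree_maximal \<omega> F N i = (\<Sum>L\<le>N. \<Sum>k<2 ^ L. \<omega> \<bar>real k - real (i div 2 ^ (N - L))\<bar> * incr F L k)"

context
  fixes \<omega> :: "real \<Rightarrow> real" and F :: "nat \<Rightarrow> nat \<Rightarrow> real"
  assumes \<omega>_nonneg: "\<And>d. 0 \<le> \<omega> d" and antimono: "antimono_on {0..} \<omega>"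
    and incr_nonneg: "\<And>L k. 0 \<le> incr F L k"
begin

lemma tree_maximal_nonneg: "0 \<le> tree_maximal \<omega> F N i"
  unfolding tree_maximal_def by (intro sum_nonneg mult_nonneg_nonneg \<omega>_nonneg incr_nonneg)

text \<open>Telescoping replaces \<open>F L k\<close> by the increments at the ancestors of
  \<open>k\<close>. Passing to ancestors does not increase index distances, so an antitone weight
  only grows, and the ancestors contribute one term per level of the full sum.\<close>

lemma le_tree_maximal:
  assumes "L \<le> N" "k < 2 ^ L"
  shows "\<omega> \<bar>real k - real (i div 2 ^ (N - L))\<bar> * F L k \<le> tree_maximal \<omega> F N i"
proof -
  let ?W = "\<omega> \<bar>real k - real (i div 2 ^ (N - L))\<bar>"
  have "?W * F L k = (\<Sum>l\<le>L. ?W * incr F l (k div 2 ^ (L - l)))"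
    unfolding sum_distrib_left[symmetric] telescope_incr ..
  also have "\<dots> \<le> (\<Sum>l\<le>L. \<Sum>k'<2 ^ l. \<omega> \<bar>real k' - real (i div 2 ^ (N - l))\<bar> * incr F l k')"
  proof (rule sum_mono)
    fix l assume "l \<in> {..L}"
    then have l: "l \<le> L" by simp
    let ?k = "k div 2 ^ (L - l)"
    have "?k < 2 ^ l" using div_level_less[OF l assms(2)] .
    have "?W * incr F l ?k \<le> \<omega> \<bar>real ?k - real (i div 2 ^ (N - l))\<bar> * incr F l ?k"
      using abs_div_diff_le[of k "2 ^ (L - l)" "i div 2 ^ (N - L)"] div_level_div[OF l assms(1), of i]
      by (intro mult_right_mono incr_nonneg monotone_onD[OF antimono]) auto
    also have "\<dots> \<le> (\<Sum>k'<2 ^ l. \<omega> \<bar>real k' - real (i div 2 ^ (N - l))\<bar> * incr F l k')"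
      using \<open>?k < 2 ^ l\<close> by (intro member_le_sum) (auto intro!: mult_nonneg_nonneg \<omega>_nonneg incr_nonneg)
    finally show "?W * incr F l ?k \<le> (\<Sum>k'<2 ^ l. \<omega> \<bar>real k' - real (i div 2 ^ (N - l))\<bar> * incr F l k')" .
  qed
  also have "\<dots> \<le> tree_maximal \<omega> F N i"
    unfolding tree_maximal_def
    using assms by (intro sum_mono2) (auto intro!: sum_nonneg mult_nonneg_nonneg \<omega>_nonneg incr_nonneg)
  finally show ?thesis .
qed

text \<open>After an exchange of sums each increment is multiplied by the total weight on its level,
  at most \<open>Z\<close>, and by the number of leaves below a node, as in
  \<open>sum_incr\<close>.\<close>

lemma sum_tree_maximal_le:
  assumes Z: "\<And>n k. (\<Sum>k'<n. \<omega> \<bar>real k - real k'\<bar>) \<le> Z"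
  shows "(\<Sum>i<2 ^ N. tree_maximal \<omega> F N i) \<le> Z * (\<Sum>i<2 ^ N. F N i)"
proof -
  have "(\<Sum>i<2 ^ N. tree_maximal \<omega> F N i) =
    (\<Sum>L\<le>N. \<Sum>i<2 ^ N. \<Sum>k<2 ^ L. \<omega> \<bar>real k - real (i div 2 ^ (N - L))\<bar> * incr F L k)"
    unfolding tree_maximal_def by (rule sum.swap)
  also have "\<dots> = (\<Sum>L\<le>N. \<Sum>k<2 ^ L. \<Sum>i<2 ^ N. \<omega> \<bar>real k - real (i div 2 ^ (N - L))\<bar> * incr F L k)"
    by (rule sum.cong[OF refl], rule sum.swap)
  also have "\<dots> \<le> (\<Sum>L\<le>N. \<Sum>k<2 ^ L. Z * (2 ^ (N - L) * incr F L k))"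
  proof (intro sum_mono)
    fix L k assume "L \<in> {..N}" "k \<in> {..<(2::nat) ^ L}"
    then have L: "L \<le> N" by simp
    have "(\<Sum>i<2 ^ N. \<omega> \<bar>real k - real (i div 2 ^ (N - L))\<bar> * incr F L k) =
      2 ^ (N - L) * incr F L k * (\<Sum>k'<2 ^ L. \<omega> \<bar>real k - real k'\<bar>)"
      by (subst sum_div_level[OF L, of "\<lambda>k'. \<omega> \<bar>real k - real k'\<bar> * incr F L k"])
        (simp add: sum_distrib_left mult_ac)
    also have "\<dots> \<le> 2 ^ (N - L) * incr F L k * Z"
      by (intro mult_left_mono Z mult_nonneg_nonneg incr_nonneg) auto
    finally show "(\<Sum>i<2 ^ N. \<omega> \<bar>real k - real (i div 2 ^ (N - L))\<bar> * incr F L k) \<le> Z * (2 ^ (N - L) * incr F L k)"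
      by (simp add: mult_ac)
  qed
  also have "\<dots> = Z * (\<Sum>i<2 ^ N. F N i)" unfolding sum_incr by (simp add: sum_distrib_left)
  finally show ?thesis .
qed

end

lemma sum_weights_le:
  assumes "b > (1::real)"
  obtains Z where "Z > 0" "\<And>n k. (\<Sum>k'<n. (1 + \<bar>real k - real k'\<bar>) powr (- b)) \<le> Z"
proof -
  have "summable (\<lambda>n. real (Suc n) powr (- b))"
    using assms by (subst summable_Suc_iff) (simp add: summable_real_powr_iff)
  then have s: "summable (\<lambda>n. (1 + real n) powr (- b))" by (simp add: add.commute)
  define Y where "Y = (\<Sum>n. (1 + real n) powr (- b))"
  have Y: "(\<Sum>d\<in>A. (1 + real d) powr (- b)) \<le> Y" if "finite A" for A
    unfolding Y_def by (rule sum_le_suminf[OF s that]) auto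
  have "Y \<ge> 1" using Y[of "{0}"] by simp
  show ?thesis
  proof (rule that[of "Y + Y"])
    fix n k :: nat
    let ?w = "\<lambda>k'. (1 + \<bar>real k - real k'\<bar>) powr (- b)"
    have "(\<Sum>k'<n. ?w k') = (\<Sum>k'\<in>{..<n} \<inter> {..k}. ?w k') + (\<Sum>k'\<in>{..<n} - {..k}. ?w k')"
      using sum.Int_Diff[of "{..<n}" ?w "{..k}"] by simp
    also have "(\<Sum>k'\<in>{..<n} \<inter> {..k}. ?w k') = (\<Sum>d\<in>(\<lambda>k'. k - k') ` ({..<n} \<inter> {..k}). (1 + real d) powr (- b))"
      by (subst sum.reindex) (auto simp: inj_on_def of_nat_diff intro!: sum.cong)
    also have "(\<Sum>k'\<in>{..<n} - {..k}. ?w k') = (\<Sum>d\<in>(\<lambda>k'. k' - k) ` ({..<n} - {..k}). (1 + real d) powr (- b))"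
      by (subst sum.reindex) (auto simp: inj_on_def of_nat_diff intro!: sum.cong)
    also have "(\<Sum>d\<in>(\<lambda>k'. k - k') ` ({..<n} \<inter> {..k}). (1 + real d) powr (- b)) +
       (\<Sum>d\<in>(\<lambda>k'. k' - k) ` ({..<n} - {..k}). (1 + real d) powr (- b)) \<le> Y + Y"
      by (intro add_mono Y) auto
    finally show "(\<Sum>k'<n. ?w k') \<le> Y + Y" by simp
  qed (use \<open>Y \<ge> 1\<close> in simp)
qed

definition path_sum :: "(nat \<Rightarrow> nat \<Rightarrow> real) \<Rightarrow> nat \<Rightarrow> nat \<Rightarrow> real" where
  "path_sum u L k = (\<Sum>l\<le>L. u l (k div 2 ^ (L - l)))"

lemma path_sum_Suc: "path_sum u (Suc L) k = path_sum u L (k div 2) + u (Suc L) k"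
proof -
  have "(\<Sum>l\<le>L. u l (k div 2 ^ (Suc L - l))) = path_sum u L (k div 2)"
    unfolding path_sum_def by (intro sum.cong refl) (simp add: Suc_diff_le div_mult2_eq[symmetric])
  then show ?thesis by (simp add: path_sum_def)
qed

lemma path_sum_nonneg: "(\<And>L k. 0 \<le> u L k) \<Longrightarrow> 0 \<le> path_sum u L k"
  unfolding path_sum_def by (intro sum_nonneg) auto

definition tree_op :: "real \<Rightarrow> (nat \<Rightarrow> nat \<Rightarrow> real) \<Rightarrow> nat \<Rightarrow> nat \<Rightarrow> real" where
  "tree_op b u N i = (\<Sum>L\<le>N. \<Sum>k<2 ^ L. (1 + \<bar>real k - real (i div 2 ^ (N - L))\<bar>) powr (- b) * u L k)"

lemma tree_op_nonneg: "(\<And>L k. 0 \<le> u L k) \<Longrightarrow> 0 \<le> tree_op b u N i"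
  unfolding tree_op_def by (intro sum_nonneg mult_nonneg_nonneg) auto

text \<open>With \<open>S\<close> the sum of \<open>u\<close> along the branch from the root and \<open>v\<close> the increments of \<open>S\<^sup>\<theta>\<close>, concavity gives
  \<open>u \<le> v S\<^sup>1\<^sup>-\<^sup>\<theta> / \<theta>\<close>, and \<open>S\<^sup>\<theta>\<close> is in turn a sum of increments. Hence the operator is bounded pointwise by the
  power \<open>1 / \<theta>\<close> of its analogue for \<open>v\<close>, which can be integrated term by term.\<close>

lemma tree_op_bound_le_one:
  assumes \<theta>: "0 < \<theta>" "\<theta> \<le> 1" and b: "b * \<theta> > 1"
  obtains C where "C > 0" "\<And>N u. (\<And>L k. 0 \<le> u L k) \<Longrightarrow>
    (\<Sum>i<2 ^ N. tree_op b u N i powr \<theta>) \<le> C * (\<Sum>i<2 ^ N. path_sum u N i powr \<theta>)"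
proof -
  have b0: "b > 0" using \<theta> b by (smt (verit) mult_nonpos_nonneg)
  obtain Z where Z: "Z > 0" "\<And>n k. (\<Sum>k'<n. (1 + \<bar>real k - real k'\<bar>) powr (- (b * \<theta>))) \<le> Z"
    using sum_weights_le[OF b] by blast
  show ?thesis
  proof (rule that[of "(1 / \<theta>) powr \<theta> * Z"])
    show "0 < (1 / \<theta>) powr \<theta> * Z" using \<theta> Z by simp
    fix N and u :: "nat \<Rightarrow> nat \<Rightarrow> real" assume u: "\<And>L k. 0 \<le> u L k"
    define F where "F = (\<lambda>L k. path_sum u L k powr \<theta>)"
    define \<omega> where "\<omega> = (\<lambda>d::real. (1 + \<bar>d\<bar>) powr (- (b * \<theta>)))"
    have S: "0 \<le> path_sum u L k" for L k using path_sum_nonneg u by blast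
    have inc: "0 \<le> incr F L k" "u L k \<le> 1 / \<theta> * incr F L k * path_sum u L k powr (1 - \<theta>)" for L k
    proof -
      have "0 \<le> incr F L k \<and> u L k \<le> 1 / \<theta> * incr F L k * path_sum u L k powr (1 - \<theta>)"
      proof (cases L)
        case 0
        have "path_sum u 0 k = u 0 k" by (simp add: path_sum_def)
        then show ?thesis using diff_le_powr_diff[of 0 "u 0 k" \<theta>] \<theta> u 0 by (simp add: incr_def F_def)
      next
        case (Suc l)
        then show ?thesis
          using diff_le_powr_diff[of "path_sum u l (k div 2)" "path_sum u L k" \<theta>] \<theta> u[of L k] S[of l "k div 2"]
          by (auto simp: incr_def F_def path_sum_Suc intro!: powr_mono2)
      qed
      then show "0 \<le> incr F L k" "u L k \<le> 1 / \<theta> * incr F L k * path_sum u L k powr (1 - \<theta>)" by auto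
    qed
    have \<omega>: "0 \<le> \<omega> d" "antimono_on {0..} \<omega>" for d
      unfolding \<omega>_def using b by (auto intro!: powr_mono2' monotone_onI)
    let ?V = "tree_maximal \<omega> F N"
    have V0: "0 \<le> ?V i" for i by (rule tree_maximal_nonneg[OF \<omega> inc(1)])
    have "tree_op b u N i powr \<theta> \<le> (1 / \<theta>) powr \<theta> * ?V i" for i
    proof -
      let ?e = "(1 - \<theta>) / \<theta>"
      have "tree_op b u N i \<le> (\<Sum>L\<le>N. \<Sum>k<2 ^ L. 1 / \<theta> * (\<omega> \<bar>real k - real (i div 2 ^ (N - L))\<bar> * incr F L k) * ?V i powr ?e)"
        unfolding tree_op_def
      proof (intro sum_mono)
        fix L k assume "L \<in> {..N}" "k \<in> {..<(2::nat) ^ L}"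
        then have Lk: "L \<le> N" "k < 2 ^ L" by auto
        define d where "d = \<bar>real k - real (i div 2 ^ (N - L))\<bar>"
        have d: "d \<ge> 0" unfolding d_def by simp
        \<comment> \<open>The weight splits into \<open>\<omega> d\<close>, which stays with the
          increment and is summable because \<open>b * \<theta> > 1\<close>, and a power of
          \<open>\<omega> d\<close>, which together with the same power of \<open>F L k\<close> is
          bounded by the tree maximal function.\<close>
        have "(1 + d) powr (- b) = (1 + d) powr (- (b * \<theta>)) * (1 + d) powr (- (b * (1 - \<theta>)))"
          unfolding powr_add[symmetric] by (simp add: algebra_simps)
        also have "\<dots> = \<omega> d * \<omega> d powr ?e"
        proof -
          have "- (b * \<theta>) * ?e = - (b * (1 - \<theta>))" using \<theta> by (simp add: field_simps)
          then show ?thesis using d unfolding \<omega>_def powr_powr by simp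
        qed
        finally have w: "(1 + d) powr (- b) = \<omega> d * \<omega> d powr ?e" .
        have "path_sum u L k powr (1 - \<theta>) = F L k powr ?e"
          unfolding F_def powr_powr using \<theta> by simp
        then have "(1 + d) powr (- b) * u L k \<le> \<omega> d * \<omega> d powr ?e * (1 / \<theta> * incr F L k * F L k powr ?e)"
          unfolding w using inc(2)[of L k] \<omega>(1) by (intro mult_left_mono) auto
        also have "\<dots> = 1 / \<theta> * (\<omega> d * incr F L k) * (\<omega> d * F L k) powr ?e"
          by (subst powr_mult) (simp_all add: \<omega>(1) F_def mult_ac)
        also have "\<dots> \<le> 1 / \<theta> * (\<omega> d * incr F L k) * ?V i powr ?e"
          using le_tree_maximal[OF \<omega> inc(1) Lk, where i=i] \<theta> \<omega>(1)[of d] inc(1)[of L k] unfolding d_def[symmetric]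
          by (intro mult_left_mono powr_mono2) (auto simp: F_def)
        finally show "(1 + \<bar>real k - real (i div 2 ^ (N - L))\<bar>) powr (- b) * u L k
            \<le> 1 / \<theta> * (\<omega> \<bar>real k - real (i div 2 ^ (N - L))\<bar> * incr F L k) * ?V i powr ?e"
          unfolding d_def .
      qed
      also have "\<dots> = 1 / \<theta> * (?V i * ?V i powr ?e)"
        unfolding tree_maximal_def by (simp add: sum_distrib_left sum_distrib_right mult_ac)
      also have "?V i * ?V i powr ?e = ?V i powr (1 / \<theta>)"
        using powr_mult_base[OF V0[of i], of ?e] \<theta> by (simp add: field_simps)
      finally have "tree_op b u N i powr \<theta> \<le> (1 / \<theta> * ?V i powr (1 / \<theta>)) powr \<theta>"
        using tree_op_nonneg[OF u] \<theta> by (intro powr_mono2) auto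
      also have "\<dots> = (1 / \<theta>) powr \<theta> * ?V i"
        using \<theta> V0[of i] by (subst powr_mult) (auto simp: powr_powr)
      finally show ?thesis .
    qed
    then have "(\<Sum>i<2 ^ N. tree_op b u N i powr \<theta>) \<le> (1 / \<theta>) powr \<theta> * (\<Sum>i<2 ^ N. ?V i)"
      unfolding sum_distrib_left by (intro sum_mono)
    also have "(\<Sum>i<2 ^ N. ?V i) \<le> Z * (\<Sum>i<2 ^ N. F N i)"
    proof (rule sum_tree_maximal_le[OF \<omega> inc(1)])
      show "(\<Sum>k'<n. \<omega> \<bar>real k - real k'\<bar>) \<le> Z" for n k
        using Z(2)[of k n] unfolding \<omega>_def by simp
    qed
    finally show "(\<Sum>i<2 ^ N. tree_op b u N i powr \<theta>) \<le> (1 / \<theta>) powr \<theta> * Z * (\<Sum>i<2 ^ N. path_sum u N i powr \<theta>)"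
      using \<theta> unfolding F_def by (simp add: mult.assoc)
  qed
qed


section \<open>Doob's maximal inequality for averages over the dyadic tree\<close>

primrec running_max :: "(nat \<Rightarrow> nat \<Rightarrow> real) \<Rightarrow> nat \<Rightarrow> nat \<Rightarrow> real" where
  "running_max a 0 k = a 0 k"
| "running_max a (Suc L) k = max (running_max a L (k div 2)) (a (Suc L) k)"

lemma le_running_max: "a L k \<le> running_max a L k"
  by (cases L) auto

text \<open>The conditional expectation of \<open>g\<close> on level \<open>L\<close>;
  \<open>running_max\<close> of these averages is the dyadic maximal function along a
  branch.\<close>

definition block_avg :: "(nat \<Rightarrow> real) \<Rightarrow> nat \<Rightarrow> nat \<Rightarrow> nat \<Rightarrow> real" where
  "block_avg g N L k = (\<Sum>i\<in>block N L k. g i) / 2 ^ (N - L)"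

context
  fixes g :: "nat \<Rightarrow> real" and N :: nat and r :: real and F :: "nat \<Rightarrow> nat \<Rightarrow> real"
  assumes g: "\<And>i. 0 \<le> g i" and r: "r > 1"
  defines "F \<equiv> \<lambda>L k. running_max (block_avg g N) L k powr r"
begin

lemma block_avg_nonneg: "0 \<le> block_avg g N L k"
  unfolding block_avg_def by (intro divide_nonneg_nonneg sum_nonneg g) auto

lemma running_max_nonneg: "0 \<le> running_max (block_avg g N) L k"
  using block_avg_nonneg le_running_max order_trans by blast

text \<open>The running maximum jumps only at a node where the current average is the new maximum,
  so the factor \<open>a\<close> in \<open>powr_diff_le_mult\<close> may be taken to be that
  average.\<close>

lemma running_max_incr:
  "0 \<le> incr F L k"
  "incr F L k \<le> r / (r - 1) * block_avg g N L k * incr (\<lambda>L k. running_max (block_avg g N) L k powr (r - 1)) L k"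
proof -
  let ?m = "running_max (block_avg g N)"
  have "0 \<le> incr F L k \<and> incr F L k \<le> r / (r - 1) * block_avg g N L k * incr (\<lambda>L k. ?m L k powr (r - 1)) L k"
  proof (cases L)
    case 0
    have "?m 0 k powr r - 0 powr r \<le> r / (r - 1) * ?m 0 k * (?m 0 k powr (r - 1) - 0 powr (r - 1))"
      using r by (intro powr_diff_le_mult running_max_nonneg) auto
    then show ?thesis using r 0 by (simp add: incr_def F_def)
  next
    case (Suc l)
    have le: "?m l (k div 2) \<le> ?m L k" using Suc by simp
    show ?thesis
    proof (cases "?m l (k div 2) < block_avg g N L k")
      case True
      then have "?m L k = block_avg g N L k" using Suc by simp
      then have "?m L k powr r - ?m l (k div 2) powr r
          \<le> r / (r - 1) * block_avg g N L k * (?m L k powr (r - 1) - ?m l (k div 2) powr (r - 1))"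
        using powr_diff_le_mult[OF running_max_nonneg le r] by simp
      moreover have "?m l (k div 2) powr r \<le> ?m L k powr r"
        using r le running_max_nonneg by (intro powr_mono2) auto
      ultimately show ?thesis using Suc by (simp add: incr_def F_def)
    next
      case False
      then have "?m L k = ?m l (k div 2)" using Suc by simp
      then show ?thesis using Suc by (simp add: incr_def F_def del: running_max.simps)
    qed
  qed
  then show "0 \<le> incr F L k"
    "incr F L k \<le> r / (r - 1) * block_avg g N L k * incr (\<lambda>L k. ?m L k powr (r - 1)) L k" by auto
qed

text \<open>\<open>2 ^ (N - L)\<close> times a block average is the sum of \<open>g\<close> over the
  block. Hence averages turn into \<open>g\<close> itself at the leaves, and the increments
  telescope along each branch.\<close>

lemma Doob_linear:
  "(\<Sum>i<2 ^ N. F N i) \<le> (\<Sum>i<2 ^ N. r / (r - 1) * g i * running_max (block_avg g N) N i powr (r - 1))"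
proof -
  let ?G = "\<lambda>L k. running_max (block_avg g N) L k powr (r - 1)"
  have "(\<Sum>i<2 ^ N. F N i) = (\<Sum>L\<le>N. \<Sum>k<2 ^ L. 2 ^ (N - L) * incr F L k)" by (rule sum_incr)
  also have "\<dots> \<le> (\<Sum>L\<le>N. \<Sum>k<2 ^ L. \<Sum>i\<in>block N L k. r / (r - 1) * g i * incr ?G L k)"
  proof (intro sum_mono)
    fix L k
    have "2 ^ (N - L) * incr F L k \<le> 2 ^ (N - L) * (r / (r - 1) * block_avg g N L k * incr ?G L k)"
      using running_max_incr(2) by (intro mult_left_mono) auto
    also have "\<dots> = r / (r - 1) * (\<Sum>i\<in>block N L k. g i) * incr ?G L k"
      unfolding block_avg_def by simp
    also have "\<dots> = (\<Sum>i\<in>block N L k. r / (r - 1) * g i * incr ?G L k)"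
      by (simp add: sum_distrib_left sum_distrib_right)
    finally show "2 ^ (N - L) * incr F L k \<le> (\<Sum>i\<in>block N L k. r / (r - 1) * g i * incr ?G L k)" .
  qed
  also have "\<dots> = (\<Sum>L\<le>N. \<Sum>i<2 ^ N. r / (r - 1) * g i * incr ?G L (i div 2 ^ (N - L)))"
  proof (rule sum.cong[OF refl])
    fix L assume "L \<in> {..N}"
    then show "(\<Sum>k<2 ^ L. \<Sum>i\<in>block N L k. r / (r - 1) * g i * incr ?G L k)
        = (\<Sum>i<2 ^ N. r / (r - 1) * g i * incr ?G L (i div 2 ^ (N - L)))"
      by (intro sum_blocks[symmetric, where h="\<lambda>k i. r / (r - 1) * g i * incr ?G L k"]) simp
  qed
  also have "\<dots> = (\<Sum>i<2 ^ N. r / (r - 1) * g i * (\<Sum>L\<le>N. incr ?G L (i div 2 ^ (N - L))))"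
    unfolding sum_distrib_left by (rule sum.swap)
  finally show ?thesis unfolding telescope_incr .
qed

end

text \<open>Young's inequality puts \<open>1 / 2\<close> in front of the maximal function, and this
  term is absorbed, all sums being finite.\<close>

lemma Doob_maximal:
  assumes r: "r > (1::real)"
  obtains C where "C \<ge> 0" "\<And>N g. (\<And>i. 0 \<le> g i) \<Longrightarrow>
    (\<Sum>i<2 ^ N. running_max (block_avg g N) N i powr r) \<le> C * (\<Sum>i<2 ^ N. g i powr r)"
proof -
  obtain C where C: "C \<ge> 0"
    "\<And>x y. 0 \<le> x \<Longrightarrow> 0 \<le> y \<Longrightarrow> x * y \<le> C * x powr r + 1 / 2 * y powr (r / (r - 1))"
    using Young_absorb[OF r, of "1/2"] by auto
  define A where "A = r / (r - 1)"
  have A: "A \<ge> 0" using r by (simp add: A_def)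
  show ?thesis
  proof (rule that[of "2 * (C * A powr r)"])
    fix N and g :: "nat \<Rightarrow> real" assume g: "\<And>i. 0 \<le> g i"
    let ?m = "running_max (block_avg g N) N"
    have "(\<Sum>i<2 ^ N. ?m i powr r) \<le> (\<Sum>i<2 ^ N. A * g i * ?m i powr (r - 1))"
      using Doob_linear[OF g r] unfolding A_def .
    also have "\<dots> \<le> (\<Sum>i<2 ^ N. C * A powr r * g i powr r + 1 / 2 * ?m i powr r)"
    proof (rule sum_mono)
      fix i
      have "A * g i * ?m i powr (r - 1) \<le> C * (A * g i) powr r + 1 / 2 * (?m i powr (r - 1)) powr (r / (r - 1))"
        using A g by (intro C) auto
      then show "A * g i * ?m i powr (r - 1) \<le> C * A powr r * g i powr r + 1 / 2 * ?m i powr r"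
        using r A g by (simp add: powr_powr powr_mult)
    qed
    also have "\<dots> = C * A powr r * (\<Sum>i<2 ^ N. g i powr r) + 1 / 2 * (\<Sum>i<2 ^ N. ?m i powr r)"
      by (simp add: sum.distrib sum_distrib_left)
    finally show "(\<Sum>i<2 ^ N. ?m i powr r) \<le> 2 * (C * A powr r) * (\<Sum>i<2 ^ N. g i powr r)" by simp
  qed (use C in simp)
qed

text \<open>Only the least \<open>m\<close> with \<open>d < 2 ^ m\<close> is kept from the sum; for
  it \<open>1 + d\<close> is at least \<open>2 powr (real m - 1)\<close>, which accounts for the
  factor \<open>2 powr b\<close>.\<close>

lemma weight_le_dyadic_sum:
  fixes d b :: real
  assumes "0 \<le> d" "d < 2 ^ L" "b \<ge> 0"
  shows "(1 + d) powr (- b) \<le> 2 powr b * (\<Sum>m\<le>L. 2 powr (- b * real m) * (if d < 2 ^ m then 1 else 0))"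
proof -
  define m where "m = (LEAST m. d < 2 ^ m)"
  have m: "d < 2 ^ m" unfolding m_def by (rule LeastI[of _ L]) (use assms in auto)
  have mL: "m \<le> L" unfolding m_def by (rule Least_le) (use assms in auto)
  have "2 powr (real m - 1) \<le> 1 + d"
  proof (cases m)
    case (Suc n)
    have "\<not> d < 2 ^ n" using not_less_Least[of n "\<lambda>m. d < 2 ^ m"] Suc unfolding m_def by simp
    then show ?thesis using Suc by (simp add: powr_realpow)
  qed (use assms in \<open>simp add: powr_minus\<close>)
  then have "(1 + d) powr (- b) \<le> (2 powr (real m - 1)) powr (- b)"
    using assms by (intro powr_mono2') auto
  also have "\<dots> = 2 powr b * (2 powr (- b * real m) * (if d < 2 ^ m then 1 else 0))"
    using m by (simp add: powr_powr powr_add[symmetric] algebra_simps)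
  also have "\<dots> \<le> 2 powr b * (\<Sum>m\<le>L. 2 powr (- b * real m) * (if d < 2 ^ m then 1 else 0))"
    using mL by (intro mult_left_mono member_le_sum) auto
  finally show ?thesis .
qed

lemma sum_near_le:
  fixes k n :: nat
  shows "(\<Sum>k'<n. if \<bar>real k - real k'\<bar> \<le> 1 then 1 else 0 :: real) \<le> 3"
proof -
  have "(\<Sum>k'<n. if \<bar>real k - real k'\<bar> \<le> 1 then 1 else 0 :: real) = real (card {k'\<in>{..<n}. \<bar>real k - real k'\<bar> \<le> 1})"
    by (simp add: sum.If_cases Int_def)
  also have "{k'\<in>{..<n}. \<bar>real k - real k'\<bar> \<le> 1} \<subseteq> {k - 1, k, k + 1}" by auto
  then have "card {k'\<in>{..<n}. \<bar>real k - real k'\<bar> \<le> 1} \<le> card {k - 1, k, k + 1}" by (intro card_mono) auto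
  also have "\<dots> \<le> 3" by (simp add: card_insert_if)
  finally show ?thesis by simp
qed

text \<open>The weights are cut into layers \<open>d < 2 ^ m\<close>. Nodes of level
  \<open>L\<close> in such a layer have their ancestors \<open>m\<close> levels up among at most
  three neighbouring nodes, whose block averages are bounded by \<open>n\<close>. A layer thus costs
  \<open>2 ^ m\<close> against \<open>2 powr (- b * real m)\<close>, a convergent geometric series
  since \<open>b > 1\<close>.\<close>

lemma weighted_average_le:
  assumes b: "b > (1::real)"
  obtains C where "C \<ge> 0" "\<And>N g n L i. (\<And>i. 0 \<le> g i) \<Longrightarrow> L \<le> N \<Longrightarrow> i < 2 ^ N \<Longrightarrow>
    (\<And>l k. l \<le> N \<Longrightarrow> k < 2 ^ l \<Longrightarrow> \<bar>real k - real (i div 2 ^ (N - l))\<bar> \<le> 1 \<Longrightarrow> block_avg g N l k \<le> n) \<Longrightarrow> 0 \<le> n \<Longrightarrow>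
    (\<Sum>i'<2 ^ N. (1 + \<bar>real (i div 2 ^ (N - L)) - real (i' div 2 ^ (N - L))\<bar>) powr (- b) * g i') \<le> C * 2 ^ (N - L) * n"
proof -
  have geo: "summable (\<lambda>m. (2 powr (1 - b)) ^ m)" using b by (intro summable_geometric) (simp add: powr_less_one)
  define Y where "Y = (\<Sum>m. (2 powr (1 - b)) ^ m)"
  have Y: "(\<Sum>m\<le>L. 2 powr (- b * real m) * 2 ^ m) \<le> Y" for L
  proof -
    have "(\<Sum>m\<le>L. 2 powr (- b * real m) * 2 ^ m) = (\<Sum>m\<le>L. (2 powr (1 - b)) ^ m)"
      by (intro sum.cong refl) (simp add: powr_realpow[symmetric] powr_powr powr_add[symmetric] algebra_simps)
    also have "\<dots> \<le> Y" unfolding Y_def by (rule sum_le_suminf[OF geo]) auto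
    finally show ?thesis .
  qed
  have "Y \<ge> 0" unfolding Y_def by (intro suminf_nonneg geo) auto
  show ?thesis
  proof (rule that[of "2 powr b * 3 * Y"])
    show "0 \<le> 2 powr b * 3 * Y" using \<open>Y \<ge> 0\<close> by simp
    fix N L i and g :: "nat \<Rightarrow> real" and n :: real
    assume g: "\<And>i. 0 \<le> g i" and L: "L \<le> N" and i: "i < 2 ^ N" and n0: "0 \<le> n"
      and n: "\<And>l k. l \<le> N \<Longrightarrow> k < 2 ^ l \<Longrightarrow> \<bar>real k - real (i div 2 ^ (N - l))\<bar> \<le> 1 \<Longrightarrow> block_avg g N l k \<le> n"
    define d where "d = (\<lambda>i'. \<bar>real (i div 2 ^ (N - L)) - real (i' div 2 ^ (N - L))\<bar>)"
    have d: "0 \<le> d i'" "i' < 2 ^ N \<Longrightarrow> d i' < 2 ^ L" for i'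
    proof -
      assume "i' < 2 ^ N"
      then have "real (i' div 2 ^ (N - L)) < 2 ^ L" "real (i div 2 ^ (N - L)) < 2 ^ L"
        using div_level_less[OF L, of i'] div_level_less[OF L i] by (metis of_nat_less_iff of_nat_numeral of_nat_power)+
      then show "d i' < 2 ^ L" unfolding d_def by (smt (verit) of_nat_0_le_iff)
    qed (simp add: d_def)
    have layer: "(\<Sum>i'<2 ^ N. (if d i' < 2 ^ m then 1 else 0) * g i') \<le> 3 * (2 ^ (N - L) * 2 ^ m * n)" if m: "m \<le> L" for m
    proof -
      let ?l = "L - m"
      have l: "?l \<le> N" "N - ?l = (N - L) + m" "L - ?l = m" using m L by auto
      let ?k = "i div 2 ^ (N - ?l)"
      have "(\<Sum>i'<2 ^ N. (if d i' < 2 ^ m then 1 else 0) * g i') \<le>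
        (\<Sum>i'<2 ^ N. (if \<bar>real ?k - real (i' div 2 ^ (N - ?l))\<bar> \<le> 1 then 1 else 0) * g i')"
      proof (intro sum_mono mult_right_mono g)
        fix i'
        show "(if d i' < 2 ^ m then 1 else 0 :: real) \<le> (if \<bar>real ?k - real (i' div 2 ^ (N - ?l))\<bar> \<le> 1 then 1 else 0)"
          using abs_div_diff_le_one[of "i div 2 ^ (N - L)" "i' div 2 ^ (N - L)" "2 ^ m"]
            div_level_div[of ?l L N i] div_level_div[of ?l L N i'] l L
          unfolding d_def by auto
      qed
      also have "\<dots> = (\<Sum>k'<2 ^ ?l. (if \<bar>real ?k - real k'\<bar> \<le> 1 then 1 else 0) * (\<Sum>i'\<in>block N ?l k'. g i'))"
        unfolding sum_distrib_left
        by (rule sum_blocks[OF l(1), of "\<lambda>k' i'. (if \<bar>real ?k - real k'\<bar> \<le> 1 then 1 else 0) * g i'"])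
      also have "\<dots> \<le> (\<Sum>k'<2 ^ ?l. (if \<bar>real ?k - real k'\<bar> \<le> 1 then 1 else 0) * (2 ^ (N - L) * 2 ^ m * n))"
      proof (rule sum_mono)
        fix k' assume "k' \<in> {..<(2::nat) ^ ?l}"
        then have "\<bar>real ?k - real k'\<bar> \<le> 1 \<Longrightarrow> block_avg g N ?l k' \<le> n" by (intro n l) (auto simp: abs_minus_commute)
        then show "(if \<bar>real ?k - real k'\<bar> \<le> 1 then 1 else 0) * (\<Sum>i'\<in>block N ?l k'. g i')
            \<le> (if \<bar>real ?k - real k'\<bar> \<le> 1 then 1 else 0) * (2 ^ (N - L) * 2 ^ m * n)"
          unfolding block_avg_def l(2) by (auto simp: power_add field_simps)
      qed
      also have "\<dots> = (\<Sum>k'<2 ^ ?l. if \<bar>real ?k - real k'\<bar> \<le> 1 then 1 else 0) * (2 ^ (N - L) * 2 ^ m * n)"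
        by (simp add: sum_distrib_right)
      also have "\<dots> \<le> 3 * (2 ^ (N - L) * 2 ^ m * n)"
        using n0 by (intro mult_right_mono sum_near_le) auto
      finally show ?thesis .
    qed
    have "(\<Sum>i'<2 ^ N. (1 + d i') powr (- b) * g i') \<le>
      (\<Sum>i'<2 ^ N. 2 powr b * (\<Sum>m\<le>L. 2 powr (- b * real m) * (if d i' < 2 ^ m then 1 else 0)) * g i')"
      using b d g by (intro sum_mono mult_right_mono weight_le_dyadic_sum) auto
    also have "\<dots> = (\<Sum>i'<2 ^ N. \<Sum>m\<le>L. 2 powr b * (2 powr (- b * real m) * ((if d i' < 2 ^ m then 1 else 0) * g i')))"
      by (simp add: sum_distrib_left sum_distrib_right mult.assoc)
    also have "\<dots> = (\<Sum>m\<le>L. 2 powr b * (2 powr (- b * real m) * (\<Sum>i'<2 ^ N. (if d i' < 2 ^ m then 1 else 0) * g i')))"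
      unfolding sum_distrib_left by (rule sum.swap)
    also have "\<dots> \<le> (\<Sum>m\<le>L. 2 powr b * (2 powr (- b * real m) * (3 * (2 ^ (N - L) * 2 ^ m * n))))"
      by (intro sum_mono mult_left_mono layer) auto
    also have "\<dots> = 2 powr b * 3 * (\<Sum>m\<le>L. 2 powr (- b * real m) * 2 ^ m) * (2 ^ (N - L) * n)"
      by (simp add: sum_distrib_left sum_distrib_right mult_ac)
    also have "\<dots> \<le> 2 powr b * 3 * Y * (2 ^ (N - L) * n)"
      using n0 by (intro mult_right_mono mult_left_mono Y) auto
    finally show "(\<Sum>i'<2 ^ N. (1 + \<bar>real (i div 2 ^ (N - L)) - real (i' div 2 ^ (N - L))\<bar>) powr (- b) * g i')
        \<le> 2 powr b * 3 * Y * 2 ^ (N - L) * n"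
      unfolding d_def by (simp add: mult.assoc)
  qed
qed

text \<open>For \<open>\<theta> > 1\<close> the operator is tested against \<open>g = (tree_op b u)\<^sup>\<theta>\<^sup>-\<^sup>1\<close>; moving the weights to \<open>g\<close> produces a
  dyadic maximal function of \<open>g\<close> over neighbouring blocks.\<close>

lemma tree_op_bound_gt_one:
  assumes \<theta>: "1 < \<theta>" and b: "b > 1"
  obtains C where "C > 0" "\<And>N u. (\<And>L k. 0 \<le> u L k) \<Longrightarrow>
    (\<Sum>i<2 ^ N. tree_op b u N i powr \<theta>) \<le> C * (\<Sum>i<2 ^ N. path_sum u N i powr \<theta>)"
proof -
  define r where "r = \<theta> / (\<theta> - 1)"
  have r: "r > 1" "r / (r - 1) = \<theta>" "(\<theta> - 1) * r = \<theta>" using \<theta> by (auto simp: r_def field_simps)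
  obtain D where D: "D \<ge> 0" "\<And>N g. (\<And>i. 0 \<le> g i) \<Longrightarrow>
    (\<Sum>i<2 ^ N. running_max (block_avg g N) N i powr r) \<le> D * (\<Sum>i<2 ^ N. g i powr r)"
    using Doob_maximal[OF r(1)] by blast
  \<comment> \<open>\<open>\<eta> * (3 * D)\<close> is at most \<open>1 / 2\<close>, with 3 from the
    neighbouring blocks and \<open>D\<close> from Doob's inequality, so that the last term can be
    absorbed.\<close>
  define \<eta> where "\<eta> = 1 / (2 * (3 * D + 1))"
  have \<eta>: "\<eta> > 0" using D by (simp add: \<eta>_def)
  obtain Y where Y: "Y \<ge> 0" "\<And>x y. 0 \<le> x \<Longrightarrow> 0 \<le> y \<Longrightarrow> x * y \<le> Y * x powr \<theta> + \<eta> * y powr (\<theta> / (\<theta> - 1))"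
    using Young_absorb[OF \<theta> \<eta>] by auto
  show ?thesis
  proof (rule weighted_average_le[OF b])
    fix A :: real assume A: "A \<ge> 0" "\<And>N g n L i. (\<And>i. 0 \<le> g i) \<Longrightarrow> L \<le> N \<Longrightarrow> i < 2 ^ N \<Longrightarrow>
      (\<And>l k. l \<le> N \<Longrightarrow> k < 2 ^ l \<Longrightarrow> \<bar>real k - real (i div 2 ^ (N - l))\<bar> \<le> 1 \<Longrightarrow> block_avg g N l k \<le> n) \<Longrightarrow> 0 \<le> n \<Longrightarrow>
      (\<Sum>i'<2 ^ N. (1 + \<bar>real (i div 2 ^ (N - L)) - real (i' div 2 ^ (N - L))\<bar>) powr (- b) * g i') \<le> A * 2 ^ (N - L) * n"
    show thesis
    proof (rule that[of "2 * (Y * A powr \<theta>) + 1"])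
      show "0 < 2 * (Y * A powr \<theta>) + 1" using Y by (simp add: add_nonneg_pos)
      fix N and u :: "nat \<Rightarrow> nat \<Rightarrow> real" assume u: "\<And>L k. 0 \<le> u L k"
      define W where "W = tree_op b u N"
      have W0: "0 \<le> W i" for i unfolding W_def by (rule tree_op_nonneg[OF u])
      define g where "g = (\<lambda>i. W i powr (\<theta> - 1))"
      have g: "0 \<le> g i" for i by (simp add: g_def)
      define F where "F = (\<lambda>L k. running_max (block_avg g N) L k powr r)"
      have incF: "0 \<le> incr F L k" for L k unfolding F_def by (rule running_max_incr(1)[OF g r(1)])
      define \<omega> where "\<omega> = (\<lambda>d::real. if d \<le> 1 then 1 else 0 :: real)"
      have \<omega>: "0 \<le> \<omega> d" "antimono_on {0..} \<omega>" for d unfolding \<omega>_def by (auto intro!: monotone_onI)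
      define V where "V = tree_maximal \<omega> F N"
      have V0: "0 \<le> V i" for i unfolding V_def by (rule tree_maximal_nonneg[OF \<omega> incF])
      \<comment> \<open>One number per leaf that dominates the averages of \<open>g\<close> over all
        ancestors of the leaf and their neighbours, since \<open>V\<close> is the tree maximal
        function of \<open>F\<close> with the cut-off weight.\<close>
      define n where "n = (\<lambda>i. V i powr (1 / r))"
      have avg: "block_avg g N l k \<le> n i"
        if "l \<le> N" "k < 2 ^ l" "\<bar>real k - real (i div 2 ^ (N - l))\<bar> \<le> 1" for l k i
      proof -
        have a0: "0 \<le> block_avg g N l k" by (rule block_avg_nonneg[OF g r(1)])
        have "block_avg g N l k powr r \<le> F l k"
          unfolding F_def using a0 r le_running_max by (intro powr_mono2) auto
        also have "\<dots> \<le> V i"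
          using le_tree_maximal[OF \<omega> incF that(1,2), where i=i] that(3) unfolding V_def \<omega>_def by simp
        finally have "(block_avg g N l k powr r) powr (1 / r) \<le> V i powr (1 / r)"
          using r by (intro powr_mono2) auto
        then show ?thesis unfolding n_def using a0 r by (simp add: powr_powr)
      qed
      have sumn: "(\<Sum>i<2 ^ N. n i powr r) \<le> 3 * D * (\<Sum>i<2 ^ N. W i powr \<theta>)"
      proof -
        have "(\<Sum>i<2 ^ N. n i powr r) = (\<Sum>i<2 ^ N. V i)"
          unfolding n_def using r V0 by (simp add: powr_powr)
        also have "\<dots> \<le> 3 * (\<Sum>i<2 ^ N. F N i)"
          unfolding V_def
        proof (rule sum_tree_maximal_le[OF \<omega> incF])
          show "(\<Sum>k'<n. \<omega> \<bar>real k - real k'\<bar>) \<le> 3" for n k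
            using sum_near_le[of k n] unfolding \<omega>_def .
        qed
        also have "(\<Sum>i<2 ^ N. F N i) \<le> D * (\<Sum>i<2 ^ N. g i powr r)" unfolding F_def by (rule D(2)[OF g])
        also have "(\<Sum>i<2 ^ N. g i powr r) = (\<Sum>i<2 ^ N. W i powr \<theta>)" unfolding g_def powr_powr r(3) ..
        finally show ?thesis by simp
      qed
      have "(\<Sum>i<2 ^ N. W i powr \<theta>) = (\<Sum>i<2 ^ N. W i * g i)"
        unfolding g_def using \<theta> powr_mult_base[OF W0] by simp
      also have "\<dots> = (\<Sum>i<2 ^ N. \<Sum>L\<le>N. \<Sum>k<2 ^ L. (1 + \<bar>real k - real (i div 2 ^ (N - L))\<bar>) powr (- b) * u L k * g i)"
        unfolding W_def tree_op_def by (simp add: sum_distrib_right)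
      also have "\<dots> = (\<Sum>L\<le>N. \<Sum>i<2 ^ N. \<Sum>k<2 ^ L. (1 + \<bar>real k - real (i div 2 ^ (N - L))\<bar>) powr (- b) * u L k * g i)"
        by (rule sum.swap)
      also have "\<dots> = (\<Sum>L\<le>N. \<Sum>k<2 ^ L. \<Sum>i<2 ^ N. (1 + \<bar>real k - real (i div 2 ^ (N - L))\<bar>) powr (- b) * u L k * g i)"
        by (rule sum.cong[OF refl], rule sum.swap)
      also have "\<dots> \<le> (\<Sum>L\<le>N. \<Sum>i<2 ^ N. u L (i div 2 ^ (N - L)) * (A * n i))"
      proof (rule sum_mono)
        fix L assume "L \<in> {..N}"
        then have L: "L \<le> N" by simp
        let ?w = "\<lambda>k i. (1 + \<bar>real k - real (i div 2 ^ (N - L))\<bar>) powr (- b)"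
        have "(\<Sum>k<2 ^ L. \<Sum>i<2 ^ N. ?w k i * u L k * g i) = (\<Sum>k<2 ^ L. u L k * (\<Sum>i<2 ^ N. ?w k i * g i))"
          by (simp add: sum_distrib_left mult_ac)
        also have "\<dots> \<le> (\<Sum>k<2 ^ L. \<Sum>i\<in>block N L k. u L k * (A * n i))"
        proof (rule sum_mono)
          fix k assume "k \<in> {..<(2::nat) ^ L}"
          then have k: "k < 2 ^ L" by simp
          \<comment> \<open>The estimate by \<open>n i\<close> holds for every leaf \<open>i\<close>
            below the node \<open>k\<close> with the same left side, so it may be averaged over the
            \<open>2 ^ (N - L)\<close> leaves of the block.\<close>
          have "(\<Sum>i\<in>block N L k. (\<Sum>i<2 ^ N. ?w k i * g i) / 2 ^ (N - L)) \<le> (\<Sum>i\<in>block N L k. A * n i)"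
          proof (rule sum_mono)
            fix i assume "i \<in> block N L k"
            then have i: "i < 2 ^ N" "i div 2 ^ (N - L) = k" by (auto simp: block_def)
            have "(\<Sum>i<2 ^ N. ?w k i * g i) \<le> A * 2 ^ (N - L) * n i"
              using A(2)[OF g L i(1) avg] unfolding i(2) by (simp add: n_def)
            then show "(\<Sum>i<2 ^ N. ?w k i * g i) / 2 ^ (N - L) \<le> A * n i"
              by (simp add: field_simps)
          qed
          then have "(\<Sum>i<2 ^ N. ?w k i * g i) \<le> (\<Sum>i\<in>block N L k. A * n i)"
            using card_block[OF L k] by simp
          then show "u L k * (\<Sum>i<2 ^ N. ?w k i * g i) \<le> (\<Sum>i\<in>block N L k. u L k * (A * n i))"
            unfolding sum_distrib_left[symmetric] using u by (rule mult_left_mono)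
        qed
        also have "\<dots> = (\<Sum>i<2 ^ N. u L (i div 2 ^ (N - L)) * (A * n i))"
          by (rule sum_blocks[OF L, of "\<lambda>k i. u L k * (A * n i)", symmetric])
        finally show "(\<Sum>k<2 ^ L. \<Sum>i<2 ^ N. ?w k i * u L k * g i) \<le> (\<Sum>i<2 ^ N. u L (i div 2 ^ (N - L)) * (A * n i))" .
      qed
      also have "\<dots> = (\<Sum>i<2 ^ N. \<Sum>L\<le>N. u L (i div 2 ^ (N - L)) * (A * n i))" by (rule sum.swap)
      also have "\<dots> = (\<Sum>i<2 ^ N. (A * path_sum u N i) * n i)"
        unfolding path_sum_def by (simp add: sum_distrib_left sum_distrib_right mult_ac)
      also have "\<dots> \<le> (\<Sum>i<2 ^ N. Y * A powr \<theta> * path_sum u N i powr \<theta> + \<eta> * n i powr r)"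
      proof (rule sum_mono)
        fix i
        have "(A * path_sum u N i) * n i \<le> Y * (A * path_sum u N i) powr \<theta> + \<eta> * n i powr (\<theta> / (\<theta> - 1))"
          using A(1) path_sum_nonneg[OF u] by (intro Y) (auto simp: n_def)
        then show "(A * path_sum u N i) * n i \<le> Y * A powr \<theta> * path_sum u N i powr \<theta> + \<eta> * n i powr r"
          using A(1) path_sum_nonneg[OF u] by (simp add: r_def powr_mult mult.assoc)
      qed
      also have "\<dots> = Y * A powr \<theta> * (\<Sum>i<2 ^ N. path_sum u N i powr \<theta>) + \<eta> * (\<Sum>i<2 ^ N. n i powr r)"
        by (simp add: sum.distrib sum_distrib_left)
      also have "\<eta> * (\<Sum>i<2 ^ N. n i powr r) \<le> \<eta> * (3 * D * (\<Sum>i<2 ^ N. W i powr \<theta>))"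
        using \<eta> sumn by (intro mult_left_mono) auto
      also have "\<eta> * (3 * D * (\<Sum>i<2 ^ N. W i powr \<theta>)) = (\<eta> * (3 * D)) * (\<Sum>i<2 ^ N. W i powr \<theta>)" by simp
      also have "\<dots> \<le> 1 / 2 * (\<Sum>i<2 ^ N. W i powr \<theta>)"
        using D by (intro mult_right_mono sum_nonneg) (auto simp: \<eta>_def field_simps)
      finally have "(\<Sum>i<2 ^ N. W i powr \<theta>) \<le> 2 * (Y * A powr \<theta>) * (\<Sum>i<2 ^ N. path_sum u N i powr \<theta>)" by simp
      also have "\<dots> \<le> (2 * (Y * A powr \<theta>) + 1) * (\<Sum>i<2 ^ N. path_sum u N i powr \<theta>)"
        by (intro mult_right_mono sum_nonneg) auto
      finally show "(\<Sum>i<2 ^ N. tree_op b u N i powr \<theta>) \<le> (2 * (Y * A powr \<theta>) + 1) * (\<Sum>i<2 ^ N. path_sum u N i powr \<theta>)"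
        unfolding W_def .
    qed
  qed
qed

lemma tree_op_bound:
  assumes "0 < \<theta>" "b > 1" "b * \<theta> > 1"
  obtains C where "C > 0" "\<And>N u. (\<And>L k. 0 \<le> u L k) \<Longrightarrow>
    (\<Sum>i<2 ^ N. tree_op b u N i powr \<theta>) \<le> C * (\<Sum>i<2 ^ N. path_sum u N i powr \<theta>)"
proof (cases "\<theta> \<le> 1")
  case True
  then show ?thesis using tree_op_bound_le_one[OF assms(1) True assms(3)] that by metis
next
  case False
  then show ?thesis using tree_op_bound_gt_one[of \<theta> b] assms(2) that by (metis not_le)
qed

section \<open>Localisation to dyadic arcs\<close>

lemma sum_powr_le_sum_powr:
  fixes a :: "'i \<Rightarrow> real"
  assumes "finite I" "\<And>i. i \<in> I \<Longrightarrow> 0 \<le> a i" "0 < \<theta>" "\<theta> \<le> 1"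
  shows "(\<Sum>i\<in>I. a i) powr \<theta> \<le> (\<Sum>i\<in>I. a i powr \<theta>)"
proof -
  define s where "s = (\<Sum>i\<in>I. a i)"
  have s: "s \<ge> 0" unfolding s_def using assms by (intro sum_nonneg) auto
  have "s powr \<theta> = (\<Sum>i\<in>I. a i * s powr (\<theta> - 1))"
    using powr_mult_base[OF s, of "\<theta> - 1"] by (simp add: s_def sum_distrib_right)
  also have "\<dots> \<le> (\<Sum>i\<in>I. a i powr \<theta>)"
  proof (rule sum_mono)
    fix i assume i: "i \<in> I"
    show "a i * s powr (\<theta> - 1) \<le> a i powr \<theta>"
    proof (cases "a i = 0")
      case False
      then have a: "a i > 0" using assms(2)[OF i] by simp
      have "a i \<le> s" unfolding s_def using assms i by (intro member_le_sum) auto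
      then have "s powr (\<theta> - 1) \<le> a i powr (\<theta> - 1)" using a assms by (intro powr_mono2') auto
      then have "a i * s powr (\<theta> - 1) \<le> a i * a i powr (\<theta> - 1)" using a by (intro mult_left_mono) auto
      also have "\<dots> = a i powr \<theta>" using a powr_mult_base[of "a i" "\<theta> - 1"] by simp
      finally show ?thesis .
    qed simp
  qed
  finally show ?thesis unfolding s_def .
qed

text \<open>Jensen's inequality for the weighted mean \<open>m\<close>, with Young's inequality as
  the tangent at \<open>m\<close>; zero total weight is treated apart because \<open>m\<close>
  divides by it.\<close>

lemma weighted_sum_powr_le:
  fixes w T :: "'i \<Rightarrow> real"
  assumes "finite I" and w: "\<And>i. i \<in> I \<Longrightarrow> 0 \<le> w i" and T: "\<And>i. i \<in> I \<Longrightarrow> 0 \<le> T i" and "1 < \<theta>"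
  shows "(\<Sum>i\<in>I. w i * T i) powr \<theta> \<le> (\<Sum>i\<in>I. w i) powr (\<theta> - 1) * (\<Sum>i\<in>I. w i * T i powr \<theta>)"
proof (cases "(\<Sum>i\<in>I. w i) = 0")
  case True
  then have "w i = 0" if "i \<in> I" for i using assms(1) w that by (simp add: sum_nonneg_eq_0_iff)
  then show ?thesis by simp
next
  case False
  define W where "W = (\<Sum>i\<in>I. w i)"
  have W: "W > 0" using False w sum_nonneg[of I w] unfolding W_def by fastforce
  define m where "m = (\<Sum>i\<in>I. w i * T i) / W"
  have m: "m \<ge> 0" unfolding m_def using W w T by (intro divide_nonneg_pos sum_nonneg mult_nonneg_nonneg) auto
  have "(\<theta> - 1) * W * m powr \<theta> + (\<Sum>i\<in>I. w i * T i powr \<theta>) \<ge> \<theta> * W * m powr \<theta>"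
  proof -
    have pt: "\<theta> * (m powr (\<theta> - 1) * t) \<le> (\<theta> - 1) * m powr \<theta> + t powr \<theta>" if t: "t \<ge> 0" for t
    proof -
      have "t * m powr (\<theta> - 1) \<le> t powr \<theta> / \<theta> + (m powr (\<theta> - 1)) powr (\<theta> / (\<theta> - 1)) / (\<theta> / (\<theta> - 1))"
        using assms t by (intro Youngs_inequality) (auto simp: field_simps)
      then have "\<theta> * (t * m powr (\<theta> - 1)) \<le> \<theta> * (t powr \<theta> / \<theta> + m powr \<theta> / (\<theta> / (\<theta> - 1)))"
        using assms by (intro mult_left_mono) (auto simp: powr_powr)
      also have "\<dots> = t powr \<theta> + (\<theta> - 1) * m powr \<theta>" using assms by (simp add: field_simps)
      finally show ?thesis by (simp add: mult_ac)
    qed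
    have "\<theta> * W * m powr \<theta> = \<theta> * m powr (\<theta> - 1) * (\<Sum>i\<in>I. w i * T i)"
      using W powr_mult_base[OF m, of "\<theta> - 1"] unfolding m_def by (simp add: field_simps)
    also have "\<dots> = (\<Sum>i\<in>I. w i * (\<theta> * (m powr (\<theta> - 1) * T i)))" by (simp add: sum_distrib_left mult_ac)
    also have "\<dots> \<le> (\<Sum>i\<in>I. w i * ((\<theta> - 1) * m powr \<theta> + T i powr \<theta>))"
      by (intro sum_mono mult_left_mono pt w T)
    also have "\<dots> = (\<theta> - 1) * W * m powr \<theta> + (\<Sum>i\<in>I. w i * T i powr \<theta>)"
      unfolding W_def by (simp add: distrib_left sum.distrib sum_distrib_left sum_distrib_right mult_ac)
    finally show ?thesis .
  qed
  then have "W * m powr \<theta> \<le> (\<Sum>i\<in>I. w i * T i powr \<theta>)" by (simp add: algebra_simps)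
  then have "W powr (\<theta> - 1) * (W * m powr \<theta>) \<le> W powr (\<theta> - 1) * (\<Sum>i\<in>I. w i * T i powr \<theta>)"
    by (intro mult_left_mono) auto
  also have "W powr (\<theta> - 1) * (W * m powr \<theta>) = (W * m) powr \<theta>"
    using W m powr_mult_base[of W "\<theta> - 1"] by (simp add: powr_mult mult_ac)
  also have "W * m = (\<Sum>i\<in>I. w i * T i)" unfolding m_def using W by simp
  finally show ?thesis unfolding W_def .
qed

definition lev :: "nat \<Rightarrow> real \<Rightarrow> nat" where
  "lev n x = nat \<lfloor>2 ^ n * x\<rfloor>"

lemma mem_dyadic_iff: "0 \<le> x \<Longrightarrow> x \<in> dyadic n m \<longleftrightarrow> lev n x = m"
proof -
  assume "0 \<le> x"
  then have "0 \<le> \<lfloor>2 ^ n * x\<rfloor>" by simp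
  then have "lev n x = m \<longleftrightarrow> \<lfloor>2 ^ n * x\<rfloor> = int m" unfolding lev_def by auto
  also have "\<dots> \<longleftrightarrow> x \<in> dyadic n m" by (simp add: floor_eq_iff dyadic_def field_simps)
  finally show ?thesis by simp
qed

lemma dyadic_nonneg: "x \<in> dyadic n m \<Longrightarrow> 0 \<le> x"
  by (auto simp: dyadic_def intro: order_trans[rotated])

lemma dyadic_less_one:
  assumes "x \<in> dyadic n m" "m < 2 ^ n"
  shows "x < 1"
proof -
  have "real m + 1 \<le> 2 ^ n" using assms(2) by (metis Suc_eq_plus1 Suc_leI of_nat_Suc of_nat_le_iff of_nat_numeral of_nat_power add.commute)
  then have "(real m + 1) / 2 ^ n \<le> 1" by simp
  moreover have "x < (real m + 1) / 2 ^ n" using assms(1) by (simp add: dyadic_def)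
  ultimately show ?thesis by (rule order_less_le_trans[rotated])
qed

lemma lev_div:
  assumes "0 \<le> x"
  shows "lev n x = lev (n + m) x div 2 ^ m"
proof -
  have "\<lfloor>2 ^ n * x\<rfloor> = \<lfloor>2 ^ (n + m) * x / real_of_int (2 ^ m)\<rfloor>" by (simp add: power_add)
  also have "\<dots> = \<lfloor>2 ^ (n + m) * x\<rfloor> div 2 ^ m" by (rule floor_divide_real_eq_div) simp
  finally show ?thesis using assms unfolding lev_def by (simp add: nat_div_distrib nat_power_eq)
qed

lemma lev_less: "0 \<le> x \<Longrightarrow> x < 1 \<Longrightarrow> lev n x < 2 ^ n"
  unfolding lev_def by (simp add: nat_less_iff floor_less_iff)

lemma lev_dyadic:
  assumes "x \<in> dyadic j k" "L \<le> N"
  shows "lev (j + N) x mod 2 ^ N < 2 ^ N" "lev (j + L) x = k * 2 ^ L + lev (j + N) x mod 2 ^ N div 2 ^ (N - L)"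
proof -
  have x: "0 \<le> x" using assms dyadic_nonneg by blast
  define i where "i = lev (j + N) x mod 2 ^ N"
  have "lev (j + N) x div 2 ^ N = k" using lev_div[OF x, of j N] mem_dyadic_iff[OF x] assms by simp
  then have *: "lev (j + N) x = k * 2 ^ N + i" unfolding i_def by (metis div_mult_mod_eq)
  have N: "2 ^ N = 2 ^ L * (2::nat) ^ (N - L)" using assms by (simp flip: power_add)
  have "lev (j + L) x = lev (j + N) x div 2 ^ (N - L)"
    using lev_div[OF x, of "j + L" "N - L"] assms by simp
  also have "\<dots> = k * 2 ^ L + i div 2 ^ (N - L)"
    unfolding * N mult.assoc[symmetric] by (rule div_mult_self3) simp
  finally show "lev (j + L) x = k * 2 ^ L + lev (j + N) x mod 2 ^ N div 2 ^ (N - L)" unfolding i_def .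
qed simp

lemma nn_integral_dyadic_step:
  fixes c :: "nat \<Rightarrow> ennreal"
  shows "(\<integral>\<^sup>+ x. c (lev (j + N) x mod 2 ^ N) * indicator (dyadic j k) x \<partial>lborel)
    = (\<Sum>i<2 ^ N. c i) * ennreal (1 / 2 ^ (j + N))"
proof -
  let ?D = "\<lambda>i. dyadic (j + N) (k * 2 ^ N + i)"
  have eq: "c (lev (j + N) x mod 2 ^ N) * indicator (dyadic j k) x = (\<Sum>i<2 ^ N. c i * indicator (?D i) x)" for x
  proof (cases "x \<in> dyadic j k")
    case True
    then have x: "0 \<le> x" using dyadic_nonneg by blast
    have "lev (j + N) x = k * 2 ^ N + lev (j + N) x mod 2 ^ N" using lev_dyadic(2)[OF True, of N N] by simp
    then have "x \<in> ?D i \<longleftrightarrow> i = lev (j + N) x mod 2 ^ N" for i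
      unfolding mem_dyadic_iff[OF x] by (metis add_left_cancel)
    then have "(\<Sum>i<2 ^ N. c i * indicator (?D i) x) = (\<Sum>i<2 ^ N. if i = lev (j + N) x mod 2 ^ N then c i else 0)"
      by (intro sum.cong refl) (auto simp: indicator_def)
    then show ?thesis using True by simp
  next
    case False
    have "x \<notin> ?D i" if "i < 2 ^ N" for i
    proof
      assume D: "x \<in> ?D i"
      then have x: "0 \<le> x" using dyadic_nonneg by blast
      have "lev j x = (k * 2 ^ N + i) div 2 ^ N" using lev_div[OF x, of j N] D mem_dyadic_iff[OF x] by simp
      then have "lev j x = k" using that by simp
      then show False using False mem_dyadic_iff[OF x] by simp
    qed
    then show ?thesis using False by simp
  qed
  have emeasure: "emeasure lborel (?D i) = ennreal (1 / 2 ^ (j + N))" for i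
    unfolding dyadic_def by (simp add: diff_divide_distrib[symmetric] divide_right_mono)
  have "(\<integral>\<^sup>+ x. c (lev (j + N) x mod 2 ^ N) * indicator (dyadic j k) x \<partial>lborel)
    = (\<Sum>i<2 ^ N. \<integral>\<^sup>+ x. c i * indicator (?D i) x \<partial>lborel)"
    unfolding eq by (intro nn_integral_sum) (auto simp: dyadic_def)
  also have "\<dots> = (\<Sum>i<2 ^ N. c i * emeasure lborel (?D i))"
    by (intro sum.cong refl nn_integral_cmult_indicator) (auto simp: dyadic_def)
  finally show ?thesis unfolding emeasure by (simp add: sum_distrib_right)
qed

text \<open>For adjacent arcs (\<open>e = 1\<close>) the reflection does not increase the distance,
  \<open>D \<le> A\<close>, whereas a translation could carry neighbours across the common endpoint
  to opposite ends. For \<open>e \<ge> 2\<close> the true distance exceeds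
  \<open>(e - 1) * B\<close> while \<open>1 + D \<le> B\<close>, and
  \<open>1 + e \<le> 3 * (e - 1)\<close> gives the constant 3.\<close>

lemma reflected_weight_ge:
  fixes J J0 B k c :: nat
  assumes "k < B" "c < B"
  defines "\<rho> \<equiv> if J = J0 then k else B - 1 - k"
  shows "(1 + \<bar>real J - real J0\<bar>) * (1 + \<bar>real \<rho> - real c\<bar>) \<le> 3 * (1 + \<bar>real (J * B + k) - real (J0 * B + c)\<bar>)"
proof (cases "J = J0")
  case True
  then show ?thesis by (simp add: \<rho>_def)
next
  case False
  have \<rho>: "real \<rho> = real B - 1 - real k" using False assms by (simp add: \<rho>_def of_nat_diff)
  define e where "e = \<bar>real J - real J0\<bar>"
  have e1: "e \<ge> 1" using False unfolding e_def by linarith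
  have B: "real k \<le> real B - 1" "real c \<le> real B - 1" using assms by linarith+
  define D where "D = \<bar>real \<rho> - real c\<bar>"
  have D: "1 + D \<le> real B" "D \<ge> 0" unfolding D_def \<rho> using B by linarith+
  define A where "A = \<bar>real (J * B + k) - real (J0 * B + c)\<bar>"
  have A: "A = \<bar>(real J - real J0) * real B + real k - real c\<bar>" unfolding A_def by (simp add: algebra_simps)
  have eB: "\<bar>(real J - real J0) * real B\<bar> = e * real B" by (simp add: e_def abs_mult)
  show ?thesis
  proof (cases "e = 1")
    case True
    then have "(real J - real J0) * real B = real B \<or> (real J - real J0) * real B = - real B"
      unfolding e_def by (metis abs_if minus_minus mult_1 mult_minus_left)
    then have "D \<le> A" unfolding A D_def \<rho> using B by linarith
    then show ?thesis using True D(2) unfolding e_def[symmetric] D_def[symmetric] A_def[symmetric] by simp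
  next
    case False
    define z where "z = \<bar>int J - int J0\<bar>"
    have ez: "e = real_of_int z" unfolding e_def z_def by simp
    have "z \<ge> 1" "z \<noteq> 1" using e1 False ez by auto
    then have e2: "e \<ge> 2" using ez by simp
    have "A \<ge> e * real B - (real B - 1)" unfolding A using eB B by linarith
    then have "3 * (1 + A) \<ge> 3 * (e - 1) * real B" by (simp add: algebra_simps)
    also have "3 * (e - 1) * real B \<ge> (1 + e) * real B"
      using e2 by (intro mult_right_mono) auto
    also have "(1 + e) * real B \<ge> (1 + e) * (1 + D)" using e2 D by (intro mult_left_mono) auto
    finally show ?thesis unfolding e_def[symmetric] D_def[symmetric] A_def[symmetric] by simp
  qed
qed

text \<open>Reflection commutes with passing to ancestors, so it acts on the whole tree over an arc
  and preserves branches.\<close>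

lemma reflect_div_level:
  assumes "L \<le> N" "i < 2 ^ N"
  shows "(2 ^ N - 1 - i) div 2 ^ (N - L) = 2 ^ L - 1 - i div (2::nat) ^ (N - L)"
proof -
  let ?m = "2 ^ (N - L) :: nat"
  have N: "2 ^ N = 2 ^ L * ?m" using assms by (simp flip: power_add)
  have q: "i div ?m < 2 ^ L" using div_level_less assms by blast
  define q r where "q = i div ?m" and "r = i mod ?m"
  have i: "i = q * ?m + r" unfolding q_def r_def by (rule div_mult_mod_eq[symmetric])
  have r: "r < ?m" unfolding r_def by simp
  have "2 ^ N - 1 - i = (2 ^ L - 1 - q) * ?m + (?m - 1 - r)"
  proof -
    from less_imp_Suc_add[OF q[folded q_def]] obtain t where t: "2 ^ L = q + 1 + t" by auto
    from less_imp_Suc_add[OF r] obtain t' where t': "?m = r + 1 + t'" by auto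
    have "2 ^ N = q * ?m + ?m + t * ?m" unfolding N t by (simp add: algebra_simps)
    then have "2 ^ N = i + 1 + (t * ?m + t')" using i t' by linarith
    moreover have "2 ^ L - 1 - q = t" "?m - 1 - r = t'" using t t' by linarith+
    ultimately show ?thesis by simp
  qed
  also have "\<dots> div ?m = 2 ^ L - 1 - q"
  proof -
    have *: "(a * ?m + b) div ?m = a" if "b < ?m" for a b using that by simp
    show ?thesis by (rule *) simp
  qed
  finally show ?thesis unfolding q_def .
qed

lemma sum_reflect:
  fixes f :: "nat \<Rightarrow> 'b::comm_monoid_add"
  shows "(\<Sum>i<n. f (n - 1 - i)) = (\<Sum>i<n. f i)"
  using sum.nat_diff_reindex[of f n] by simp

lemma sum_split_mult:
  fixes f :: "nat \<Rightarrow> 'b::comm_monoid_add"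
  shows "(\<Sum>K<A * B. f K) = (\<Sum>J<A. \<Sum>k<B. f (J * B + k))"
proof -
  have "(\<Sum>K<A * B. f K) = (\<Sum>J<A. sum f {J * B..<J * B + B})" by (rule sum.nat_group[symmetric])
  also have "\<dots> = (\<Sum>J<A. \<Sum>k<B. f (J * B + k))"
  proof (rule sum.cong[OF refl])
    show "sum f {J * B..<J * B + B} = (\<Sum>k<B. f (J * B + k))" for J
      using sum.shift_bounds_nat_ivl[of f 0 "J * B" B] by (simp add: atLeast0LessThan add.commute)
  qed
  finally show ?thesis .
qed

text \<open>Tail contributions from an arc at distance \<open>\<nu>\<close> arcs are reduced to the given arc by reflecting the
  far arc onto it, which decreases all distances and gains a factor \<open>(1 + \<nu>)\<^sup>-\<^sup>b\<close>.\<close>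

lemma local_tree_bound:
  assumes \<theta>: "0 < \<theta>" and b: "b > 1" "b * \<theta> > 1"
  shows "\<exists>C>0. \<forall>(g :: nat \<Rightarrow> nat \<Rightarrow> real) j k0 N X. (\<forall>n k. 0 \<le> g n k) \<longrightarrow> k0 < 2 ^ j \<longrightarrow>
    (\<forall>\<kappa><2 ^ j. (\<Sum>i<2 ^ N. (\<Sum>L\<le>N. g (j + L) (\<kappa> * 2 ^ L + i div 2 ^ (N - L))) powr \<theta>) \<le> X) \<longrightarrow>
    (\<Sum>i<2 ^ N. (\<Sum>L\<le>N. \<Sum>K<3 * 2 ^ (j + L).
        (1 + \<bar>real K - real (k0 * 2 ^ L + i div 2 ^ (N - L) + 2 ^ (j + L))\<bar>) powr (- b) * g (j + L) (K mod 2 ^ (j + L))) powr \<theta>)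
      \<le> C * X"
proof (rule tree_op_bound[OF \<theta> b])
  fix C assume C: "C > 0" "\<And>N u. (\<And>L k. 0 \<le> u L k) \<Longrightarrow>
    (\<Sum>i<2 ^ N. tree_op b u N i powr \<theta>) \<le> C * (\<Sum>i<2 ^ N. path_sum u N i powr \<theta>)"
  obtain Z where Z: "Z > 0" "\<And>n k. (\<Sum>k'<n. (1 + \<bar>real k - real k'\<bar>) powr (- b)) \<le> Z"
    using sum_weights_le[OF b(1)] by blast
  obtain Z' where Z': "Z' > 0" "\<And>n k. (\<Sum>k'<n. (1 + \<bar>real k - real k'\<bar>) powr (- (b * \<theta>))) \<le> Z'"
    using sum_weights_le[OF b(2)] by blast
  define C' where "C' = (3 powr b) powr \<theta> * (C * (Z powr \<theta> + Z'))"
  have "C' > 0" unfolding C'_def using C Z Z' by (intro mult_pos_pos add_nonneg_pos) auto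
  show ?thesis
  proof (intro exI[of _ C'] conjI allI impI)
    show "C' > 0" by fact
    fix g :: "nat \<Rightarrow> nat \<Rightarrow> real" and j k0 N :: nat and X :: real
    assume g: "\<forall>n k. 0 \<le> g n k" and k0: "k0 < 2 ^ j"
      and X: "\<forall>\<kappa><2 ^ j. (\<Sum>i<2 ^ N. (\<Sum>L\<le>N. g (j + L) (\<kappa> * 2 ^ L + i div 2 ^ (N - L))) powr \<theta>) \<le> X"
    \<comment> \<open>\<open>J\<close> runs through the arcs of rank \<open>j\<close> in three
      periods; \<open>J0\<close> is the given arc in the middle one.\<close>
    define J0 where "J0 = k0 + 2 ^ j"
    define w where "w = (\<lambda>J. (1 + \<bar>real J - real J0\<bar>) powr (- b))"
    define u where "u = (\<lambda>J L k. g (j + L) ((J mod 2 ^ j) * 2 ^ L + (if J = J0 then k else 2 ^ L - 1 - k)))"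
    have u0: "0 \<le> u J L k" for J L k unfolding u_def using g by simp
    let ?T = "\<lambda>J i. tree_op b (u J) N i"
    have T0: "0 \<le> ?T J i" for J i by (rule tree_op_nonneg[OF u0])
    have X0: "X \<ge> 0"
      using X[rule_format, of 0] sum_nonneg[of "{..<2 ^ N}" "\<lambda>i. (\<Sum>L\<le>N. g (j + L) (0 * 2 ^ L + i div 2 ^ (N - L))) powr \<theta>"]
      by force
    \<comment> \<open>Reflection only permutes the leaves, so the path sums of each transplanted
      tree obey the hypothesis for the arc \<open>J mod 2 ^ j\<close>.\<close>
    have path: "(\<Sum>i<2 ^ N. path_sum (u J) N i powr \<theta>) \<le> X" for J
    proof -
      define G where "G = (\<lambda>i. (\<Sum>L\<le>N. g (j + L) ((J mod 2 ^ j) * 2 ^ L + i div 2 ^ (N - L))) powr \<theta>)"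
      have "path_sum (u J) N i powr \<theta> = (if J = J0 then G i else G (2 ^ N - 1 - i))" if "i < 2 ^ N" for i
        unfolding path_sum_def u_def G_def using reflect_div_level[OF _ that] by (auto intro!: sum.cong arg_cong[where f="\<lambda>x. x powr \<theta>"])
      then have "(\<Sum>i<2 ^ N. path_sum (u J) N i powr \<theta>) = (\<Sum>i<2 ^ N. if J = J0 then G i else G (2 ^ N - 1 - i))"
        by (intro sum.cong) auto
      also have "\<dots> = (\<Sum>i<2 ^ N. G i)" using sum_reflect[of G "2 ^ N"] by (cases "J = J0") simp_all
      also have "\<dots> \<le> X" unfolding G_def using X by simp
      finally show ?thesis .
    qed
    have T: "(\<Sum>i<2 ^ N. ?T J i powr \<theta>) \<le> C * X" for J
      using C(2)[of "u J" N, OF u0] mult_left_mono[OF path[of J], of C] C(1) by linarith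
    have pt: "(\<Sum>L\<le>N. \<Sum>K<3 * 2 ^ (j + L).
        (1 + \<bar>real K - real (k0 * 2 ^ L + i div 2 ^ (N - L) + 2 ^ (j + L))\<bar>) powr (- b) * g (j + L) (K mod 2 ^ (j + L)))
        \<le> 3 powr b * (\<Sum>J<3 * 2 ^ j. w J * ?T J i)" if i: "i < 2 ^ N" for i
    proof -
      have level: "(\<Sum>K<3 * 2 ^ (j + L).
          (1 + \<bar>real K - real (k0 * 2 ^ L + i div 2 ^ (N - L) + 2 ^ (j + L))\<bar>) powr (- b) * g (j + L) (K mod 2 ^ (j + L)))
        \<le> (\<Sum>J<3 * 2 ^ j. 3 powr b * (w J * (\<Sum>k<2 ^ L. (1 + \<bar>real k - real (i div 2 ^ (N - L))\<bar>) powr (- b) * u J L k)))"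
        if "L \<in> {..N}" for L
      proof -
        have L: "L \<le> N" using that by simp
        define c where "c = i div 2 ^ (N - L)"
        have c: "c < 2 ^ L" unfolding c_def by (rule div_level_less[OF L i])
        have "(\<Sum>K<3 * 2 ^ (j + L). (1 + \<bar>real K - real (k0 * 2 ^ L + c + 2 ^ (j + L))\<bar>) powr (- b) * g (j + L) (K mod 2 ^ (j + L)))
          = (\<Sum>J<3 * 2 ^ j. \<Sum>k<2 ^ L. (1 + \<bar>real (J * 2 ^ L + k) - real (J0 * 2 ^ L + c)\<bar>) powr (- b) * g (j + L) ((J mod 2 ^ j) * 2 ^ L + k))"
        proof -
          have 1: "3 * 2 ^ (j + L) = (3 * 2 ^ j) * (2::nat) ^ L" by (simp add: power_add)
          have 2: "k0 * 2 ^ L + c + 2 ^ (j + L) = J0 * 2 ^ L + c" by (simp add: J0_def power_add algebra_simps)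
          have 3: "(J * 2 ^ L + k) mod 2 ^ (j + L) = (J mod 2 ^ j) * 2 ^ L + k" if "k < 2 ^ L" for J k :: nat
            using mod_mult2_eq[of "J * 2 ^ L + k" "2 ^ L" "2 ^ j"] that by (simp add: power_add mult.commute)
          show ?thesis unfolding 1 2 sum_split_mult by (intro sum.cong refl) (simp add: 3)
        qed
        also have "\<dots> \<le> (\<Sum>J<3 * 2 ^ j. 3 powr b * (w J * (\<Sum>k<2 ^ L. (1 + \<bar>real k - real c\<bar>) powr (- b) * u J L k)))"
        proof (rule sum_mono)
          fix J
          let ?\<rho> = "\<lambda>k. if J = J0 then k else 2 ^ L - 1 - k"
          let ?h = "\<lambda>k. (1 + \<bar>real k - real c\<bar>) powr (- b) * u J L k"
          have "(\<Sum>k<2 ^ L. (1 + \<bar>real (J * 2 ^ L + k) - real (J0 * 2 ^ L + c)\<bar>) powr (- b) * g (j + L) ((J mod 2 ^ j) * 2 ^ L + k))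
            \<le> (\<Sum>k<2 ^ L. 3 powr b * (w J * ?h (?\<rho> k)))"
          proof (rule sum_mono)
            fix k assume "k \<in> {..<(2::nat) ^ L}"
            then have k: "k < 2 ^ L" by simp
            have "?\<rho> (?\<rho> k) = k" using k by auto
            then have gu: "g (j + L) ((J mod 2 ^ j) * 2 ^ L + k) = u J L (?\<rho> k)" unfolding u_def by auto
            have "(1 + \<bar>real (J * 2 ^ L + k) - real (J0 * 2 ^ L + c)\<bar>) powr (- b) \<le>
               (1 / 3 * ((1 + \<bar>real J - real J0\<bar>) * (1 + \<bar>real (?\<rho> k) - real c\<bar>))) powr (- b)"
              using reflected_weight_ge[OF k c, of J J0] b by (intro powr_mono2') (auto intro!: add_pos_nonneg)
            also have "\<dots> = 3 powr b * (w J * (1 + \<bar>real (?\<rho> k) - real c\<bar>) powr (- b))"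
              unfolding w_def by (subst powr_mult, simp, subst powr_mult) (simp_all add: powr_divide powr_minus_divide)
            finally show "(1 + \<bar>real (J * 2 ^ L + k) - real (J0 * 2 ^ L + c)\<bar>) powr (- b) * g (j + L) ((J mod 2 ^ j) * 2 ^ L + k)
                \<le> 3 powr b * (w J * ?h (?\<rho> k))"
              unfolding gu using mult_right_mono[OF _ u0[of J L "?\<rho> k"]] by (fastforce simp: mult.assoc)
          qed
          also have "\<dots> = 3 powr b * (w J * (\<Sum>k<2 ^ L. ?h (?\<rho> k)))" by (simp add: sum_distrib_left)
          also have "(\<Sum>k<2 ^ L. ?h (?\<rho> k)) = (\<Sum>k<2 ^ L. ?h k)"
            using sum_reflect[of ?h "2 ^ L"] by (cases "J = J0") auto
          finally show "(\<Sum>k<2 ^ L. (1 + \<bar>real (J * 2 ^ L + k) - real (J0 * 2 ^ L + c)\<bar>) powr (- b) * g (j + L) ((J mod 2 ^ j) * 2 ^ L + k))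
            \<le> 3 powr b * (w J * (\<Sum>k<2 ^ L. ?h k))" .
        qed
        finally show ?thesis unfolding c_def .
      qed
      have "(\<Sum>L\<le>N. \<Sum>K<3 * 2 ^ (j + L).
          (1 + \<bar>real K - real (k0 * 2 ^ L + i div 2 ^ (N - L) + 2 ^ (j + L))\<bar>) powr (- b) * g (j + L) (K mod 2 ^ (j + L)))
        \<le> (\<Sum>L\<le>N. \<Sum>J<3 * 2 ^ j. 3 powr b * (w J * (\<Sum>k<2 ^ L. (1 + \<bar>real k - real (i div 2 ^ (N - L))\<bar>) powr (- b) * u J L k)))"
        by (rule sum_mono[OF level])
      also have "\<dots> = (\<Sum>J<3 * 2 ^ j. \<Sum>L\<le>N. 3 powr b * (w J * (\<Sum>k<2 ^ L. (1 + \<bar>real k - real (i div 2 ^ (N - L))\<bar>) powr (- b) * u J L k)))"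
        by (rule sum.swap)
      also have "\<dots> = 3 powr b * (\<Sum>J<3 * 2 ^ j. w J * ?T J i)"
        unfolding tree_op_def sum_distrib_left ..
      finally show ?thesis .
    qed
    \<comment> \<open>For \<open>\<theta> \<le> 1\<close> the power is subadditive and the sum of
      \<open>w J powr \<theta>\<close> is at most \<open>Z'\<close>, where
      \<open>b * \<theta> > 1\<close> enters; for \<open>\<theta> > 1\<close> Jensen's inequality
      needs the sum of the weights themselves, at most \<open>Z\<close>, where \<open>b > 1\<close>
      enters.\<close>
    have main: "(\<Sum>i<2 ^ N. (\<Sum>J<3 * 2 ^ j. w J * ?T J i) powr \<theta>) \<le> (Z powr \<theta> + Z') * (C * X)"
    proof -
      have CX: "0 \<le> C * X" using C X0 by simp
      have wZ: "(\<Sum>J<3 * 2 ^ j. w J) \<le> Z" unfolding w_def using Z(2)[of J0 "3 * 2 ^ j"] by (simp add: abs_minus_commute)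
      show ?thesis
      proof (cases "\<theta> \<le> 1")
        case True
        have "(\<Sum>i<2 ^ N. (\<Sum>J<3 * 2 ^ j. w J * ?T J i) powr \<theta>) \<le> (\<Sum>i<2 ^ N. \<Sum>J<3 * 2 ^ j. (w J * ?T J i) powr \<theta>)"
          using True \<theta> T0 by (intro sum_mono sum_powr_le_sum_powr) (auto simp: w_def)
        also have "\<dots> = (\<Sum>J<3 * 2 ^ j. \<Sum>i<2 ^ N. (w J * ?T J i) powr \<theta>)" by (rule sum.swap)
        also have "\<dots> = (\<Sum>J<3 * 2 ^ j. w J powr \<theta> * (\<Sum>i<2 ^ N. ?T J i powr \<theta>))"
          using T0 by (simp add: powr_mult sum_distrib_left w_def)
        also have "\<dots> \<le> (\<Sum>J<3 * 2 ^ j. w J powr \<theta> * (C * X))"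
          by (intro sum_mono mult_left_mono T) auto
        also have "\<dots> = (\<Sum>J<3 * 2 ^ j. (1 + \<bar>real J0 - real J\<bar>) powr (- (b * \<theta>))) * (C * X)"
          unfolding w_def by (simp add: powr_powr sum_distrib_right abs_minus_commute)
        also have "\<dots> \<le> Z' * (C * X)" using Z'(2)[of J0 "3 * 2 ^ j"] CX by (intro mult_right_mono)
        also have "\<dots> \<le> (Z powr \<theta> + Z') * (C * X)" using CX by (intro mult_right_mono) auto
        finally show ?thesis .
      next
        case False
        then have \<theta>1: "\<theta> > 1" by simp
        have "(\<Sum>i<2 ^ N. (\<Sum>J<3 * 2 ^ j. w J * ?T J i) powr \<theta>)
            \<le> (\<Sum>i<2 ^ N. Z powr (\<theta> - 1) * (\<Sum>J<3 * 2 ^ j. w J * ?T J i powr \<theta>))"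
        proof (rule sum_mono)
          fix i
          have "(\<Sum>J<3 * 2 ^ j. w J * ?T J i) powr \<theta>
            \<le> (\<Sum>J<3 * 2 ^ j. w J) powr (\<theta> - 1) * (\<Sum>J<3 * 2 ^ j. w J * ?T J i powr \<theta>)"
            by (intro weighted_sum_powr_le \<theta>1 T0) (auto simp: w_def)
          also have "\<dots> \<le> Z powr (\<theta> - 1) * (\<Sum>J<3 * 2 ^ j. w J * ?T J i powr \<theta>)"
            using \<theta>1 wZ T0 by (intro mult_right_mono powr_mono2 sum_nonneg mult_nonneg_nonneg) (auto simp: w_def)
          finally show "(\<Sum>J<3 * 2 ^ j. w J * ?T J i) powr \<theta> \<le> Z powr (\<theta> - 1) * (\<Sum>J<3 * 2 ^ j. w J * ?T J i powr \<theta>)" .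
        qed
        also have "\<dots> = Z powr (\<theta> - 1) * (\<Sum>i<2 ^ N. \<Sum>J<3 * 2 ^ j. w J * ?T J i powr \<theta>)"
          by (simp add: sum_distrib_left)
        also have "(\<Sum>i<2 ^ N. \<Sum>J<3 * 2 ^ j. w J * ?T J i powr \<theta>) = (\<Sum>J<3 * 2 ^ j. w J * (\<Sum>i<2 ^ N. ?T J i powr \<theta>))"
          unfolding sum_distrib_left by (rule sum.swap)
        also have "\<dots> \<le> (\<Sum>J<3 * 2 ^ j. w J * (C * X))"
          by (intro sum_mono mult_left_mono T) (auto simp: w_def)
        also have "\<dots> \<le> Z * (C * X)"
          unfolding sum_distrib_right[symmetric] using wZ CX by (intro mult_right_mono)
        finally have "(\<Sum>i<2 ^ N. (\<Sum>J<3 * 2 ^ j. w J * ?T J i) powr \<theta>) \<le> Z powr (\<theta> - 1) * (Z * (C * X))"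
          by (simp add: mult_left_mono)
        also have "\<dots> = (Z * Z powr (\<theta> - 1)) * (C * X)" by (simp only: mult_ac)
        also have "\<dots> = Z powr \<theta> * (C * X)" using powr_mult_base[of Z "\<theta> - 1"] Z(1) by simp
        also have "\<dots> \<le> (Z powr \<theta> + Z') * (C * X)" using CX Z' by (intro mult_right_mono) auto
        finally show ?thesis .
      qed
    qed
    have "(\<Sum>i<2 ^ N. (\<Sum>L\<le>N. \<Sum>K<3 * 2 ^ (j + L).
        (1 + \<bar>real K - real (k0 * 2 ^ L + i div 2 ^ (N - L) + 2 ^ (j + L))\<bar>) powr (- b) * g (j + L) (K mod 2 ^ (j + L))) powr \<theta>)
      \<le> (\<Sum>i<2 ^ N. (3 powr b * (\<Sum>J<3 * 2 ^ j. w J * ?T J i)) powr \<theta>)"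
      using \<theta> g by (intro sum_mono powr_mono2 pt sum_nonneg mult_nonneg_nonneg) auto
    also have "\<dots> = (3 powr b) powr \<theta> * (\<Sum>i<2 ^ N. (\<Sum>J<3 * 2 ^ j. w J * ?T J i) powr \<theta>)"
    proof -
      have "(3 powr b * (\<Sum>J<3 * 2 ^ j. w J * ?T J i)) powr \<theta> = (3 powr b) powr \<theta> * (\<Sum>J<3 * 2 ^ j. w J * ?T J i) powr \<theta>" for i
        by (rule powr_mult)
      then show ?thesis by (simp only: sum_distrib_left[symmetric])
    qed
    also have "\<dots> \<le> (3 powr b) powr \<theta> * ((Z powr \<theta> + Z') * (C * X))"
      by (intro mult_left_mono main) auto
    also have "\<dots> = C' * X" unfolding C'_def by (simp add: mult_ac)
    finally show "(\<Sum>i<2 ^ N. (\<Sum>L\<le>N. \<Sum>K<3 * 2 ^ (j + L).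
        (1 + \<bar>real K - real (k0 * 2 ^ L + i div 2 ^ (N - L) + 2 ^ (j + L))\<bar>) powr (- b) * g (j + L) (K mod 2 ^ (j + L))) powr \<theta>)
      \<le> C' * X" .
  qed
qed

section \<open>Powers of extended reals and comparison of dyadic quasi-norms\<close>

lemma epow_ennreal: "0 \<le> x \<Longrightarrow> epow (ennreal x) t = ennreal (x powr t)"
  by (simp add: epow_def)

lemma epow_mono:
  assumes "0 \<le> t" "x \<le> y"
  shows "epow x t \<le> epow y t"
proof (cases "y = \<infinity>")
  case False
  then have "x \<noteq> \<infinity>" "enn2real x \<le> enn2real y"
    using assms by (auto simp: top_unique enn2real_mono less_top)
  then show ?thesis using False assms by (auto simp: epow_def intro!: ennreal_leI powr_mono2)
qed (simp add: epow_def)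

lemma epow_cmult:
  assumes "0 < c"
  shows "epow (ennreal c * x) t = ennreal (c powr t) * epow x t"
proof (cases x)
  case (real r)
  then show ?thesis
    using assms by (simp add: epow_ennreal ennreal_mult'[symmetric] powr_mult)
next
  case top
  then show ?thesis using assms by (simp add: epow_def ennreal_mult_top)
qed

lemma epow_epow:
  assumes "t \<noteq> 0"
  shows "epow (epow x t) (1 / t) = x"
  using assms by (cases x) (simp_all add: epow_def powr_powr)

lemma epow_SUP:
  assumes "0 < t"
  shows "epow (SUP n\<in>A. X n) t = (SUP n\<in>A. epow (X n) t)"
proof (rule antisym)
  define z where "z = (SUP n\<in>A. epow (X n) t)"
  have "X n \<le> epow z (1 / t)" if "n \<in> A" for n
  proof -
    have "epow (X n) t \<le> z" unfolding z_def using that by (rule SUP_upper)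
    then have "epow (epow (X n) t) (1 / t) \<le> epow z (1 / t)" using assms by (intro epow_mono) auto
    then show ?thesis using epow_epow[of t "X n"] assms by simp
  qed
  then have "(SUP n\<in>A. X n) \<le> epow z (1 / t)" by (rule SUP_least)
  then have "epow (SUP n\<in>A. X n) t \<le> epow (epow z (1 / t)) t" using assms by (intro epow_mono) auto
  also have "epow (epow z (1 / t)) t = z" using epow_epow[of "1 / t" z] assms by simp
  finally show "epow (SUP n\<in>A. X n) t \<le> (SUP n\<in>A. epow (X n) t)" unfolding z_def .
  show "(SUP n\<in>A. epow (X n) t) \<le> epow (SUP n\<in>A. X n) t"
    using assms by (intro SUP_least epow_mono SUP_upper) auto
qed

lemma epow_measurable [measurable]: "(\<lambda>x. epow x t) \<in> borel_measurable borel"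
  unfolding epow_def by measurable

lemma lev_measurable [measurable]: "lev n \<in> borel \<rightarrow>\<^sub>M count_space UNIV"
  unfolding lev_def by measurable

lemma dyadic_measurable [measurable, simp]: "dyadic n m \<in> sets borel"
  unfolding dyadic_def by simp

text \<open>The integral is a supremum over simple functions below the integrand, and dividing such
  a function by \<open>C\<close> gives one below \<open>F\<close>. The inequality is thus available
  for an arbitrary \<open>F\<close>, such as a bracket containing Peetre suprema.\<close>

lemma nn_integral_cmult_le:
  assumes C: "C > 0"
  shows "(\<integral>\<^sup>+ x. ennreal C * F x \<partial>M) \<le> ennreal C * (\<integral>\<^sup>+ x. F x \<partial>M)"
proof -
  have "(\<integral>\<^sup>+ x. ennreal C * F x \<partial>M) = (SUP s\<in>{s. simple_function M s \<and> s \<le> (\<lambda>x. ennreal C * F x)}. integral\<^sup>S M s)"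
    unfolding nn_integral_def by simp
  also have "\<dots> \<le> ennreal C * (\<integral>\<^sup>+ x. F x \<partial>M)"
  proof (rule SUP_least, clarsimp)
    fix s assume s: "simple_function M s" "s \<le> (\<lambda>x. ennreal C * F x)"
    have CC: "ennreal C * ennreal (1 / C) = 1" using C by (simp add: ennreal_mult[symmetric])
    have "ennreal (1 / C) * s x \<le> F x" for x
    proof -
      have "ennreal (1 / C) * s x \<le> ennreal (1 / C) * (ennreal C * F x)" using s(2) by (intro mult_left_mono) (auto simp: le_fun_def)
      also have "\<dots> = F x" unfolding mult.assoc[symmetric] using CC by (simp add: mult.commute)
      finally show ?thesis .
    qed
    then have le: "(\<integral>\<^sup>+ x. ennreal (1 / C) * s x \<partial>M) \<le> (\<integral>\<^sup>+ x. F x \<partial>M)" by (intro nn_integral_mono)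
    have sm: "s \<in> borel_measurable M" using s(1) by (rule borel_measurable_simple_function)
    have "integral\<^sup>S M s = (\<integral>\<^sup>+ x. s x \<partial>M)" using s(1) by (rule nn_integral_eq_simple_integral[symmetric])
    also have "\<dots> = ennreal C * (ennreal (1 / C) * (\<integral>\<^sup>+ x. s x \<partial>M))"
      unfolding mult.assoc[symmetric] CC by simp
    also have "\<dots> = ennreal C * (\<integral>\<^sup>+ x. ennreal (1 / C) * s x \<partial>M)"
      using sm by (simp add: nn_integral_cmult)
    also have "\<dots> \<le> ennreal C * (\<integral>\<^sup>+ x. F x \<partial>M)" using le by (intro mult_left_mono) auto
    finally show "integral\<^sup>S M s \<le> ennreal C * (\<integral>\<^sup>+ x. F x \<partial>M)" .
  qed
  finally show ?thesis .
qed

lemma dyadic_norm_le_pointwise: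
  assumes "0 < p" "0 < q" "0 < c"
    and le: "\<And>x j. 0 \<le> x \<Longrightarrow> x < 1 \<Longrightarrow> G x j \<le> ennreal c * H x j"
  shows "dyadic_norm p q \<tau> G \<le> ennreal (c powr (1 / q)) * dyadic_norm p q \<tau> H"
  unfolding dyadic_norm_def
proof (intro SUP_least)
  fix j k assume "k \<in> {..<(2::nat) ^ j}"
  let ?I = "\<lambda>G. \<integral>\<^sup>+ x. epow (G x j) (p / q) * indicator (dyadic j k) x \<partial>lborel"
  have "?I G \<le> (\<integral>\<^sup>+ x. ennreal (c powr (p / q)) * (epow (H x j) (p / q) * indicator (dyadic j k) x) \<partial>lborel)"
  proof (rule nn_integral_mono)
    fix x
    show "epow (G x j) (p / q) * indicator (dyadic j k) x
        \<le> ennreal (c powr (p / q)) * (epow (H x j) (p / q) * indicator (dyadic j k) x)"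
    proof (cases "x \<in> dyadic j k")
      case True
      then have "0 \<le> x" "x < 1" using dyadic_nonneg dyadic_less_one \<open>k \<in> {..<2 ^ j}\<close> by auto
      then have "epow (G x j) (p / q) \<le> epow (ennreal c * H x j) (p / q)"
        using assms by (intro epow_mono le) auto
      then show ?thesis using True assms by (simp add: epow_cmult)
    qed simp
  qed
  also have "\<dots> \<le> ennreal (c powr (p / q)) * ?I H"
    using assms by (intro nn_integral_cmult_le) auto
  finally have "epow (?I G) (1 / p) \<le> epow (ennreal (c powr (p / q)) * ?I H) (1 / p)"
    using assms by (intro epow_mono) auto
  also have "\<dots> = ennreal (c powr (1 / q)) * epow (?I H) (1 / p)"
    using assms by (simp add: epow_cmult powr_powr)
  finally have "ennreal (2 powr (real j * \<tau>)) * epow (?I G) (1 / p)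
      \<le> ennreal (2 powr (real j * \<tau>)) * (ennreal (c powr (1 / q)) * epow (?I H) (1 / p))"
    by (rule mult_left_mono) simp
  also have "\<dots> = ennreal (c powr (1 / q)) * (ennreal (2 powr (real j * \<tau>)) * epow (?I H) (1 / p))"
    by (simp add: mult_ac)
  also have "\<dots> \<le> ennreal (c powr (1 / q)) * (SUP j. SUP k\<in>{..<2 ^ j}. ennreal (2 powr (real j * \<tau>)) *
      epow (\<integral>\<^sup>+ x. epow (H x j) (p / q) * indicator (dyadic j k) x \<partial>lborel) (1 / p))"
    by (intro mult_left_mono SUP_upper2[of j] SUP_upper2[of k]) (use \<open>k \<in> {..<2 ^ j}\<close> in auto)
  finally show "ennreal (2 powr (real j * \<tau>)) * epow (?I G) (1 / p)
      \<le> ennreal (c powr (1 / q)) * (SUP j. SUP k\<in>{..<2 ^ j}. ennreal (2 powr (real j * \<tau>)) *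
      epow (\<integral>\<^sup>+ x. epow (H x j) (p / q) * indicator (dyadic j k) x \<partial>lborel) (1 / p))" .
qed

text \<open>The factor \<open>2 powr (real j * \<tau>)\<close> depends on the rank alone, so an
  integral over one arc may be estimated by that over any other arc of the same rank, whatever
  \<open>\<tau>\<close> is.\<close>

lemma dyadic_norm_le_same_rank:
  assumes "0 < p" "0 < C"
    and le: "\<And>j k. k < 2 ^ j \<Longrightarrow> \<exists>\<kappa><2 ^ j. (\<integral>\<^sup>+ x. epow (G x j) (p / q) * indicator (dyadic j k) x \<partial>lborel)
       \<le> ennreal C * (\<integral>\<^sup>+ x. epow (H x j) (p / q) * indicator (dyadic j \<kappa>) x \<partial>lborel)"
  shows "dyadic_norm p q \<tau> G \<le> ennreal (C powr (1 / p)) * dyadic_norm p q \<tau> H"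
  unfolding dyadic_norm_def
proof (intro SUP_least)
  fix j k assume "k \<in> {..<(2::nat) ^ j}"
  let ?I = "\<lambda>G k. \<integral>\<^sup>+ x. epow (G x j) (p / q) * indicator (dyadic j k) x \<partial>lborel"
  obtain \<kappa> where \<kappa>: "\<kappa> < 2 ^ j" "?I G k \<le> ennreal C * ?I H \<kappa>" using le \<open>k \<in> {..<2 ^ j}\<close> by blast
  have "epow (?I G k) (1 / p) \<le> epow (ennreal C * ?I H \<kappa>) (1 / p)"
    using assms \<kappa> by (intro epow_mono) auto
  also have "\<dots> = ennreal (C powr (1 / p)) * epow (?I H \<kappa>) (1 / p)"
    using assms by (simp add: epow_cmult)
  finally have "ennreal (2 powr (real j * \<tau>)) * epow (?I G k) (1 / p)
      \<le> ennreal (2 powr (real j * \<tau>)) * (ennreal (C powr (1 / p)) * epow (?I H \<kappa>) (1 / p))"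
    by (rule mult_left_mono) simp
  also have "\<dots> = ennreal (C powr (1 / p)) * (ennreal (2 powr (real j * \<tau>)) * epow (?I H \<kappa>) (1 / p))"
    by (simp add: mult_ac)
  also have "\<dots> \<le> ennreal (C powr (1 / p)) * (SUP j. SUP k\<in>{..<2 ^ j}. ennreal (2 powr (real j * \<tau>)) *
      epow (\<integral>\<^sup>+ x. epow (H x j) (p / q) * indicator (dyadic j k) x \<partial>lborel) (1 / p))"
    by (intro mult_left_mono SUP_upper2[of j] SUP_upper2[of \<kappa>]) (use \<kappa> in auto)
  finally show "ennreal (2 powr (real j * \<tau>)) * epow (?I G k) (1 / p)
      \<le> ennreal (C powr (1 / p)) * (SUP j. SUP k\<in>{..<2 ^ j}. ennreal (2 powr (real j * \<tau>)) *
      epow (\<integral>\<^sup>+ x. epow (H x j) (p / q) * indicator (dyadic j k) x \<partial>lborel) (1 / p))" .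
qed

text \<open>The index \<open>K mod 2\<^sup>n\<close> runs through three periods around \<open>x\<close>, so that distances on the circle become
  distances between natural numbers.\<close>

definition periodic_op :: "real \<Rightarrow> (nat \<Rightarrow> nat \<Rightarrow> real) \<Rightarrow> nat \<Rightarrow> real \<Rightarrow> real" where
  "periodic_op b g n x = (\<Sum>K<3 * 2 ^ n. (1 + \<bar>real K - real (lev n x + 2 ^ n)\<bar>) powr (- b) * g n (K mod 2 ^ n))"

lemma periodic_op_nonneg: "(\<And>n k. 0 \<le> g n k) \<Longrightarrow> 0 \<le> periodic_op b g n x"
  unfolding periodic_op_def by (intro sum_nonneg mult_nonneg_nonneg) auto

lemma periodic_op_measurable [measurable]: "periodic_op b g n \<in> borel_measurable borel"
proof -
  have "periodic_op b g n = (\<lambda>m. \<Sum>K<3 * 2 ^ n. (1 + \<bar>real K - real (m + 2 ^ n)\<bar>) powr (- b) * g n (K mod 2 ^ n)) \<circ> lev n"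
    unfolding periodic_op_def by (simp add: fun_eq_iff)
  also have "\<dots> \<in> borel_measurable borel" by (rule measurable_comp[OF lev_measurable]) simp
  finally show ?thesis .
qed

text \<open>Truncated at level \<open>j + N\<close>, all functions of \<open>lev\<close> are step
  functions and the claim is \<open>local_tree_bound\<close> for leaf sums; the full series follows
  by monotone convergence. \<open>B\<close> enters only as an upper bound of the partial sums, so it
  can be any of the brackets.\<close>

lemma periodic_op_norm_bound:
  assumes p: "0 < p" and q: "0 < q" and b: "b > 1" "b * (p / q) > 1" and \<kappa>: "\<kappa> > 0"
  shows "\<exists>K>0. \<forall>(g :: nat \<Rightarrow> nat \<Rightarrow> nat \<Rightarrow> real) B. (\<forall>j n k. 0 \<le> g j n k) \<longrightarrow>
    (\<forall>x j N. 0 \<le> x \<longrightarrow> x < 1 \<longrightarrow> ennreal (\<kappa> * (\<Sum>L\<le>N. g j (j + L) (lev (j + L) x))) \<le> B x j) \<longrightarrow>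
    dyadic_norm p q \<tau> (\<lambda>x j. \<Sum>L. ennreal (periodic_op b (g j) (j + L) x)) \<le> ennreal K * dyadic_norm p q \<tau> B"
proof -
  define \<theta> where "\<theta> = p / q"
  have \<theta>: "\<theta> > 0" using p q by (simp add: \<theta>_def)
  obtain C where C: "C > 0" and bound: "\<And>(g :: nat \<Rightarrow> nat \<Rightarrow> real) j k0 N X. (\<forall>n k. 0 \<le> g n k) \<Longrightarrow> k0 < 2 ^ j \<Longrightarrow>
    (\<forall>\<kappa><2 ^ j. (\<Sum>i<2 ^ N. (\<Sum>L\<le>N. g (j + L) (\<kappa> * 2 ^ L + i div 2 ^ (N - L))) powr \<theta>) \<le> X) \<Longrightarrow>
    (\<Sum>i<2 ^ N. (\<Sum>L\<le>N. \<Sum>K<3 * 2 ^ (j + L).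
        (1 + \<bar>real K - real (k0 * 2 ^ L + i div 2 ^ (N - L) + 2 ^ (j + L))\<bar>) powr (- b) * g (j + L) (K mod 2 ^ (j + L))) powr \<theta>)
      \<le> C * X"
    using local_tree_bound[OF \<theta> b(1) b(2)[folded \<theta>_def]] by blast
  define C' where "C' = C * \<kappa> powr (- \<theta>)"
  have C': "C' > 0" using C \<kappa> by (simp add: C'_def)
  show ?thesis
  proof (intro exI[of _ "C' powr (1 / p)"] conjI allI impI)
    show "0 < C' powr (1 / p)" using C' by simp
    fix g :: "nat \<Rightarrow> nat \<Rightarrow> nat \<Rightarrow> real" and B :: "real \<Rightarrow> nat \<Rightarrow> ennreal"
    assume g: "\<forall>j n k. 0 \<le> g j n k"
      and B: "\<forall>x j N. 0 \<le> x \<longrightarrow> x < 1 \<longrightarrow> ennreal (\<kappa> * (\<Sum>L\<le>N. g j (j + L) (lev (j + L) x))) \<le> B x j"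
    show "dyadic_norm p q \<tau> (\<lambda>x j. \<Sum>L. ennreal (periodic_op b (g j) (j + L) x)) \<le> ennreal (C' powr (1 / p)) * dyadic_norm p q \<tau> B"
    proof (rule dyadic_norm_le_same_rank[OF p C'])
      fix j k :: nat assume k: "k < 2 ^ j"
      define IB where "IB = (\<lambda>\<kappa>. \<integral>\<^sup>+ x. epow (B x j) (p / q) * indicator (dyadic j \<kappa>) x \<partial>lborel)"
      \<comment> \<open>The largest of the finitely many integrals over arcs of rank
        \<open>j\<close> bounds every sum in the hypothesis of the tree bound, and an arc attaining
        it serves as comparison arc for all \<open>N\<close> at once.\<close>
      define M where "M = Max (IB ` {..<2 ^ j})"
      have ne: "IB ` {..<2 ^ j} \<noteq> {}" "finite (IB ` {..<2 ^ j})" by (auto simp: lessThan_empty_iff)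
      obtain \<kappa>' where \<kappa>': "\<kappa>' < 2 ^ j" "IB \<kappa>' = M" using Max_in[OF ne(2,1)] unfolding M_def by auto
      have IBM: "IB \<kappa> \<le> M" if "\<kappa> < 2 ^ j" for \<kappa> unfolding M_def using that by (intro Max_ge) auto
      define G where "G = (\<lambda>N x. \<Sum>L\<le>N. periodic_op b (g j) (j + L) x)"
      have G0: "0 \<le> G N x" for N x unfolding G_def using g by (intro sum_nonneg periodic_op_nonneg) auto
      have finite_level: "(\<integral>\<^sup>+ x. ennreal (G N x powr \<theta>) * indicator (dyadic j k) x \<partial>lborel) \<le> ennreal C' * M" for N
      proof (cases "M = \<infinity>")
        case True
        then show ?thesis using C' by (simp add: ennreal_mult_top)
      next
        case False
        define S where "S = (\<lambda>\<kappa> i. (\<Sum>L\<le>N. g j (j + L) (\<kappa> * 2 ^ L + i div 2 ^ (N - L))) powr \<theta>)"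
        define \<delta> where "\<delta> = 1 / (2 ^ (j + N) :: real)"
        have \<delta>: "\<delta> > 0" by (simp add: \<delta>_def)
        define X where "X = enn2real M * \<kappa> powr (- \<theta>) / \<delta>"
        have "(\<Sum>i<2 ^ N. S \<kappa>0 i) \<le> X" if \<kappa>0: "\<kappa>0 < 2 ^ j" for \<kappa>0
        proof -
          have "ennreal (\<kappa> powr \<theta> * (\<Sum>i<2 ^ N. S \<kappa>0 i) * \<delta>) = (\<Sum>i<2 ^ N. ennreal (\<kappa> powr \<theta> * S \<kappa>0 i)) * ennreal \<delta>"
          proof -
            have "ennreal (\<kappa> powr \<theta> * (\<Sum>i<2 ^ N. S \<kappa>0 i) * \<delta>) = ennreal (\<Sum>i<2 ^ N. \<kappa> powr \<theta> * S \<kappa>0 i) * ennreal \<delta>"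
              unfolding sum_distrib_left[symmetric] by (intro ennreal_mult mult_nonneg_nonneg sum_nonneg) (use \<delta> in \<open>auto simp: S_def\<close>)
            also have "ennreal (\<Sum>i<2 ^ N. \<kappa> powr \<theta> * S \<kappa>0 i) = (\<Sum>i<2 ^ N. ennreal (\<kappa> powr \<theta> * S \<kappa>0 i))"
              by (rule sum_ennreal[symmetric]) (auto simp: S_def)
            finally show ?thesis .
          qed
          also have "\<dots> = (\<integral>\<^sup>+ x. ennreal (\<kappa> powr \<theta> * S \<kappa>0 (lev (j + N) x mod 2 ^ N)) * indicator (dyadic j \<kappa>0) x \<partial>lborel)"
            unfolding \<delta>_def by (rule nn_integral_dyadic_step[symmetric])
          also have "\<dots> \<le> IB \<kappa>0"
            unfolding IB_def
          proof (rule nn_integral_mono)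
            fix x
            show "ennreal (\<kappa> powr \<theta> * S \<kappa>0 (lev (j + N) x mod 2 ^ N)) * indicator (dyadic j \<kappa>0) x
               \<le> epow (B x j) (p / q) * indicator (dyadic j \<kappa>0) x"
            proof (cases "x \<in> dyadic j \<kappa>0")
              case True
              then have x: "0 \<le> x" "x < 1" using dyadic_nonneg dyadic_less_one \<kappa>0 by auto
              have "S \<kappa>0 (lev (j + N) x mod 2 ^ N) = (\<Sum>L\<le>N. g j (j + L) (lev (j + L) x)) powr \<theta>"
                unfolding S_def using lev_dyadic(2)[OF True] by simp
              then have "ennreal (\<kappa> powr \<theta> * S \<kappa>0 (lev (j + N) x mod 2 ^ N)) = epow (ennreal (\<kappa> * (\<Sum>L\<le>N. g j (j + L) (lev (j + L) x)))) \<theta>"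
                using \<kappa> g by (subst epow_ennreal) (auto simp: powr_mult sum_nonneg)
              also have "\<dots> \<le> epow (B x j) (p / q)"
                unfolding \<theta>_def[symmetric] using B x \<theta> by (intro epow_mono) auto
              finally show ?thesis using True by simp
            qed simp
          qed
          also have "\<dots> \<le> M" by (rule IBM[OF \<kappa>0])
          finally have "\<kappa> powr \<theta> * (\<Sum>i<2 ^ N. S \<kappa>0 i) * \<delta> \<le> enn2real M"
            using False by (subst (asm) ennreal_enn2real[symmetric]) (auto simp: less_top)
          then show ?thesis unfolding X_def using \<kappa> \<delta> by (simp add: powr_minus field_simps)
        qed
        then have "(\<Sum>i<2 ^ N. (\<Sum>L\<le>N. \<Sum>K<3 * 2 ^ (j + L).
          (1 + \<bar>real K - real (k * 2 ^ L + i div 2 ^ (N - L) + 2 ^ (j + L))\<bar>) powr (- b) * g j (j + L) (K mod 2 ^ (j + L))) powr \<theta>) \<le> C * X"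
          (is "(\<Sum>i<2 ^ N. ?R i) \<le> _")
          unfolding S_def by (intro bound[OF _ k]) (use g in auto)
        then have "(\<Sum>i<2 ^ N. ?R i) * \<delta> \<le> C * X * \<delta>" using \<delta> by (intro mult_right_mono) auto
        also have "C * X * \<delta> = C' * enn2real M" using \<delta> by (simp add: X_def C'_def)
        finally have R: "(\<Sum>i<2 ^ N. ?R i) * \<delta> \<le> C' * enn2real M" .
        have "(\<integral>\<^sup>+ x. ennreal (G N x powr \<theta>) * indicator (dyadic j k) x \<partial>lborel)
           = (\<integral>\<^sup>+ x. ennreal (?R (lev (j + N) x mod 2 ^ N)) * indicator (dyadic j k) x \<partial>lborel)"
        proof (rule nn_integral_cong)
          fix x
          show "ennreal (G N x powr \<theta>) * indicator (dyadic j k) x = ennreal (?R (lev (j + N) x mod 2 ^ N)) * indicator (dyadic j k) x"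
          proof (cases "x \<in> dyadic j k")
            case True
            then show ?thesis unfolding G_def periodic_op_def using lev_dyadic(2)[OF True] by simp
          qed simp
        qed
        also have "\<dots> = (\<Sum>i<2 ^ N. ennreal (?R i)) * ennreal \<delta>"
          unfolding \<delta>_def by (rule nn_integral_dyadic_step)
        also have "\<dots> = ennreal ((\<Sum>i<2 ^ N. ?R i) * \<delta>)"
          using \<delta> by (simp add: ennreal_mult sum_nonneg)
        also have "\<dots> \<le> ennreal (C' * enn2real M)" using R by (rule ennreal_leI)
        also have "\<dots> = ennreal C' * M" using C' False by (simp add: ennreal_mult less_top)
        finally show ?thesis .
      qed
      have "(\<integral>\<^sup>+ x. epow (\<Sum>L. ennreal (periodic_op b (g j) (j + L) x)) (p / q) * indicator (dyadic j k) x \<partial>lborel)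
        = (\<integral>\<^sup>+ x. (SUP N. ennreal (G N x powr \<theta>) * indicator (dyadic j k) x) \<partial>lborel)"
      proof (rule nn_integral_cong)
        fix x
        have "(\<Sum>L. ennreal (periodic_op b (g j) (j + L) x)) = (SUP N. \<Sum>L<N. ennreal (periodic_op b (g j) (j + L) x))"
          by (rule suminf_eq_SUP)
        also have "\<dots> = (SUP N. ennreal (G N x))"
        proof (rule antisym)
          have e: "ennreal (G N x) = (\<Sum>L<Suc N. ennreal (periodic_op b (g j) (j + L) x))" for N
            unfolding G_def lessThan_Suc_atMost using g by (intro sum_ennreal[symmetric] periodic_op_nonneg) auto
          show "(SUP N. ennreal (G N x)) \<le> (SUP N. \<Sum>L<N. ennreal (periodic_op b (g j) (j + L) x))"
            unfolding e by (rule SUP_least, rule SUP_upper) simp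
          show "(SUP N. \<Sum>L<N. ennreal (periodic_op b (g j) (j + L) x)) \<le> (SUP N. ennreal (G N x))"
          proof (rule SUP_least)
            fix N
            have "(\<Sum>L<N. ennreal (periodic_op b (g j) (j + L) x)) \<le> ennreal (G N x)"
              unfolding e by (rule sum_mono2) auto
            also have "\<dots> \<le> (SUP N. ennreal (G N x))" by (rule SUP_upper) simp
            finally show "(\<Sum>L<N. ennreal (periodic_op b (g j) (j + L) x)) \<le> (SUP N. ennreal (G N x))" .
          qed
        qed
        finally have "epow (\<Sum>L. ennreal (periodic_op b (g j) (j + L) x)) (p / q) = (SUP N. ennreal (G N x powr \<theta>))"
          using epow_SUP[OF \<theta>, of "\<lambda>N. ennreal (G N x)" UNIV] G0 by (simp add: epow_ennreal \<theta>_def[symmetric])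
        then show "epow (\<Sum>L. ennreal (periodic_op b (g j) (j + L) x)) (p / q) * indicator (dyadic j k) x
            = (SUP N. ennreal (G N x powr \<theta>) * indicator (dyadic j k) x)"
          by (simp add: indicator_def)
      qed
      also have "\<dots> = (SUP N. \<integral>\<^sup>+ x. ennreal (G N x powr \<theta>) * indicator (dyadic j k) x \<partial>lborel)"
      proof (rule nn_integral_monotone_convergence_SUP)
        show "incseq (\<lambda>N x. ennreal (G N x powr \<theta>) * indicator (dyadic j k) x)"
        proof (intro incseq_SucI le_funI mult_right_mono ennreal_leI)
          fix N x
          have "G N x \<le> G (Suc N) x" unfolding G_def using g periodic_op_nonneg[of "g j" b] by simp
          then show "G N x powr \<theta> \<le> G (Suc N) x powr \<theta>" using \<theta> G0 by (intro powr_mono2) auto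
        qed simp
        show "(\<lambda>x. ennreal (G N x powr \<theta>) * indicator (dyadic j k) x) \<in> borel_measurable lborel" for N
          unfolding G_def by measurable
      qed
      also have "\<dots> \<le> ennreal C' * M" by (rule SUP_least) (rule finite_level)
      finally show "\<exists>\<kappa><2 ^ j. (\<integral>\<^sup>+ x. epow (\<Sum>L. ennreal (periodic_op b (g j) (j + L) x)) (p / q) * indicator (dyadic j k) x \<partial>lborel)
         \<le> ennreal C' * (\<integral>\<^sup>+ x. epow (B x j) (p / q) * indicator (dyadic j \<kappa>) x \<partial>lborel)"
        using \<kappa>' unfolding IB_def by blast
    qed
  qed
qed

section \<open>Peetre weighted suprema over circles\<close>

lemma sin_ge_half:
  fixes x :: real
  assumes "0 \<le> x" "x \<le> pi / 2"
  shows "x / 2 \<le> sin x"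
proof (cases "x \<le> pi / 3")
  case True
  show ?thesis
  proof (cases "x = 0")
    case False
    then have "\<exists>z>0. z < x \<and> sin x - sin 0 = (x - 0) * cos z"
      using assms by (intro MVT2) (auto intro!: derivative_eq_intros)
    then obtain z where z: "0 < z" "z < x" "sin x = x * cos z" by auto
    have "cos (pi / 3) \<le> cos z" using z True by (intro cos_monotone_0_pi_le) auto
    then have "x * (1 / 2) \<le> x * cos z" using assms by (intro mult_left_mono) (auto simp: cos_60)
    then show ?thesis using z by simp
  qed simp
next
  case False
  have "sin (pi / 3) \<le> sin x" using assms False by (intro sin_monotone_2pi_le) auto
  moreover have "pi / 4 \<le> sqrt 3 / 2"
  proof -
    have "pi < 3.2" using pi_approx by simp
    moreover have "sqrt (1.6 ^ 2) \<le> sqrt 3" by (intro real_sqrt_le_mono) (simp add: power2_eq_square)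
    ultimately show ?thesis by simp
  qed
  ultimately show ?thesis using assms by (simp add: sin_60)
qed

lemma norm_zeta_diff: "cmod (zeta x - zeta y) = 2 * \<bar>sin (pi * (x - y))\<bar>"
proof -
  have "zeta x - zeta y = zeta y * (cis (2 * (pi * (x - y))) - 1)"
    by (simp add: zeta_def cis_mult[symmetric] algebra_simps cis_mult)
  then have "cmod (zeta x - zeta y) = cmod (cis (2 * (pi * (x - y))) - 1)" by (simp add: norm_mult)
  also have "(cmod (cis (2 * (pi * (x - y))) - 1))\<^sup>2 = (2 * \<bar>sin (pi * (x - y))\<bar>)\<^sup>2"
  proof -
    have "(cmod (cis (2 * t) - 1))\<^sup>2 = (2 * \<bar>sin t\<bar>)\<^sup>2" for t :: real
    proof -
      have "(cmod (cis (2 * t) - 1))\<^sup>2 = (cos (2 * t) - 1)\<^sup>2 + (sin (2 * t))\<^sup>2" by (simp add: cmod_power2)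
      also have "\<dots> = 2 - 2 * cos (2 * t)" using sin_cos_squared_add[of "2 * t"] by (simp add: power2_eq_square algebra_simps)
      also have "\<dots> = (2 * \<bar>sin t\<bar>)\<^sup>2" by (simp add: cos_double_sin power_mult_distrib)
      finally show ?thesis .
    qed
    then show ?thesis .
  qed
  then have "cmod (cis (2 * (pi * (x - y))) - 1) = 2 * \<bar>sin (pi * (x - y))\<bar>" by (rule power2_eq_imp_eq) auto
  finally show ?thesis .
qed

lemma norm_zeta_diff_le: "cmod (zeta x - zeta y) \<le> 2 * pi * \<bar>x - y\<bar>"
  unfolding norm_zeta_diff using abs_sin_x_le_abs_x[of "pi * (x - y)"] by (simp add: abs_mult)

text \<open>The shift by \<open>m - 1\<close> selects the representative of \<open>y\<close> modulo
  1 nearest to \<open>x\<close>. A natural number below 3 fits the three periods over which the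
  index \<open>K\<close> of \<open>periodic_op\<close> runs.\<close>

lemma norm_zeta_diff_ge:
  assumes "0 \<le> x" "x < 1" "0 \<le> y" "y < 1"
  obtains m :: nat where "m < 3" "2 * \<bar>y + real m - 1 - x\<bar> \<le> cmod (zeta x - zeta y)"
proof -
  have *: "t \<le> \<bar>sin (pi * t)\<bar>" if "0 \<le> t" "t \<le> 1 / 2" for t
  proof -
    have "t \<le> pi * t / 2" using that pi_gt3 mult_right_mono[of 2 pi t] by simp
    also have "\<dots> \<le> sin (pi * t)" using that by (intro sin_ge_half) auto
    finally show ?thesis by simp
  qed
  consider "\<bar>x - y\<bar> \<le> 1 / 2" | "x - y > 1 / 2" | "x - y < - 1 / 2" by linarith
  then show ?thesis
  proof cases
    case 1
    have "\<bar>sin (pi * \<bar>x - y\<bar>)\<bar> = \<bar>sin (pi * (x - y))\<bar>"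
    proof (cases "x - y \<ge> 0")
      case False
      have "sin (pi * (y - x)) = - sin (pi * (x - y))" by (metis minus_diff_eq mult_minus_right sin_minus)
      then show ?thesis using False by simp
    qed simp
    then show ?thesis using *[of "\<bar>x - y\<bar>"] 1 by (intro that[of 1]) (auto simp: norm_zeta_diff)
  next
    case 2
    have "sin (pi * (1 - (x - y))) = sin (pi * (x - y))" by (simp add: right_diff_distrib sin_diff)
    then show ?thesis using *[of "1 - (x - y)"] 2 assms by (intro that[of 2]) (auto simp: norm_zeta_diff)
  next
    case 3
    have "sin (pi * (1 + (x - y))) = - sin (pi * (x - y))" by (simp add: distrib_left sin_add)
    then show ?thesis using *[of "1 + (x - y)"] 3 assms by (intro that[of 0]) (auto simp: norm_zeta_diff)
  qed
qed

lemma polar_zeta: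
  obtains y where "0 \<le> y" "y < 1" "v = complex_of_real (cmod v) * zeta y"
proof -
  define y where "y = Arg2pi v / (2 * pi)"
  have "v = complex_of_real (cmod v) * zeta y"
    using Arg2pi[of v] by (simp add: y_def zeta_def cis_conv_exp is_Arg_def)
  moreover have "0 \<le> y" "y < 1" using Arg2pi[of v] by (auto simp: y_def)
  ultimately show ?thesis using that by blast
qed

lemma one_plus_mult_le:
  fixes u v :: real
  assumes "0 \<le> u" "0 \<le> v"
  shows "1 + (u + v) \<le> (1 + u) * (1 + v)"
  using assms by (simp add: algebra_simps)

text \<open>Distance is taken in the plane, from points of the inner circle to the boundary point,
  and scaled by \<open>2 ^ l\<close> in place of \<open>1 / (1 - R l)\<close>. The triangle
  inequality can then pass through arbitrary points of the disc.\<close>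

definition peak :: "(complex \<Rightarrow> 'a::complex_banach) \<Rightarrow> real \<Rightarrow> (nat \<Rightarrow> real) \<Rightarrow> nat \<Rightarrow> real \<Rightarrow> real" where
  "peak f a R l x = (SUP v\<in>sphere 0 (R l). norm (f v) * (1 + 2 ^ l * cmod (v - zeta x)) powr (- a))"

text \<open>The box contains an arc of the circle of radius \<open>R l\<close> itself, as the sums
  over circles need, and extends outwards by a multiple of \<open>1 / 2 ^ l\<close>, as the radial
  integrals need.\<close>

definition box_inf :: "(complex \<Rightarrow> 'a::complex_banach) \<Rightarrow> (nat \<Rightarrow> real) \<Rightarrow> real \<Rightarrow> nat \<Rightarrow> nat \<Rightarrow> nat \<Rightarrow> real" where
  "box_inf f R \<delta> l n k = (INF z\<in>{R l..R l + \<delta> / 2 ^ l} \<times> dyadic n k. norm (f (complex_of_real (fst z) * zeta (snd z))))"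

text \<open>The factor \<open>A\<close> may depend on \<open>f\<close>; only the rate
  \<open>\<beta>\<close> is fixed in advance and enters the choice of constants.\<close>

definition poly_growth :: "(complex \<Rightarrow> 'a::complex_banach) \<Rightarrow> (nat \<Rightarrow> real) \<Rightarrow> real \<Rightarrow> bool" where
  "poly_growth f R \<beta> \<longleftrightarrow> (\<exists>A\<ge>0. \<forall>l v. cmod v \<le> R l \<longrightarrow> norm (f v) \<le> A * 2 powr (\<beta> * real l))"

lemma dyadic_nonempty: "dyadic n k \<noteq> {}"
  by (auto simp: dyadic_def divide_strict_right_mono intro!: exI[of _ "real k / 2 ^ n"])

lemma box_inf_nonneg: "0 \<le> \<delta> \<Longrightarrow> 0 \<le> box_inf f R \<delta> l n k"
  unfolding box_inf_def using dyadic_nonempty[of n k] by (intro cINF_greatest) auto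

lemma box_inf_le:
  assumes "r \<in> {R l..R l + \<delta> / 2 ^ l}" "y \<in> dyadic n k"
  shows "box_inf f R \<delta> l n k \<le> norm (f (complex_of_real r * zeta y))"
  unfolding box_inf_def
  by (rule cINF_lower2[where x="(r, y)"]) (use assms in \<open>auto intro!: bdd_belowI2[where m=0]\<close>)

lemma le_box_inf:
  assumes "0 \<le> \<delta>" "\<And>r y. r \<in> {R l..R l + \<delta> / 2 ^ l} \<Longrightarrow> y \<in> dyadic n k \<Longrightarrow> c \<le> norm (f (complex_of_real r * zeta y))"
  shows "c \<le> box_inf f R \<delta> l n k"
  unfolding box_inf_def using assms dyadic_nonempty[of n k] by (intro cINF_greatest) auto

text \<open>One set of estimates serves both the given radii and a fixed auxiliary sequence.\<close>

locale radii =
  fixes R :: "nat \<Rightarrow> real" and c0 C0 :: real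
  assumes R: "\<And>l. 0 \<le> R l" "\<And>l. R l < 1"
    and c0: "0 < c0" and c0C0: "c0 \<le> C0"
    and R_lower: "\<And>l. c0 / 2 ^ l \<le> 1 - R l" and R_upper: "\<And>l. 1 - R l \<le> C0 / 2 ^ l"
begin

lemma peak_bdd:
  assumes "analytic_disc f"
  shows "bdd_above ((\<lambda>v. norm (f v) * (1 + 2 ^ l * cmod (v - zeta x)) powr (- a)) ` sphere 0 (R l))"
proof -
  have "sphere 0 (R l) \<subseteq> ball 0 1" using R by auto
  then have "continuous_on (sphere 0 (R l)) (\<lambda>v. norm (f v) * (1 + 2 ^ l * cmod (v - zeta x)) powr (- a))"
    by (intro continuous_intros analytic_disc_continuous[OF assms])
      (auto simp: add_nonneg_eq_0_iff)
  then show ?thesis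
    by (intro bounded_imp_bdd_above compact_imp_bounded compact_continuous_image) auto
qed

lemma le_peak:
  assumes "analytic_disc f" "cmod v = R l"
  shows "norm (f v) \<le> peak f a R l x * (1 + 2 ^ l * cmod (v - zeta x)) powr a"
proof -
  have "norm (f v) * (1 + 2 ^ l * cmod (v - zeta x)) powr (- a) \<le> peak f a R l x"
    unfolding peak_def by (rule cSUP_upper[OF _ peak_bdd]) (use assms in auto)
  moreover have "0 < (1 + 2 ^ l * cmod (v - zeta x)) powr a"
    by (subst powr_gt_zero) (simp add: add_nonneg_eq_0_iff)
  ultimately show ?thesis by (simp add: powr_minus_divide pos_divide_le_eq)
qed

lemma sphere_R_nonempty: "sphere (0::complex) (R l) \<noteq> {}"
proof -
  have "complex_of_real (R l) \<in> sphere 0 (R l)" using R by simp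
  then show ?thesis by blast
qed

lemma peak_le:
  assumes "\<And>v. cmod v = R l \<Longrightarrow> norm (f v) * (1 + 2 ^ l * cmod (v - zeta x)) powr (- a) \<le> c"
  shows "peak f a R l x \<le> c"
  unfolding peak_def using assms sphere_R_nonempty by (intro cSUP_least) auto

lemma peak_nonneg:
  assumes "analytic_disc f"
  shows "0 \<le> peak f a R l x"
proof -
  have "cmod (complex_of_real (R l)) = R l" using R by simp
  from order_trans[OF norm_ge_zero le_peak[OF assms this, of a x]]
  have "0 \<le> peak f a R l x * (1 + 2 ^ l * cmod (complex_of_real (R l) - zeta x)) powr a" .
  moreover have "0 < (1 + 2 ^ l * cmod (complex_of_real (R l) - zeta x)) powr a"
    by (subst powr_gt_zero) (simp add: add_nonneg_eq_0_iff)
  ultimately show ?thesis by (simp only: zero_le_mult_iff) linarith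
qed

text \<open>The exponent \<open>N\<close> of the divisor is an integer at least \<open>a\<close>, so
  that the quotient is holomorphic and the weight is still dominated. The powers of
  \<open>2 ^ l\<close> from the weight cancel against \<open>1 - (cmod w)\<^sup>2\<close>, which is
  of order \<open>1 / 2 ^ l\<close>; hence \<open>K\<close> is independent of
  \<open>l\<close>.\<close>

lemma norm_le_peak_deeper:
  assumes a: "a > 0" and A: "A > 0" and B: "B > 0"
  shows "\<exists>M. \<exists>K>0. \<forall>(f :: complex \<Rightarrow> 'a::complex_banach) l x w. analytic_disc f \<longrightarrow> A / 2 ^ l \<le> 1 - cmod w \<longrightarrow> 1 - cmod w \<le> B / 2 ^ l \<longrightarrow>
    norm (f w) \<le> K * (1 + 2 ^ l * cmod (w - zeta x)) powr a * peak f a R (l + M) x"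
proof -
  \<comment> \<open>This \<open>M\<close> makes \<open>1 - R (l + M)\<close> smaller than
    \<open>A / 2 ^ l\<close>, so that \<open>w\<close> lies strictly inside the deeper
    circle.\<close>
  obtain M where M: "C0 / A < 2 ^ M" using real_arch_pow[of 2 "C0 / A"] by auto
  obtain N :: nat where N: "a \<le> real N" using real_arch_simple by blast
  define K where "K = (2 ^ M) powr a * ((1 / A + 1) * (2 * B)) ^ N"
  show ?thesis
  proof (intro exI[of _ M] exI[of _ K] conjI allI impI)
    show "K > 0" unfolding K_def using A B by (intro mult_pos_pos zero_less_power add_pos_pos) auto
    fix f :: "complex \<Rightarrow> 'a" and l x w
    assume f: "analytic_disc f" and w: "A / 2 ^ l \<le> 1 - cmod w" "1 - cmod w \<le> B / 2 ^ l"
    let ?Q = "peak f a R (l + M) x"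
    have Q0: "0 \<le> ?Q" by (rule peak_nonneg[OF f])
    have "1 - R (l + M) \<le> C0 / 2 ^ (l + M)" by (rule R_upper)
    also have "\<dots> < A / 2 ^ l" using M A by (simp add: power_add field_simps)
    finally have wR: "cmod w < R (l + M)" using w by linarith
    let ?s = "1 + 2 ^ l * cmod (w - zeta x)"
    have s: "?s > 0" by (simp add: add_pos_nonneg)
    define B' where "B' = ?Q * ((2 ^ M) powr a * ?s powr a * ((1 / A + 1) * 2 ^ l) ^ N)"
    have "norm (f w) \<le> B' * (1 - (cmod w)\<^sup>2) ^ N"
    proof (rule weighted_max_principle[OF f R(2) wR])
      fix v assume v: "cmod v = R (l + M)"
      have vw: "cmod v \<le> 1" "cmod w \<le> 1" using v R(2)[of "l + M"] wR by auto
      let ?h = "cmod (1 - cnj w * v)"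
      have h: "cmod (v - w) \<le> ?h" "A / 2 ^ l \<le> ?h"
        using cmod_one_minus_cnj_mult[OF vw] w by auto
      have "1 + 2 ^ l * cmod (v - w) \<le> (1 / A + 1) * 2 ^ l * ?h"
      proof -
        have "1 \<le> (1 / A) * 2 ^ l * ?h" using h(2) A by (simp add: field_simps)
        moreover have "2 ^ l * cmod (v - w) \<le> 2 ^ l * ?h" using h(1) by (intro mult_left_mono) auto
        moreover have "(1 / A + 1) * 2 ^ l * ?h = (1 / A) * 2 ^ l * ?h + 2 ^ l * ?h" by (simp add: algebra_simps)
        ultimately show ?thesis by linarith
      qed
      then have 1: "(1 + 2 ^ l * cmod (v - w)) ^ N \<le> ((1 / A + 1) * 2 ^ l * ?h) ^ N"
        by (intro power_mono) auto
      \<comment> \<open>The weight centred at \<open>zeta x\<close> is split at \<open>w\<close>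
        into one centred at \<open>w\<close>, which the divisor removes, and one depending on
        \<open>w\<close> alone, which remains in the claim; the change of scale costs
        \<open>2 ^ M\<close>.\<close>
      have "1 + 2 ^ (l + M) * cmod (v - zeta x) \<le> 2 ^ M * (1 + 2 ^ l * (cmod (v - w) + cmod (w - zeta x)))"
      proof -
        have "cmod (v - zeta x) \<le> cmod (v - w) + cmod (w - zeta x)" using norm_triangle_ineq[of "v - w" "w - zeta x"] by simp
        then have "2 ^ (l + M) * cmod (v - zeta x) \<le> 2 ^ (l + M) * (cmod (v - w) + cmod (w - zeta x))" by (intro mult_left_mono) auto
        moreover have "(1::real) \<le> 2 ^ M" by simp
        moreover have "2 ^ M * (1 + 2 ^ l * (cmod (v - w) + cmod (w - zeta x))) = 2 ^ M + 2 ^ (l + M) * (cmod (v - w) + cmod (w - zeta x))"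
          by (simp add: power_add algebra_simps)
        ultimately show ?thesis by linarith
      qed
      also have "\<dots> \<le> 2 ^ M * ((1 + 2 ^ l * cmod (v - w)) * ?s)"
        using one_plus_mult_le[of "2 ^ l * cmod (v - w)" "2 ^ l * cmod (w - zeta x)"]
        by (intro mult_left_mono) (auto simp: distrib_left)
      finally have "(1 + 2 ^ (l + M) * cmod (v - zeta x)) powr a \<le> (2 ^ M * ((1 + 2 ^ l * cmod (v - w)) * ?s)) powr a"
        using a by (intro powr_mono2) auto
      also have "\<dots> = (2 ^ M) powr a * ?s powr a * (1 + 2 ^ l * cmod (v - w)) powr a"
        by (simp add: powr_mult mult_ac)
      also have "(1 + 2 ^ l * cmod (v - w)) powr a \<le> (1 + 2 ^ l * cmod (v - w)) powr real N"
        using N by (intro powr_mono) auto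
      also have "(1 + 2 ^ l * cmod (v - w)) powr real N = (1 + 2 ^ l * cmod (v - w)) ^ N"
        by (rule powr_realpow) (simp add: add_pos_nonneg)
      also note 1
      finally have 2: "(1 + 2 ^ (l + M) * cmod (v - zeta x)) powr a
          \<le> (2 ^ M) powr a * ?s powr a * ((1 / A + 1) * 2 ^ l * ?h) ^ N" by (simp add: mult_left_mono)
      have "norm (f v) \<le> ?Q * (1 + 2 ^ (l + M) * cmod (v - zeta x)) powr a" by (rule le_peak[OF f v])
      also have "\<dots> \<le> ?Q * ((2 ^ M) powr a * ?s powr a * ((1 / A + 1) * 2 ^ l * ?h) ^ N)"
        using 2 Q0 by (rule mult_left_mono)
      also have "\<dots> = B' * ?h ^ N" unfolding B'_def by (simp add: power_mult_distrib mult_ac)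
      finally show "norm (f v) \<le> B' * ?h ^ N" .
    qed
    also have "(1 - (cmod w)\<^sup>2) ^ N \<le> (2 * B / 2 ^ l) ^ N"
    proof (rule power_mono)
      have w1: "cmod w \<le> 1" using wR R(2)[of "l + M"] by linarith
      have "1 - (cmod w)\<^sup>2 = (1 + cmod w) * (1 - cmod w)" by (simp add: power2_eq_square algebra_simps)
      also have "\<dots> \<le> 2 * (B / 2 ^ l)" using w w1 by (intro mult_mono) auto
      finally show "1 - (cmod w)\<^sup>2 \<le> 2 * B / 2 ^ l" by simp
      show "0 \<le> 1 - (cmod w)\<^sup>2" using w1 by (simp add: abs_square_le_1)
    qed
    also have "B' * (2 * B / 2 ^ l) ^ N = K * ?s powr a * ?Q"
    proof -
      have "((1 / A + 1) * 2 ^ l) ^ N * (2 * B / 2 ^ l) ^ N = ((1 / A + 1) * (2 * B)) ^ N"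
        by (simp add: power_mult_distrib[symmetric])
      then show ?thesis unfolding B'_def K_def by (simp add: mult_ac)
    qed
    finally show "norm (f w) \<le> K * ?s powr a * ?Q"
      using Q0 A by (simp add: B'_def mult_left_mono)
  qed
qed

text \<open>The ball of radius \<open>c0 / 2 / 2 ^ l\<close> around \<open>v\<close> keeps a
  distance comparable to \<open>1 / 2 ^ l\<close> from the unit circle, so the preceding bound
  applies on it uniformly and Cauchy's estimate follows. The gain is the factor
  \<open>2 ^ l * cmod (v' - v)\<close>, small for nearby points.\<close>

lemma oscillation_le_peak_deeper:
  assumes a: "a > 0"
  shows "\<exists>M. \<exists>K>0. \<forall>(f :: complex \<Rightarrow> 'a::complex_banach) l x v v'. analytic_disc f \<longrightarrow> cmod v = R l \<longrightarrow> cmod (v' - v) \<le> c0 / 4 / 2 ^ l \<longrightarrow>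
    norm (f v' - f v) \<le> K * (2 ^ l * cmod (v' - v)) * (1 + 2 ^ l * cmod (v - zeta x)) powr a * peak f a R (l + M) x"
proof -
  have "c0 / 2 > 0" "C0 + c0 > 0" using c0 c0C0 by auto
  from norm_le_peak_deeper[OF a this] obtain M K where K: "K > 0" and
    le: "\<And>(f :: complex \<Rightarrow> 'a) l x w. analytic_disc f \<Longrightarrow> c0 / 2 / 2 ^ l \<le> 1 - cmod w \<Longrightarrow> 1 - cmod w \<le> (C0 + c0) / 2 ^ l \<Longrightarrow>
    norm (f w) \<le> K * (1 + 2 ^ l * cmod (w - zeta x)) powr a * peak f a R (l + M) x"
    by blast
  define K' where "K' = 4 / c0 * (K * (1 + c0) powr a)"
  show ?thesis
  proof (intro exI[of _ M] exI[of _ K'] conjI allI impI)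
    show "K' > 0" unfolding K'_def using K c0 by auto
    fix f :: "complex \<Rightarrow> 'a" and l x v v'
    assume f: "analytic_disc f" and v: "cmod v = R l" and v': "cmod (v' - v) \<le> c0 / 4 / 2 ^ l"
    let ?Q = "peak f a R (l + M) x" and ?s = "1 + 2 ^ l * cmod (v - zeta x)"
    have Q0: "0 \<le> ?Q" by (rule peak_nonneg[OF f])
    define \<rho> where "\<rho> = c0 / 2 / 2 ^ l"
    have \<rho>: "\<rho> > 0" using c0 by (simp add: \<rho>_def)
    have zb: "cmod z \<le> R l + \<rho>" "R l - \<rho> \<le> cmod z" if "z \<in> cball v \<rho>" for z
      using that norm_triangle_ineq2[of z v] norm_triangle_ineq2[of v z] v by (auto simp: dist_norm norm_minus_commute)
    have R2: "2 * \<rho> \<le> 1 - R l" using R_lower[of l] by (simp add: \<rho>_def)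
    have "norm (f v' - f v) \<le> 2 * (K * ((1 + c0) powr a * ?s powr a) * ?Q) / \<rho> * cmod (v' - v)"
    proof (rule analytic_disc_lipschitz[OF f _ \<rho>])
      show "cball v \<rho> \<subseteq> ball 0 1" using zb(1) R2 \<rho> by (fastforce simp: subset_iff)
      show "cmod (v' - v) \<le> \<rho> / 2" using v' by (simp add: \<rho>_def)
      fix z assume z: "z \<in> cball v \<rho>"
      have "norm (f z) \<le> K * (1 + 2 ^ l * cmod (z - zeta x)) powr a * ?Q"
      proof (rule le[OF f])
        show "c0 / 2 / 2 ^ l \<le> 1 - cmod z" using zb(1)[OF z] R2 by (simp add: \<rho>_def)
        have "1 - cmod z \<le> C0 / 2 ^ l + \<rho>" using zb(2)[OF z] R_upper[of l] by linarith
        also have "\<dots> \<le> (C0 + c0) / 2 ^ l" using c0 by (simp add: \<rho>_def field_simps)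
        finally show "1 - cmod z \<le> (C0 + c0) / 2 ^ l" .
      qed
      also have "\<dots> \<le> K * ((1 + c0) powr a * ?s powr a) * ?Q"
      proof (intro mult_right_mono mult_left_mono Q0)
        have "cmod (z - zeta x) \<le> \<rho> + cmod (v - zeta x)"
          using norm_triangle_ineq[of "z - v" "v - zeta x"] z by (simp add: dist_norm norm_minus_commute)
        then have "2 ^ l * cmod (z - zeta x) \<le> 2 ^ l * (\<rho> + cmod (v - zeta x))" by (intro mult_left_mono) auto
        also have "\<dots> \<le> c0 + 2 ^ l * cmod (v - zeta x)" using c0 by (simp add: \<rho>_def distrib_left)
        finally have "1 + 2 ^ l * cmod (z - zeta x) \<le> (1 + c0) * ?s"
          using one_plus_mult_le[of c0 "2 ^ l * cmod (v - zeta x)"] c0 by simp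
        then have "(1 + 2 ^ l * cmod (z - zeta x)) powr a \<le> ((1 + c0) * ?s) powr a"
          using a by (intro powr_mono2) auto
        then show "(1 + 2 ^ l * cmod (z - zeta x)) powr a \<le> (1 + c0) powr a * ?s powr a"
          by (simp add: powr_mult)
      qed (use K in auto)
      finally show "norm (f z) \<le> K * ((1 + c0) powr a * ?s powr a) * ?Q" .
    qed
    also have "\<dots> = K' * (2 ^ l * cmod (v' - v)) * ?s powr a * ?Q"
      using c0 by (simp add: K'_def \<rho>_def)
    finally show "norm (f v' - f v) \<le> K' * (2 ^ l * cmod (v' - v)) * ?s powr a * ?Q" .
  qed
qed

end

text \<open>The error term sits \<open>M\<close> levels deeper, so partial sums cannot be absorbed
  directly. After \<open>i\<close> iterations there remains \<open>\<eta> ^ i\<close> times a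
  partial sum of length \<open>n + i * M\<close>; growth at rate \<open>\<kappa>\<close> with
  \<open>\<eta> * \<kappa> ^ M \<le> 1 / 2\<close> sends this to 0, and the growth constant
  \<open>A\<close> leaves no trace.\<close>

lemma absorb_shifted:
  fixes a o' :: "nat \<Rightarrow> real"
  assumes a0: "\<And>L. 0 \<le> a L" and o0: "\<And>L. 0 \<le> o' L" and c: "c > 0"
    and step: "\<And>L. a L \<le> c * o' (L + m) + \<eta> * a (L + M)"
    and \<eta>: "0 \<le> \<eta>" "\<eta> \<le> 1 / 2" "\<eta> * \<kappa> ^ M \<le> 1 / 2" and \<kappa>: "\<kappa> \<ge> 1"
    and growth: "\<And>L. a L \<le> A * \<kappa> ^ L"
  shows "(\<Sum>L. ennreal (a L)) \<le> ennreal (2 * c) * (\<Sum>L. ennreal (o' L))"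
proof (cases "(\<Sum>L. ennreal (o' L)) = \<infinity>")
  case True
  then show ?thesis using c by (simp add: ennreal_mult_top)
next
  case False
  then have so: "summable o'" using o0 by (auto intro!: summable_suminf_not_top)
  define T where "T = (\<Sum>L. o' L)"
  have T0: "T \<ge> 0" unfolding T_def using so o0 by (intro suminf_nonneg)
  define s where "s = (\<lambda>n. \<Sum>L<n. a L)"
  have A: "A \<ge> 0" using growth[of 0] a0[of 0] by simp
  have s1: "s n \<le> c * T + \<eta> * s (n + M)" for n
  proof -
    have "s n \<le> (\<Sum>L<n. c * o' (L + m) + \<eta> * a (L + M))" unfolding s_def by (rule sum_mono[OF step])
    also have "\<dots> = c * (\<Sum>L<n. o' (L + m)) + \<eta> * (\<Sum>L<n. a (L + M))"
      by (simp add: sum.distrib sum_distrib_left)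
    also have "(\<Sum>L<n. o' (L + m)) = (\<Sum>L\<in>(\<lambda>L. L + m) ` {..<n}. o' L)" by (simp add: sum.reindex)
    also have "\<dots> \<le> T" unfolding T_def by (rule sum_le_suminf[OF so]) (use o0 in auto)
    also have "(\<Sum>L<n. a (L + M)) = (\<Sum>L\<in>(\<lambda>L. L + M) ` {..<n}. a L)" by (simp add: sum.reindex)
    also have "\<dots> \<le> s (n + M)" unfolding s_def using a0 by (intro sum_mono2) auto
    finally show ?thesis using c \<eta> by (simp add: mult_left_mono)
  qed
  have s2: "s n \<le> 2 * c * T * (1 - (1 / 2) ^ i) + \<eta> ^ i * s (n + i * M)" for n i
  proof (induction i)
    case (Suc i)
    have "\<eta> ^ i * s (n + i * M) \<le> \<eta> ^ i * (c * T + \<eta> * s (n + i * M + M))"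
      using \<eta> s1 by (intro mult_left_mono) auto
    also have "\<dots> = \<eta> ^ i * (c * T) + \<eta> ^ Suc i * s (n + Suc i * M)" by (simp add: algebra_simps)
    also have "\<eta> ^ i * (c * T) \<le> (1 / 2) ^ i * (c * T)" using \<eta> c T0 by (intro mult_right_mono power_mono) auto
    finally have "s n \<le> 2 * c * T * (1 - (1 / 2) ^ i) + (1 / 2) ^ i * (c * T) + \<eta> ^ Suc i * s (n + Suc i * M)"
      using Suc.IH by simp
    also have "2 * c * T * (1 - (1 / 2) ^ i) + (1 / 2) ^ i * (c * T) = 2 * c * T * (1 - (1 / 2) ^ Suc i)"
      by (simp add: algebra_simps)
    finally show ?case .
  qed simp
  have s3: "s n \<le> 2 * c * T + A * \<kappa> ^ n * ((real n + real i * real M) * (1 / 2) ^ i)" for n i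
  proof -
    have "s (n + i * M) \<le> (\<Sum>L<n + i * M. A * \<kappa> ^ (n + i * M))"
      unfolding s_def
    proof (rule sum_mono)
      fix L assume "L \<in> {..<n + i * M}"
      then have "\<kappa> ^ L \<le> \<kappa> ^ (n + i * M)" using \<kappa> by (intro power_increasing) auto
      then show "a L \<le> A * \<kappa> ^ (n + i * M)" using growth[of L] mult_left_mono[of "\<kappa> ^ L" _ A] A by fastforce
    qed
    also have "\<dots> = (real n + real i * real M) * (A * \<kappa> ^ n * (\<kappa> ^ M) ^ i)"
      by (simp add: power_add power_mult[symmetric] mult.commute)
    finally have "\<eta> ^ i * s (n + i * M) \<le> \<eta> ^ i * ((real n + real i * real M) * (A * \<kappa> ^ n * (\<kappa> ^ M) ^ i))"
      using \<eta> by (intro mult_left_mono) auto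
    also have "\<dots> = (real n + real i * real M) * (A * \<kappa> ^ n) * (\<eta> * \<kappa> ^ M) ^ i"
      by (simp add: power_mult_distrib mult_ac)
    also have "\<dots> \<le> (real n + real i * real M) * (A * \<kappa> ^ n) * (1 / 2) ^ i"
      using \<eta> A \<kappa> by (intro mult_left_mono power_mono) auto
    finally have 1: "\<eta> ^ i * s (n + i * M) \<le> A * \<kappa> ^ n * ((real n + real i * real M) * (1 / 2) ^ i)" by (simp add: mult_ac)
    have "2 * c * T * (1 - (1 / 2) ^ i) \<le> 2 * c * T * 1" using c T0 by (intro mult_left_mono) auto
    then show ?thesis using s2[of n i] 1 by linarith
  qed
  have s4: "s n \<le> 2 * c * T" for n
  proof -
    have "(\<lambda>i. real i * (1 / 2) ^ i) \<longlonglongrightarrow> (0::real)" by (rule powser_times_n_limit_0) simp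
    moreover have "(\<lambda>i. (1 / 2) ^ i) \<longlonglongrightarrow> (0::real)" by (rule LIMSEQ_power_zero) simp
    ultimately have "(\<lambda>i. 2 * c * T + A * \<kappa> ^ n * (real n * (1 / 2) ^ i + real M * (real i * (1 / 2) ^ i)))
        \<longlonglongrightarrow> 2 * c * T + A * \<kappa> ^ n * (real n * 0 + real M * 0)"
      by (intro tendsto_add tendsto_mult tendsto_const)
    then have "(\<lambda>i. 2 * c * T + A * \<kappa> ^ n * (real n * (1 / 2) ^ i + real M * (real i * (1 / 2) ^ i))) \<longlonglongrightarrow> 2 * c * T" by simp
    then show ?thesis
      by (rule LIMSEQ_le_const) (use s3[of n] in \<open>auto simp: algebra_simps\<close>)
  qed
  have "(\<Sum>L<n. ennreal (a L)) \<le> ennreal (2 * c * T)" for n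
    using s4[of n] a0 unfolding s_def by (simp add: sum_ennreal ennreal_leI)
  then have "(\<Sum>L. ennreal (a L)) \<le> ennreal (2 * c * T)"
    unfolding suminf_eq_SUP by (intro SUP_least)
  also have "\<dots> = ennreal (2 * c) * (\<Sum>L. ennreal (o' L))"
    unfolding T_def using suminf_ennreal2[OF o0 so] c T0 by (simp add: ennreal_mult T_def)
  finally show ?thesis .
qed

text \<open>The arcs of level \<open>n\<close> sample the circle of radius \<open>R (n - m)\<close>: they are finer than the scale of that
  circle by \<open>m\<close> generations. Circles of index below \<open>j\<close> are not controlled on an arc of rank \<open>j\<close>.\<close>

definition box_weights :: "(complex \<Rightarrow> 'a::complex_banach) \<Rightarrow> (nat \<Rightarrow> real) \<Rightarrow> real \<Rightarrow> nat \<Rightarrow> real \<Rightarrow> real \<Rightarrow> nat \<Rightarrow> nat \<Rightarrow> nat \<Rightarrow> real" where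
  "box_weights f R \<delta> m s q j n k =
     (if j + m \<le> n then 2 powr (s * real (n - m) * q) * box_inf f R \<delta> (n - m) n k powr q else 0)"

definition peak_bracket :: "real \<Rightarrow> real \<Rightarrow> real \<Rightarrow> (nat \<Rightarrow> real) \<Rightarrow> (complex \<Rightarrow> 'a::complex_banach) \<Rightarrow> real \<Rightarrow> nat \<Rightarrow> ennreal" where
  "peak_bracket s q a R f x j = (\<Sum>L. ennreal (2 powr (s * real (j + L) * q) * peak f a R (j + L) x powr q))"

lemma box_weights_nonneg: "0 \<le> box_weights f R \<delta> m s q j n k"
  unfolding box_weights_def by simp

context radii
begin

text \<open>Indices of generation \<open>n\<close> live on the scale \<open>2 ^ n\<close> and the
  weight on the scale \<open>2 ^ l\<close>; the quotient \<open>2 ^ m\<close> and the rounding to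
  integers give the factor \<open>2 * 2 ^ m\<close>.\<close>

lemma index_near:
  assumes x: "0 \<le> x" "x < 1" and y: "0 \<le> y" "y < 1" and n: "n = l + m"
  obtains K where "K < 3 * 2 ^ n" "K mod 2 ^ n = lev n y"
    "1 + \<bar>real K - real (lev n x + 2 ^ n)\<bar> \<le> 2 * 2 ^ m * (1 + 2 ^ l * cmod (complex_of_real (R l) * zeta y - zeta x))"
proof -
  let ?v = "complex_of_real (R l) * zeta y"
  obtain t :: nat where t: "t < 3" "2 * \<bar>y + real t - 1 - x\<bar> \<le> cmod (zeta x - zeta y)"
    using norm_zeta_diff_ge[OF x y] by blast
  have "cmod (zeta y - ?v) = 1 - R l"
  proof -
    have "zeta y - ?v = (1 - complex_of_real (R l)) * zeta y" by (simp add: algebra_simps)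
    also have "cmod \<dots> = cmod (complex_of_real (1 - R l))" by (simp only: norm_mult norm_zeta) simp
    finally show ?thesis using R(2)[of l] by (simp only: norm_of_real)
  qed
  moreover have "1 - R l \<le> cmod (?v - zeta x)"
    using norm_triangle_ineq2[of "zeta x" ?v] R(1)[of l] by (simp add: norm_mult norm_minus_commute)
  moreover have "cmod (zeta x - zeta y) \<le> cmod (?v - zeta x) + cmod (zeta y - ?v)"
    using norm_triangle_ineq[of "zeta x - ?v" "?v - zeta y"] by (simp add: norm_minus_commute)
  \<comment> \<open>With \<open>V\<close> the distance from the point to \<open>zeta x\<close>, the
    chord is at most \<open>2 * V\<close> because the radial gap \<open>1 - R l\<close> is itself at
    most \<open>V\<close>. This cancels the factor 2 in the lower bound for the chord.\<close>
  moreover have "a \<le> V" if "U = r" "r \<le> V" "d \<le> V + U" "2 * a \<le> d" for a V U r d :: real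
    using that by linarith
  ultimately have d: "\<bar>y + real t - 1 - x\<bar> \<le> cmod (?v - zeta x)" using t(2) by blast
  let ?K = "lev n y + t * 2 ^ n"
  have lev: "real (lev n z) \<le> 2 ^ n * z" "2 ^ n * z < real (lev n z) + 1" if "0 \<le> z" for z
    using that unfolding lev_def by simp_all
  have e: "real ?K - real (lev n x + 2 ^ n) = (real (lev n y) - 2 ^ n * y) - (real (lev n x) - 2 ^ n * x) + 2 ^ n * (y + real t - 1 - x)"
    by (simp add: algebra_simps)
  have "\<bar>2 ^ n * (y + real t - 1 - x)\<bar> = 2 ^ n * \<bar>y + real t - 1 - x\<bar>" by (simp add: abs_mult)
  also have "\<dots> \<le> 2 ^ n * cmod (?v - zeta x)" by (rule mult_left_mono[OF d]) simp
  finally have "\<bar>real ?K - real (lev n x + 2 ^ n)\<bar> \<le> 1 + 2 ^ n * cmod (?v - zeta x)"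
    unfolding e using lev[OF x(1)] lev[OF y(1)] by linarith
  moreover have "2 * 2 ^ m * (1 + 2 ^ l * cmod (?v - zeta x)) = 2 * 2 ^ m + 2 * (2 ^ n * cmod (?v - zeta x))"
    by (simp add: n power_add algebra_simps)
  moreover have "(1::real) \<le> 2 ^ m" "0 \<le> 2 ^ n * cmod (?v - zeta x)" by simp_all
  ultimately have "1 + \<bar>real ?K - real (lev n x + 2 ^ n)\<bar> \<le> 2 * 2 ^ m * (1 + 2 ^ l * cmod (?v - zeta x))" by linarith
  moreover have "?K < 3 * 2 ^ n"
  proof -
    have "t * 2 ^ n \<le> 2 * 2 ^ n" using t(1) by (intro mult_right_mono) auto
    then show ?thesis using lev_less[OF y, of n] by linarith
  qed
  moreover have "?K mod 2 ^ n = lev n y" using lev_less[OF y, of n] by simp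
  ultimately show ?thesis using that by blast
qed

text \<open>The constants depend on each other in one direction only: the shift \<open>M\<close> and
  factor \<open>K\<close> of the oscillation bound and the growth rate \<open>\<kappa>\<close> per
  level determine \<open>\<epsilon>\<close>, this determines the box size \<open>\<delta>\<close>,
  and \<open>\<delta>\<close> the refinement \<open>m\<close>. None depends on
  \<open>f\<close>.\<close>

lemma sampling:
  assumes a: "a > 0" and q: "q > 0" and \<beta>: "\<beta> \<ge> 0" and \<delta>1: "\<delta>1 > 0"
  shows "\<exists>\<delta> m c. 0 < \<delta> \<and> \<delta> \<le> \<delta>1 \<and> 0 < c \<and> (\<forall>f :: complex \<Rightarrow> 'a::complex_banach. analytic_disc f \<longrightarrow> poly_growth f R \<beta> \<longrightarrow>
    (\<forall>x j. 0 \<le> x \<longrightarrow> x < 1 \<longrightarrow> peak_bracket s q a R f x j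
      \<le> ennreal c * (\<Sum>L. ennreal (periodic_op (a * q) (box_weights f R \<delta> m s q j) (j + L) x))))"
proof -
  obtain M K where K: "K > 0" and
    osc: "\<And>(f :: complex \<Rightarrow> 'a) l x v v'. analytic_disc f \<Longrightarrow> cmod v = R l \<Longrightarrow> cmod (v' - v) \<le> c0 / 4 / 2 ^ l \<Longrightarrow>
    norm (f v' - f v) \<le> K * (2 ^ l * cmod (v' - v)) * (1 + 2 ^ l * cmod (v - zeta x)) powr a * peak f a R (l + M) x"
    using oscillation_le_peak_deeper[OF a] by blast
  define \<kappa> where "\<kappa> = 2 powr ((\<bar>s\<bar> + \<beta>) * q)"
  have \<kappa>: "\<kappa> \<ge> 1" unfolding \<kappa>_def using q \<beta> by (intro ge_one_powr_ge_zero) auto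
  \<comment> \<open>Solved from \<open>\<eta> * \<kappa> ^ M = 1 / 2\<close>: the factor
    \<open>2 powr q\<close> is the loss in splitting the \<open>q\<close>-th power of a sum, and
    \<open>2 powr (real M * \<bar>s\<bar> * q)\<close> compares the weights of the levels
    \<open>l\<close> and \<open>l + M\<close>.\<close>
  define \<epsilon> where "\<epsilon> = (1 / 2 / (2 powr q * 2 powr (real M * \<bar>s\<bar> * q) * \<kappa> ^ M)) powr (1 / q)"
  have \<kappa>M: "\<kappa> ^ M \<ge> 1" using \<kappa> by simp
  have \<epsilon>: "\<epsilon> > 0" unfolding \<epsilon>_def using \<kappa> by simp
  define \<eta> where "\<eta> = 2 powr q * \<epsilon> powr q * 2 powr (real M * \<bar>s\<bar> * q)"
  have "\<epsilon> powr q = 1 / 2 / (2 powr q * 2 powr (real M * \<bar>s\<bar> * q) * \<kappa> ^ M)"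
    unfolding \<epsilon>_def using q \<kappa>M by (simp add: powr_powr)
  then have \<eta>\<kappa>: "\<eta> * \<kappa> ^ M = 1 / 2" unfolding \<eta>_def using \<kappa>M \<kappa> by (simp add: field_simps)
  have \<eta>0: "\<eta> \<ge> 0" unfolding \<eta>_def by simp
  have \<eta>1: "\<eta> \<le> 1 / 2" using \<eta>\<kappa> mult_left_mono[OF \<kappa>M \<eta>0] by simp
  \<comment> \<open>The radial and, by the choice of \<open>m\<close>, the angular displacement in a
    box are at most \<open>\<delta> / 2 ^ l\<close> each, together
    \<open>2 * \<delta> / 2 ^ l\<close>. This must stay within the range
    \<open>c0 / 4 / 2 ^ l\<close> of the oscillation bound and produce a coefficient of at most
    \<open>\<epsilon>\<close>.\<close>
  define \<delta> where "\<delta> = min \<delta>1 (min (c0 / 8) (\<epsilon> / (2 * K)))"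
  have \<delta>: "0 < \<delta>" "\<delta> \<le> \<delta>1" "2 * \<delta> \<le> c0 / 4" "K * (2 * \<delta>) \<le> \<epsilon>"
  proof -
    show "0 < \<delta>" "\<delta> \<le> \<delta>1" "2 * \<delta> \<le> c0 / 4" using \<delta>1 c0 \<epsilon> K unfolding \<delta>_def by auto
    have "\<delta> \<le> \<epsilon> / (2 * K)" unfolding \<delta>_def by simp
    then show "K * (2 * \<delta>) \<le> \<epsilon>" using K by (simp add: field_simps)
  qed
  obtain m where m: "2 * pi / \<delta> < 2 ^ m" using real_arch_pow[of 2 "2 * pi / \<delta>"] by auto
  define E where "E = 2 * 2 ^ m * (1::real)"
  have E: "E > 0" by (simp add: E_def)
  define c1 where "c1 = 2 powr q * E powr (a * q)"
  have c1: "c1 > 0" unfolding c1_def using E by simp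
  show ?thesis
  proof (rule exI[of _ \<delta>], rule exI[of _ m], rule exI[of _ "2 * c1"], intro conjI allI impI)
    fix f :: "complex \<Rightarrow> 'a" and x :: real and j :: nat
    assume f: "analytic_disc f" and gr: "poly_growth f R \<beta>" and x: "0 \<le> x" "x < 1"
    let ?g = "box_weights f R \<delta> m s q j"
    let ?O = "\<lambda>n. periodic_op (a * q) ?g n x"
    have O0: "0 \<le> ?O n" for n by (rule periodic_op_nonneg) (rule box_weights_nonneg)
    have Q0: "0 \<le> peak f a R l x" for l by (rule peak_nonneg[OF f])
    have one: "2 powr (s * real l * q) * peak f a R l x powr q
        \<le> c1 * ?O (l + m) + \<eta> * (2 powr (s * real (l + M) * q) * peak f a R (l + M) x powr q)" if l: "j \<le> l" for l
    proof -
      let ?u = "2 powr (s * real l * q)" and ?P = "peak f a R (l + M) x" and ?n = "l + m"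
      have u: "?u > 0" by simp
      \<comment> \<open>A box infimum is recovered from a single term of the periodic operator:
        after the root of order \<open>q\<close> its weight with exponent \<open>a * q\<close> turns
        into the weight of \<open>peak\<close> with exponent \<open>a\<close>, up to
        \<open>E powr a\<close>.\<close>
      define Y where "Y = (?O ?n / ?u) powr (1 / q) * E powr a"
      have Y0: "Y \<ge> 0" unfolding Y_def by simp
      have "peak f a R l x \<le> Y + \<epsilon> * ?P"
      proof (rule peak_le)
        fix v assume v: "cmod v = R l"
        obtain y where y: "0 \<le> y" "y < 1" "v = complex_of_real (R l) * zeta y"
          using polar_zeta[of v] v by metis
        let ?s = "1 + 2 ^ l * cmod (v - zeta x)"
        have s0: "?s > 0" by (simp add: add_pos_nonneg)
        define k where "k = lev ?n y"
        define I where "I = box_inf f R \<delta> l ?n k"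
        have I0: "I \<ge> 0" unfolding I_def using \<delta> by (intro box_inf_nonneg) auto
        obtain K' where K': "K' < 3 * 2 ^ ?n" "K' mod 2 ^ ?n = k"
          "1 + \<bar>real K' - real (lev ?n x + 2 ^ ?n)\<bar> \<le> E * ?s"
          using index_near[OF x y(1,2), of ?n l m] unfolding k_def E_def y(3) by auto
        let ?D = "1 + \<bar>real K' - real (lev ?n x + 2 ^ ?n)\<bar>"
        have "?D powr (- (a * q)) * (?u * I powr q) \<le> ?O ?n"
        proof -
          have "?g ?n (K' mod 2 ^ ?n) = ?u * I powr q"
            unfolding box_weights_def I_def K'(2) using l by simp
          then show ?thesis
            unfolding periodic_op_def using K'(1)
              member_le_sum[of K' "{..<3 * 2 ^ ?n}" "\<lambda>K. (1 + \<bar>real K - real (lev ?n x + 2 ^ ?n)\<bar>) powr (- (a * q)) * ?g ?n (K mod 2 ^ ?n)"]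
            by (simp add: box_weights_nonneg)
        qed
        then have "?u * I powr q \<le> ?O ?n * ?D powr (a * q)"
          by (simp add: powr_minus_divide field_simps add_pos_nonneg)
        then have "I powr q \<le> ?O ?n / ?u * ?D powr (a * q)" using u by (simp add: field_simps)
        also have "\<dots> \<le> ?O ?n / ?u * (E * ?s) powr (a * q)"
          using K'(3) a q O0[of ?n] by (intro mult_left_mono powr_mono2) auto
        finally have "(I powr q) powr (1 / q) \<le> (?O ?n / ?u * (E * ?s) powr (a * q)) powr (1 / q)"
          using q by (intro powr_mono2) auto
        moreover have "(W * (E * S) powr (a * q)) powr (1 / q) = W powr (1 / q) * E powr a * S powr a" for W S :: real
          using q by (simp add: powr_mult powr_powr)
        moreover have "(I powr q) powr (1 / q) = I" using q I0 by (simp add: powr_powr)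
        ultimately have I: "I \<le> Y * ?s powr a" unfolding Y_def by (simp only:)
        have "norm (f v) - \<epsilon> * ?s powr a * ?P \<le> I"
          unfolding I_def
        proof (rule le_box_inf)
          fix r y' assume r: "r \<in> {R l..R l + \<delta> / 2 ^ l}" and y': "y' \<in> dyadic ?n k"
          let ?v = "complex_of_real r * zeta y'"
          have "lev ?n y' = lev ?n y" "0 \<le> y'" using y' mem_dyadic_iff dyadic_nonneg k_def by blast+
          then have yd: "\<bar>y' - y\<bar> \<le> 1 / 2 ^ ?n"
          proof -
            have "y \<in> dyadic ?n k" using mem_dyadic_iff[OF y(1)] k_def by blast
            then show ?thesis using y' unfolding dyadic_def by (auto simp: abs_le_iff add_divide_distrib)
          qed
          have r01: "\<bar>r - R l\<bar> \<le> \<delta> / 2 ^ l" using r by auto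
          have "?v - v = complex_of_real (r - R l) * zeta y' + complex_of_real (R l) * (zeta y' - zeta y)"
            unfolding y(3) by (simp add: algebra_simps)
          then have "cmod (?v - v) \<le> cmod (complex_of_real (r - R l) * zeta y') + cmod (complex_of_real (R l) * (zeta y' - zeta y))"
            by (metis norm_triangle_ineq)
          also have "\<dots> = \<bar>r - R l\<bar> + R l * cmod (zeta y' - zeta y)"
            using R(1)[of l] by (simp only: norm_mult norm_of_real norm_zeta) simp
          also have "R l * cmod (zeta y' - zeta y) \<le> 1 * (2 * pi * (1 / 2 ^ ?n))"
            using R[of l] norm_zeta_diff_le[of y' y] yd
            by (intro mult_mono order_trans[OF norm_zeta_diff_le] mult_left_mono) auto
          also have "1 * (2 * pi * (1 / 2 ^ ?n)) \<le> \<delta> / 2 ^ l"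
            using m \<delta>(1) by (simp add: power_add field_simps)
          finally have vv: "cmod (?v - v) \<le> 2 * \<delta> / 2 ^ l" using r01 by simp
          then have vv2: "2 ^ l * cmod (?v - v) \<le> 2 * \<delta>" by (simp add: field_simps)
          have "2 * \<delta> / 2 ^ l \<le> c0 / 4 / 2 ^ l" using \<delta>(3) by (intro divide_right_mono) auto
          then have "norm (f ?v - f v) \<le> K * (2 ^ l * cmod (?v - v)) * ?s powr a * ?P"
            using vv by (intro osc[OF f v]) linarith
          also have "\<dots> \<le> \<epsilon> * ?s powr a * ?P"
          proof (intro mult_right_mono Q0)
            have "K * (2 ^ l * cmod (?v - v)) \<le> K * (2 * \<delta>)" using vv2 K by (intro mult_left_mono) auto
            then show "K * (2 ^ l * cmod (?v - v)) \<le> \<epsilon>" using \<delta>(4) by linarith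
          qed simp
          finally show "norm (f v) - \<epsilon> * ?s powr a * ?P \<le> norm (f ?v)"
            using norm_triangle_ineq2[of "f v" "f ?v"] by (simp add: norm_minus_commute)
        qed (use \<delta> in auto)
        then have "norm (f v) \<le> (Y + \<epsilon> * ?P) * ?s powr a" using I by (simp add: algebra_simps)
        then show "norm (f v) * ?s powr (- a) \<le> Y + \<epsilon> * ?P"
          using s0 by (simp add: powr_minus_divide pos_divide_le_eq)
      qed
      then have "peak f a R l x powr q \<le> (Y + \<epsilon> * ?P) powr q" using q Q0 by (intro powr_mono2) auto
      also have "\<dots> \<le> 2 powr q * (Y powr q + (\<epsilon> * ?P) powr q)"
        using Y0 \<epsilon> Q0 q by (intro powr_add_le) auto
      also have "Y powr q = ?O ?n / ?u * E powr (a * q)"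
        unfolding Y_def using q O0[of ?n] by (simp add: powr_mult powr_powr)
      finally have "?u * peak f a R l x powr q \<le> ?u * (2 powr q * (?O ?n / ?u * E powr (a * q) + (\<epsilon> * ?P) powr q))"
        using u by (intro mult_left_mono) auto
      also have "\<dots> = c1 * ?O ?n + 2 powr q * \<epsilon> powr q * (?u * ?P powr q)"
        unfolding c1_def using u by (simp add: powr_mult field_simps)
      also have "2 powr q * \<epsilon> powr q * (?u * ?P powr q) \<le> \<eta> * (2 powr (s * real (l + M) * q) * ?P powr q)"
      proof -
        have "?u \<le> 2 powr (real M * \<bar>s\<bar> * q) * 2 powr (s * real (l + M) * q)"
        proof -
          have "- s * (real M * q) \<le> \<bar>s\<bar> * (real M * q)" using q by (intro mult_right_mono) auto
          then show ?thesis unfolding powr_add[symmetric] by (intro powr_mono) (auto simp: algebra_simps)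
        qed
        then have "?u * ?P powr q \<le> 2 powr (real M * \<bar>s\<bar> * q) * 2 powr (s * real (l + M) * q) * ?P powr q"
          by (intro mult_right_mono) auto
        then have "2 powr q * \<epsilon> powr q * (?u * ?P powr q)
            \<le> 2 powr q * \<epsilon> powr q * (2 powr (real M * \<bar>s\<bar> * q) * 2 powr (s * real (l + M) * q) * ?P powr q)"
          by (intro mult_left_mono) auto
        then show ?thesis unfolding \<eta>_def by (simp only: mult_ac)
      qed
      finally show ?thesis by simp
    qed
    obtain A where A: "A \<ge> 0" "\<And>l v. cmod v \<le> R l \<Longrightarrow> norm (f v) \<le> A * 2 powr (\<beta> * real l)"
      using gr unfolding poly_growth_def by blast
    have P_growth: "peak f a R l x \<le> A * 2 powr (\<beta> * real l)" for l
    proof (rule peak_le)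
      fix v assume v: "cmod v = R l"
      have "(1 + 2 ^ l * cmod (v - zeta x)) powr (- a) \<le> 1 powr (- a)"
        using a by (intro powr_mono2') auto
      then have "norm (f v) * (1 + 2 ^ l * cmod (v - zeta x)) powr (- a) \<le> norm (f v) * 1" by (intro mult_left_mono) auto
      then show "norm (f v) * (1 + 2 ^ l * cmod (v - zeta x)) powr (- a) \<le> A * 2 powr (\<beta> * real l)"
        using A(2)[of v l] v by simp
    qed
    show "peak_bracket s q a R f x j \<le> ennreal (2 * c1) * (\<Sum>L. ennreal (?O (j + L)))"
      unfolding peak_bracket_def
    \<comment> \<open>Both \<open>A\<close> and \<open>j\<close> enter the growth constant only, so
      the factor \<open>2 * c1\<close> is uniform in \<open>f\<close> and \<open>j\<close>.\<close>
    proof (rule absorb_shifted[where m=m and M=M and \<eta>=\<eta> and \<kappa>=\<kappa> and A="A powr q * \<kappa> ^ j"])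
      fix L
      show "2 powr (s * real (j + L) * q) * peak f a R (j + L) x powr q
        \<le> c1 * ?O (j + (L + m)) + \<eta> * (2 powr (s * real (j + (L + M)) * q) * peak f a R (j + (L + M)) x powr q)"
        using one[of "j + L"] by (simp add: add.assoc)
      have "2 powr (s * real (j + L) * q) * peak f a R (j + L) x powr q
          \<le> 2 powr (\<bar>s\<bar> * real (j + L) * q) * (A * 2 powr (\<beta> * real (j + L))) powr q"
        using q Q0 P_growth by (intro mult_mono powr_mono2 powr_mono mult_right_mono) (auto simp del: of_nat_add)
      also have "\<dots> = A powr q * 2 powr ((\<bar>s\<bar> + \<beta>) * q * real (j + L))"
        by (simp add: powr_mult powr_powr powr_add[symmetric] algebra_simps)
      also have "2 powr ((\<bar>s\<bar> + \<beta>) * q * real (j + L)) = \<kappa> ^ (j + L)"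
        unfolding \<kappa>_def by (simp add: powr_realpow[symmetric] powr_powr del: of_nat_add)
      finally show "2 powr (s * real (j + L) * q) * peak f a R (j + L) x powr q \<le> A powr q * \<kappa> ^ j * \<kappa> ^ L"
        by (simp add: power_add mult_ac)
    qed (use O0 c1 \<eta>0 \<eta>1 \<eta>\<kappa> \<kappa> in auto)
  qed (use \<delta> c1 in auto)
qed

text \<open>Reduces a lower bound to two facts about a bracket \<open>B\<close>: it controls the
  radial infima at the point \<open>x\<close> itself, and finiteness of its quasi-norm forces
  polynomial growth. An infinite quasi-norm leaves nothing to prove.\<close>

lemma peak_bracket_le_sampled:
  fixes B :: "(complex \<Rightarrow> 'a::complex_banach) \<Rightarrow> real \<Rightarrow> nat \<Rightarrow> ennreal"
  assumes p: "p > 0" and q: "q > 0" and a: "a > max (1 / p) (1 / q)" and \<beta>: "\<beta> \<ge> 0" and \<delta>1: "\<delta>1 > 0"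
    and sampled: "\<And>\<delta>. 0 < \<delta> \<Longrightarrow> \<delta> \<le> \<delta>1 \<Longrightarrow> \<exists>\<kappa>>0. \<forall>f x j N. analytic_disc f \<longrightarrow> 0 \<le> x \<longrightarrow> x < 1 \<longrightarrow>
      ennreal (\<kappa> * (\<Sum>L\<le>N. 2 powr (s * real (j + L) * q) *
        (INF r\<in>{R (j + L)..R (j + L) + \<delta> / 2 ^ (j + L)}. norm (f (complex_of_real r * zeta x))) powr q)) \<le> B f x j"
    and growth: "\<And>f. analytic_disc f \<Longrightarrow> dyadic_norm p q \<tau> (B f) < \<infinity> \<Longrightarrow> poly_growth f R \<beta>"
  shows "\<exists>K>0. \<forall>f. analytic_disc f \<longrightarrow> dyadic_norm p q \<tau> (peak_bracket s q a R f) \<le> ennreal K * dyadic_norm p q \<tau> (B f)"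
proof -
  have a0: "a > 0" using a p q by (smt (verit) divide_pos_pos max.cobounded1)
  \<comment> \<open>The two halves of the assumption on \<open>a\<close> become the two summability
    conditions of the tree bound with outer power \<open>p / q\<close>.\<close>
  have b: "a * q > 1" "a * q * (p / q) > 1" using a p q by (auto simp: field_simps)
  obtain \<delta> m c where \<delta>: "0 < \<delta>" "\<delta> \<le> \<delta>1" and c: "0 < c" and
    samp: "\<And>(f :: complex \<Rightarrow> 'a) x j. analytic_disc f \<Longrightarrow> poly_growth f R \<beta> \<Longrightarrow> 0 \<le> x \<Longrightarrow> x < 1 \<Longrightarrow>
      peak_bracket s q a R f x j \<le> ennreal c * (\<Sum>L. ennreal (periodic_op (a * q) (box_weights f R \<delta> m s q j) (j + L) x))"
    using sampling[OF a0 q \<beta> \<delta>1, of s] by blast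
  obtain \<kappa> where \<kappa>: "\<kappa> > 0" and low: "\<And>f x j N. analytic_disc f \<Longrightarrow> 0 \<le> x \<Longrightarrow> x < 1 \<Longrightarrow>
      ennreal (\<kappa> * (\<Sum>L\<le>N. 2 powr (s * real (j + L) * q) *
        (INF r\<in>{R (j + L)..R (j + L) + \<delta> / 2 ^ (j + L)}. norm (f (complex_of_real r * zeta x))) powr q)) \<le> B f x j"
    using sampled[OF \<delta>] by blast
  obtain K where K: "K > 0" and Kb: "\<And>(g :: nat \<Rightarrow> nat \<Rightarrow> nat \<Rightarrow> real) B. (\<forall>j n k. 0 \<le> g j n k) \<Longrightarrow>
    (\<forall>x j N. 0 \<le> x \<longrightarrow> x < 1 \<longrightarrow> ennreal (\<kappa> * (\<Sum>L\<le>N. g j (j + L) (lev (j + L) x))) \<le> B x j) \<Longrightarrow>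
    dyadic_norm p q \<tau> (\<lambda>x j. \<Sum>L. ennreal (periodic_op (a * q) (g j) (j + L) x)) \<le> ennreal K * dyadic_norm p q \<tau> B"
    using periodic_op_norm_bound[OF p q b \<kappa>, of \<tau>] by blast
  show ?thesis
  proof (intro exI[of _ "c powr (1 / q) * K"] conjI allI impI)
    show "0 < c powr (1 / q) * K" using c K by simp
    fix f :: "complex \<Rightarrow> 'a" assume f: "analytic_disc f"
    show "dyadic_norm p q \<tau> (peak_bracket s q a R f) \<le> ennreal (c powr (1 / q) * K) * dyadic_norm p q \<tau> (B f)"
    proof (cases "dyadic_norm p q \<tau> (B f) < \<infinity>")
      case False
      then have "dyadic_norm p q \<tau> (B f) = \<infinity>" by (metis infinity_ennreal_def top.not_eq_extremum)
      then show ?thesis using c K by (simp add: ennreal_mult_top)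
    next
      case True
      let ?g = "box_weights f R \<delta> m s q"
      have "dyadic_norm p q \<tau> (peak_bracket s q a R f)
          \<le> ennreal (c powr (1 / q)) * dyadic_norm p q \<tau> (\<lambda>x j. \<Sum>L. ennreal (periodic_op (a * q) (?g j) (j + L) x))"
        by (rule dyadic_norm_le_pointwise[OF p q c samp[OF f growth[OF f True]]])
      also have "\<dots> \<le> ennreal (c powr (1 / q)) * (ennreal K * dyadic_norm p q \<tau> (B f))"
      proof (intro mult_left_mono Kb allI impI)
        fix x :: real and j N :: nat assume x: "0 \<le> x" "x < 1"
        define h where "h = (\<lambda>L. 2 powr (s * real (j + L) * q) *
          (INF r\<in>{R (j + L)..R (j + L) + \<delta> / 2 ^ (j + L)}. norm (f (complex_of_real r * zeta x))) powr q)"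
        \<comment> \<open>The arc of generation \<open>j + L\<close> chosen here contains
          \<open>x\<close>, so the box infimum is at most the infimum along the radius through
          \<open>x\<close>. The circle index lags behind by \<open>m\<close>, and the weights vanish
          for \<open>L < m\<close>.\<close>
        have "?g j (j + L) (lev (j + L) x) \<le> (if m \<le> L then h (L - m) else 0)" for L
        proof (cases "m \<le> L")
          case True
          let ?l = "j + L - m"
          have l: "?l = j + (L - m)" using True by simp
          have "box_inf f R \<delta> ?l (j + L) (lev (j + L) x) \<le> (INF r\<in>{R ?l..R ?l + \<delta> / 2 ^ ?l}. norm (f (complex_of_real r * zeta x)))"
            using \<delta> mem_dyadic_iff[OF x(1)] by (intro cINF_greatest box_inf_le) auto
          then have "box_inf f R \<delta> ?l (j + L) (lev (j + L) x) powr q \<le> (INF r\<in>{R ?l..R ?l + \<delta> / 2 ^ ?l}. norm (f (complex_of_real r * zeta x))) powr q"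
            using q \<delta> by (intro powr_mono2 box_inf_nonneg) auto
          then show ?thesis using True unfolding box_weights_def h_def l by simp
        qed (simp add: box_weights_def)
        then have "(\<Sum>L\<le>N. ?g j (j + L) (lev (j + L) x)) \<le> (\<Sum>L\<le>N. if m \<le> L then h (L - m) else 0)"
          by (rule sum_mono)
        also have "\<dots> = (\<Sum>L\<in>{m..N}. h (L - m))" by (intro sum.mono_neutral_cong_right) auto
        also have "\<dots> = (\<Sum>L\<in>(\<lambda>L. L - m) ` {m..N}. h L)" by (subst sum.reindex) (auto simp: inj_on_def)
        also have "\<dots> \<le> (\<Sum>L\<le>N. h L)" by (rule sum_mono2) (auto simp: h_def)
        finally have "\<kappa> * (\<Sum>L\<le>N. ?g j (j + L) (lev (j + L) x)) \<le> \<kappa> * (\<Sum>L\<le>N. h L)"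
          using \<kappa> by (intro mult_left_mono) auto
        then show "ennreal (\<kappa> * (\<Sum>L\<le>N. ?g j (j + L) (lev (j + L) x))) \<le> B f x j"
          using low[OF f x, of j N, folded h_def] by (meson ennreal_leI order_trans)
      qed (auto simp: box_weights_nonneg)
      also have "\<dots> = ennreal (c powr (1 / q) * K) * dyadic_norm p q \<tau> (B f)"
        using c K by (simp add: ennreal_mult mult.assoc)
      finally show ?thesis .
    qed
  qed
qed

end

section \<open>Upper bounds\<close>

lemma zeta_measurable [measurable]: "zeta \<in> borel_measurable borel"
  by (intro borel_measurable_continuous_onI continuous_intros)

lemma measurable_ennreal_indicator:
  fixes F :: "'a::topological_space \<Rightarrow> real"
  assumes "continuous_on S F" "S \<in> sets borel"
  shows "(\<lambda>v. ennreal (F v) * indicator S v) \<in> borel_measurable borel"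
proof -
  have [measurable]: "(\<lambda>v. indicator S v *\<^sub>R F v) \<in> borel_measurable borel"
    by (rule borel_measurable_continuous_on_indicator) (use assms in auto)
  have "(\<lambda>v. ennreal (indicator S v *\<^sub>R F v)) \<in> borel_measurable borel" by measurable
  also have "(\<lambda>v. ennreal (indicator S v *\<^sub>R F v)) = (\<lambda>v. ennreal (F v) * indicator S v)"
    by (auto simp: fun_eq_iff indicator_def)
  finally show ?thesis .
qed

lemma nn_integral_continuous_unit:
  fixes h :: "real \<Rightarrow> real"
  assumes c: "continuous_on {0..1} h" and h: "\<And>x. 0 \<le> h x"
  shows "(\<integral>\<^sup>+ x. ennreal (h x) * indicator {0..<1} x \<partial>lborel) = ennreal (integral {0..1} h)"
proof -
  have si: "set_integrable lborel {0..1} h" by (rule borel_integrable_atLeastAtMost'[OF c])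
  have "(\<integral>\<^sup>+ x. ennreal (h x) * indicator {0..<1} x \<partial>lborel) = (\<integral>\<^sup>+ x. ennreal (indicator {0..1} x *\<^sub>R h x) \<partial>lborel)"
  proof (rule nn_integral_cong_AE)
    show "AE x in lborel. ennreal (h x) * indicator {0..<1} x = ennreal (indicator {0..1} x *\<^sub>R h x)"
      using AE_lborel_singleton[of "1::real"] by eventually_elim (auto simp: indicator_def)
  qed
  also have "\<dots> = ennreal (LINT x:{0..1}|lborel. h x)"
    unfolding set_lebesgue_integral_def
    using si h by (intro nn_integral_eq_integral) (auto simp: set_integrable_def)
  also have "(LINT x:{0..1}|lborel. h x) = integral {0..1} h" by (rule set_borel_integral_eq_integral(2)[OF si])
  finally show ?thesis .
qed

lemma continuous_on_circle_powr:
  assumes f: "analytic_disc f" and sub: "cball z \<rho> \<subseteq> ball 0 1" and "0 \<le> \<rho>" "t > 0"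
  shows "continuous_on A (\<lambda>x. norm (f (z + complex_of_real \<rho> * zeta x)) powr t)"
proof -
  have "z + complex_of_real \<rho> * zeta x \<in> ball 0 1" for x
  proof -
    have "z + complex_of_real \<rho> * zeta x \<in> cball z \<rho>" using assms(3) by (simp add: dist_norm norm_mult)
    then show ?thesis using sub by blast
  qed
  then show ?thesis
    by (intro continuous_on_powr' continuous_intros continuous_on_compose2[OF analytic_disc_continuous[OF f order_refl]])
      (use assms(4) in auto)
qed

lemma circle_mean_nn:
  fixes f :: "complex \<Rightarrow> 'a::complex_banach"
  assumes f: "analytic_disc f" and sub: "cball z \<rho> \<subseteq> ball 0 1" and w: "cmod (w - z) < \<rho>" and t: "t > 0"
  shows "ennreal (norm (f w) powr t) \<le> ennreal (2 powr t * \<rho> / (\<rho> - cmod (w - z))) *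
    (\<integral>\<^sup>+ x. ennreal (norm (f (z + complex_of_real \<rho> * zeta x)) powr t) * indicator {0..<1} x \<partial>lborel)"
proof -
  have \<rho>: "\<rho> > 0" using w norm_ge_zero order_le_less_trans by blast
  have "(\<integral>\<^sup>+ x. ennreal (norm (f (z + complex_of_real \<rho> * zeta x)) powr t) * indicator {0..<1} x \<partial>lborel)
    = ennreal (integral {0..1} (\<lambda>x. norm (f (z + complex_of_real \<rho> * zeta x)) powr t))"
    by (intro nn_integral_continuous_unit continuous_on_circle_powr[OF f sub]) (use \<rho> t in auto)
  moreover have "ennreal (norm (f w) powr t) \<le> ennreal (2 powr t * \<rho> / (\<rho> - cmod (w - z)) *
      integral {0..1} (\<lambda>x. norm (f (z + complex_of_real \<rho> * zeta x)) powr t))"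
    by (intro ennreal_leI circle_mean[OF f sub w t])
  moreover have "0 \<le> 2 powr t * \<rho> / (\<rho> - cmod (w - z))" using \<rho> w by simp
  ultimately show ?thesis by (simp only: ennreal_mult')
qed

text \<open>The circle means are averaged over the centre of the circle, which only uses translation invariance
  of Lebesgue measure.\<close>

lemma disc_mean:
  assumes q: "q > 0"
  shows "\<exists>K>0. \<forall>(f :: complex \<Rightarrow> 'a::complex_banach) w \<rho>. analytic_disc f \<longrightarrow> cball w \<rho> \<subseteq> ball 0 1 \<longrightarrow> \<rho> > 0 \<longrightarrow>
    ennreal (norm (f w) powr q) \<le> ennreal (K / \<rho>\<^sup>2) * (\<integral>\<^sup>+ v. ennreal (norm (f v) powr q) * indicator (cball w \<rho>) v \<partial>lborel)"
proof -
  define V where "V = unit_ball_vol (real DIM(complex))"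
  have V: "V > 0" unfolding V_def by (rule unit_ball_vol_pos) simp
  \<comment> \<open>\<open>2 powr q * 2\<close> is the circle mean constant for a point at most
    halfway from the centre to the circle, and \<open>16 / (V * \<rho>\<^sup>2)\<close> is the
    reciprocal area of the disc of radius \<open>\<rho> / 4\<close>.\<close>
  define K where "K = 2 powr q * 2 * 16 / V"
  show ?thesis
  proof (intro exI[of _ K] conjI allI impI)
    show "K > 0" unfolding K_def using V by simp
    fix f :: "complex \<Rightarrow> 'a" and w :: complex and \<rho> :: real
    assume f: "analytic_disc f" and sub: "cball w \<rho> \<subseteq> ball 0 1" and \<rho>: "\<rho> > 0"
    define F where "F = (\<lambda>v. ennreal (norm (f v) powr q) * indicator (cball w \<rho>) v)"
    have cf: "continuous_on (cball w \<rho>) (\<lambda>v. norm (f v) powr q)"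
      by (intro continuous_on_powr' continuous_intros analytic_disc_continuous[OF f sub]) (use q in auto)
    have F [measurable]: "F \<in> borel_measurable borel"
      unfolding F_def by (rule measurable_ennreal_indicator[OF cf]) simp
    \<comment> \<open>For \<open>u\<close> in this disc the circle of radius
      \<open>\<rho> / 2\<close> about \<open>w + u\<close> stays inside
      \<open>cball w \<rho>\<close>, and \<open>w\<close> keeps a distance of at least
      \<open>\<rho> / 4\<close> from it.\<close>
    let ?U = "cball (0::complex) (\<rho> / 4)"
    let ?c = "\<lambda>x. w + complex_of_real (\<rho> / 2) * zeta x"
    have J: "ennreal (norm (f w) powr q) * indicator ?U u \<le> ennreal (2 powr q * 2) * (\<integral>\<^sup>+ x. F (?c x + u) * indicator {0..<1} x \<partial>lborel)" for u
    proof (cases "u \<in> ?U")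
      case True
      have sub2: "cball (w + u) (\<rho> / 2) \<subseteq> cball w \<rho>"
      proof
        fix v assume "v \<in> cball (w + u) (\<rho> / 2)"
        then show "v \<in> cball w \<rho>" using True norm_triangle_ineq[of "w + u - v" "- u"] \<rho> by (simp add: dist_norm)
      qed
      have wu: "cmod (w - (w + u)) \<le> \<rho> / 4" using True by simp
      have "ennreal (norm (f w) powr q) \<le> ennreal (2 powr q * (\<rho> / 2) / (\<rho> / 2 - cmod (w - (w + u)))) *
        (\<integral>\<^sup>+ x. ennreal (norm (f (w + u + complex_of_real (\<rho> / 2) * zeta x)) powr q) * indicator {0..<1} x \<partial>lborel)"
        using sub sub2 wu \<rho> q by (intro circle_mean_nn[OF f]) auto
      also have "\<dots> \<le> ennreal (2 powr q * 2) * (\<integral>\<^sup>+ x. F (?c x + u) * indicator {0..<1} x \<partial>lborel)"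
      proof (intro mult_mono ennreal_leI nn_integral_mono)
        have "(\<rho> / 2) / (\<rho> / 2 - cmod (w - (w + u))) \<le> (\<rho> / 2) / (\<rho> / 4)"
          using wu \<rho> by (intro divide_left_mono) auto
        also have "\<dots> = 2" using \<rho> by simp
        finally show "2 powr q * (\<rho> / 2) / (\<rho> / 2 - cmod (w - (w + u))) \<le> 2 powr q * 2"
          using mult_left_mono[of "(\<rho> / 2) / (\<rho> / 2 - cmod (w - (w + u)))" 2 "2 powr q"] by simp
        fix x
        have "w + u + complex_of_real (\<rho> / 2) * zeta x \<in> cball (w + u) (\<rho> / 2)"
          using \<rho> by (simp add: dist_norm norm_mult)
        moreover have eq: "w + u + complex_of_real (\<rho> / 2) * zeta x = ?c x + u" by (simp only: ac_simps)
        ultimately have "?c x + u \<in> cball w \<rho>" using sub2 by (simp only:) blast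
        then show "ennreal (norm (f (w + u + complex_of_real (\<rho> / 2) * zeta x)) powr q) \<le> F (?c x + u)"
          unfolding F_def eq by simp
      qed auto
      finally show ?thesis using True by simp
    qed simp
    have "ennreal (norm (f w) powr q) * emeasure lborel ?U = (\<integral>\<^sup>+ u. ennreal (norm (f w) powr q) * indicator ?U u \<partial>lborel)"
      by (rule nn_integral_cmult_indicator[symmetric]) simp
    also have "\<dots> \<le> (\<integral>\<^sup>+ u. ennreal (2 powr q * 2) * (\<integral>\<^sup>+ x. F (?c x + u) * indicator {0..<1} x \<partial>lborel) \<partial>lborel)"
      by (rule nn_integral_mono[OF J])
    also have "\<dots> = ennreal (2 powr q * 2) * (\<integral>\<^sup>+ u. \<integral>\<^sup>+ x. F (?c x + u) * indicator {0..<1} x \<partial>lborel \<partial>lborel)"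
      by (rule nn_integral_cmult) measurable
    also have "(\<integral>\<^sup>+ u. \<integral>\<^sup>+ x. F (?c x + u) * indicator {0..<1} x \<partial>lborel \<partial>lborel)
        = (\<integral>\<^sup>+ x. \<integral>\<^sup>+ u. F (?c x + u) * indicator {0..<1} x \<partial>lborel \<partial>lborel)"
      by (rule lborel_pair.Fubini') measurable
    also have "\<dots> = (\<integral>\<^sup>+ x. (\<integral>\<^sup>+ u. F u \<partial>lborel) * indicator {0..<1::real} x \<partial>lborel)"
    proof (rule nn_integral_cong)
      fix x :: real
      have "(\<integral>\<^sup>+ u. F (?c x + u) * indicator {0..<1} x \<partial>lborel) = (\<integral>\<^sup>+ u. F (?c x + u) \<partial>lborel) * indicator {0..<1} x"
        by (rule nn_integral_multc) measurable
      also have "(\<integral>\<^sup>+ u. F (?c x + u) \<partial>lborel) = (\<integral>\<^sup>+ u. F u \<partial>distr lborel borel ((+) (?c x)))"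
        by (rule nn_integral_distr[symmetric]) measurable
      also have "\<dots> = (\<integral>\<^sup>+ u. F u \<partial>lborel)" by (simp only: lborel_distr_plus)
      finally show "(\<integral>\<^sup>+ u. F (?c x + u) * indicator {0..<1} x \<partial>lborel) = (\<integral>\<^sup>+ u. F u \<partial>lborel) * indicator {0..<1} x" .
    qed
    also have "\<dots> = (\<integral>\<^sup>+ u. F u \<partial>lborel)"
      by (subst nn_integral_cmult_indicator) simp_all
    finally have main: "ennreal (norm (f w) powr q) * emeasure lborel ?U \<le> ennreal (2 powr q * 2) * (\<integral>\<^sup>+ u. F u \<partial>lborel)" .
    have em: "emeasure lborel ?U = ennreal (V * (\<rho> / 4)\<^sup>2)"
      unfolding V_def using \<rho> by (subst emeasure_cball) simp_all
    define m where "m = V * (\<rho> / 4)\<^sup>2"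
    have m: "m > 0" unfolding m_def using V \<rho> by simp
    have one: "ennreal m * ennreal (1 / m) = 1" using m by (simp add: ennreal_mult[symmetric])
    have "ennreal (norm (f w) powr q) = ennreal (norm (f w) powr q) * emeasure lborel ?U * ennreal (1 / m)"
      unfolding em m_def[symmetric] mult.assoc one by simp
    also have "\<dots> \<le> ennreal (2 powr q * 2) * (\<integral>\<^sup>+ u. F u \<partial>lborel) * ennreal (1 / m)"
      by (rule mult_right_mono[OF main]) simp
    also have "\<dots> = ennreal (K / \<rho>\<^sup>2) * (\<integral>\<^sup>+ u. F u \<partial>lborel)"
    proof -
      have "ennreal (2 powr q * 2) * ennreal (1 / m) = ennreal (K / \<rho>\<^sup>2)"
        using m V \<rho> by (simp add: ennreal_mult[symmetric] K_def m_def power2_eq_square field_simps)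
      then show ?thesis by (metis mult.assoc mult.commute)
    qed
    finally show "ennreal (norm (f w) powr q) \<le> ennreal (K / \<rho>\<^sup>2) * (\<integral>\<^sup>+ v. ennreal (norm (f v) powr q) * indicator (cball w \<rho>) v \<partial>lborel)"
      unfolding F_def .
  qed
qed

lemma term_le_suminf:
  fixes F :: "nat \<Rightarrow> ennreal"
  shows "F i \<le> (\<Sum>i. F i)"
  using sum_le_suminf[of F "{i}"] by simp

lemma suminf_leI:
  fixes F :: "nat \<Rightarrow> ennreal"
  assumes "\<And>n. (\<Sum>i<n. F i) \<le> c"
  shows "(\<Sum>i. F i) \<le> c"
  unfolding suminf_eq_SUP using assms by (rule SUP_least)

lemma suminf_shift_le:
  fixes F :: "nat \<Rightarrow> ennreal"
  shows "(\<Sum>i. F (i + M)) \<le> (\<Sum>i. F i)"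
proof (rule suminf_leI)
  fix n
  have "(\<Sum>i<n. F (i + M)) = (\<Sum>i\<in>(\<lambda>i. i + M) ` {..<n}. F i)" by (simp add: sum.reindex)
  also have "\<dots> \<le> (\<Sum>i. F i)" by (rule sum_le_suminf) auto
  finally show "(\<Sum>i<n. F (i + M)) \<le> (\<Sum>i. F i)" .
qed

lemma suminf_from:
  fixes F :: "nat \<Rightarrow> ennreal"
  shows "(\<Sum>l. if j \<le> l then F l else 0) = (\<Sum>L. F (j + L))"
proof (rule antisym)
  show "(\<Sum>l. if j \<le> l then F l else 0) \<le> (\<Sum>L. F (j + L))"
  proof (rule suminf_leI)
    fix n
    have "(\<Sum>l<n. if j \<le> l then F l else 0) = (\<Sum>l\<in>{j..<n}. F l)" by (intro sum.mono_neutral_cong_right) auto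
    also have "\<dots> = (\<Sum>L<n - j. F (j + L))"
      by (rule sum.reindex_bij_witness[of _ "\<lambda>L. j + L" "\<lambda>l. l - j"]) auto
    also have "\<dots> \<le> (\<Sum>L. F (j + L))" by (rule sum_le_suminf) auto
    finally show "(\<Sum>l<n. if j \<le> l then F l else 0) \<le> (\<Sum>L. F (j + L))" .
  qed
  show "(\<Sum>L. F (j + L)) \<le> (\<Sum>l. if j \<le> l then F l else 0)"
    using suminf_shift_le[of "\<lambda>l. if j \<le> l then F l else 0" j] by (simp add: add.commute)
qed

lemma slice_exists:
  fixes t :: real
  assumes "0 < t" "t \<le> 1 / 2 ^ j"
  obtains L where "1 / 2 ^ (j + L + 1) < t" "t \<le> 1 / 2 ^ (j + L)"
proof -
  obtain n where n: "1 / t < 2 ^ n" using real_arch_pow[of 2 "1 / t"] by auto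
  define P where "P = (\<lambda>L. 1 / 2 ^ (j + L + 1) < t)"
  have "1 / 2 ^ n < t" using n assms by (simp add: field_simps)
  moreover have "1 / 2 ^ (j + n + 1) \<le> 1 / (2 ^ n :: real)" by (intro divide_left_mono power_increasing) auto
  ultimately have "P n" unfolding P_def by linarith
  define L where "L = (LEAST L. P L)"
  have PL: "P L" unfolding L_def by (rule LeastI[of P n, OF \<open>P n\<close>])
  have "t \<le> 1 / 2 ^ (j + L)"
  proof (cases L)
    case (Suc L')
    then have "\<not> P L'" using not_less_Least[of L' P] unfolding L_def by simp
    then show ?thesis unfolding P_def Suc by simp
  qed (use assms in simp)
  then show ?thesis using that PL unfolding P_def by blast
qed

lemma powr_slice:
  fixes t e :: real
  assumes "1 / 2 ^ (l + 1) \<le> t" "t \<le> 1 / 2 ^ l"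
  shows "2 powr (- \<bar>e\<bar>) * 2 powr (- e * real l) \<le> t powr e" "t powr e \<le> 2 powr \<bar>e\<bar> * 2 powr (- e * real l)"
proof -
  define u where "u = t * 2 ^ l"
  have u: "1 / 2 \<le> u" "u \<le> 1" using assms by (auto simp: u_def field_simps)
  have "t = u * 2 powr (- real l)" by (simp add: u_def powr_minus powr_realpow)
  then have t: "t powr e = u powr e * 2 powr (- e * real l)" by (simp add: powr_mult powr_powr mult.commute)
  have half: "2 powr (- \<bar>e\<bar>) = (1 / 2) powr \<bar>e\<bar>" by (simp add: powr_divide powr_minus_divide)
  have "2 powr (- \<bar>e\<bar>) \<le> u powr e \<and> u powr e \<le> 2 powr \<bar>e\<bar>"
  proof (cases "e \<ge> 0")
    case True
    then have "(1 / 2) powr e \<le> u powr e" "u powr e \<le> 1 powr e" using u by (intro powr_mono2; simp)+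
    moreover have "1 \<le> 2 powr e" using True by (intro ge_one_powr_ge_zero) auto
    ultimately show ?thesis unfolding half using True by simp
  next
    case False
    then have "1 powr e \<le> u powr e" "u powr e \<le> (1 / 2) powr e" using u by (intro powr_mono2'; simp)+
    moreover have "(1 / 2) powr e = 2 powr \<bar>e\<bar>" using False by (simp add: powr_divide powr_minus_divide)
    moreover have "2 powr (- \<bar>e\<bar>) \<le> 2 powr (0::real)" by (intro powr_mono) auto
    ultimately show ?thesis by simp
  qed
  then show "2 powr (- \<bar>e\<bar>) * 2 powr (- e * real l) \<le> t powr e" "t powr e \<le> 2 powr \<bar>e\<bar> * 2 powr (- e * real l)"
    unfolding t by (auto intro: mult_right_mono)
qed

lemma norm_zeta_diff_le_tdist:
  assumes "0 \<le> x" "x < 1" "0 \<le> y" "y < 1"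
  shows "cmod (zeta y - zeta x) \<le> 2 * pi * tdist x y" "0 \<le> tdist x y"
proof -
  have z1: "zeta (t + 1) = zeta t" for t
    using cis_mult[of "2 * pi * t" "2 * pi"] by (simp add: zeta_def distrib_left)
  have fr: "frac (x - y) = (if x \<ge> y then x - y else x - y + 1)"
    using assms by (auto simp: frac_unique_iff intro!: frac_unique_iff[THEN iffD2])
  have "cmod (zeta y - zeta x) \<le> 2 * pi * frac (x - y) \<and> cmod (zeta y - zeta x) \<le> 2 * pi * (1 - frac (x - y))"
  proof (cases "x \<ge> y")
    case True
    then show ?thesis using norm_zeta_diff_le[of y x] norm_zeta_diff_le[of "y + 1" x] assms unfolding fr z1 by (auto simp: algebra_simps)
  next
    case False
    then show ?thesis using norm_zeta_diff_le[of y x] norm_zeta_diff_le[of y "x + 1"] assms unfolding fr z1 by (auto simp: algebra_simps)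
  qed
  then show "cmod (zeta y - zeta x) \<le> 2 * pi * tdist x y" unfolding tdist_def by (auto simp: min_def)
  show "0 \<le> tdist x y" unfolding tdist_def using frac_lt_1[of "x - y"] by simp
qed

text \<open>After enlarging the sphere to the disc, which is convex, a point of the hull is
  \<open>(1 - u) z + u b\<close> with \<open>cmod b \<le> 1 / 2\<close>. Then
  \<open>cmod (w - z) \<le> 3 / 2 * u\<close> while \<open>1 - cmod w \<ge> u / 2\<close>.\<close>

lemma norm_stolz_le:
  assumes "w \<in> stolz z" "cmod z = 1"
  shows "cmod (w - z) \<le> 3 * (1 - cmod w)"
proof -
  have h: "convex hull (cball 0 (1 / 2)) = (cball 0 (1 / 2) :: complex set)" by (simp add: convex_hull_eq)
  have "stolz z \<subseteq> convex hull (insert z (cball 0 (1 / 2)))"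
    unfolding stolz_def by (intro hull_mono) auto
  then have "w \<in> convex hull (insert z (cball 0 (1 / 2)))" using assms(1) by blast
  then obtain u b where u: "0 \<le> u" "u \<le> 1" and b: "cmod b \<le> 1 / 2" and w: "w = (1 - u) *\<^sub>R z + u *\<^sub>R b"
    unfolding convex_hull_insert_alt h by auto
  have "w - z = u *\<^sub>R (b - z)" unfolding w by (simp add: algebra_simps)
  then have "cmod (w - z) = u * cmod (b - z)" using u by simp
  also have "\<dots> \<le> u * (3 / 2)" using b assms(2) norm_triangle_ineq4[of b z] u by (intro mult_left_mono) auto
  finally have 1: "cmod (w - z) \<le> 3 / 2 * u" by simp
  have "cmod w \<le> (1 - u) * cmod z + u * cmod b" unfolding w using norm_triangle_ineq[of "(1 - u) *\<^sub>R z" "u *\<^sub>R b"] u by simp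
  also have "\<dots> \<le> (1 - u) + u * (1 / 2)" using assms(2) b u by (intro add_mono mult_left_mono) auto
  finally show ?thesis using 1 by simp
qed

context radii
begin

text \<open>Circles \<open>M\<close> levels deeper cost only a constant: the shift changes each
  weight by at most \<open>2 powr (\<bar>s\<bar> * real M * q)\<close>, and the shifted series is a
  tail of the bracket.\<close>

lemma suminf_peak_shift_le:
  assumes c: "c \<ge> 0" and q: "q > 0"
  shows "(\<Sum>L. ennreal (c * (2 powr (s * real (j + L) * q) * peak f a R (j + L + M) x powr q)))
    \<le> ennreal (c * 2 powr (\<bar>s\<bar> * real M * q)) * peak_bracket s q a R f x j"
proof -
  let ?G = "\<lambda>L. ennreal (2 powr (s * real (j + L) * q) * peak f a R (j + L) x powr q)"
  have "(\<Sum>L. ennreal (c * (2 powr (s * real (j + L) * q) * peak f a R (j + L + M) x powr q)))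
      \<le> (\<Sum>L. ennreal (c * 2 powr (\<bar>s\<bar> * real M * q)) * ?G (L + M))"
  proof (rule suminf_le)
    fix L
    have "- s * (real M * q) \<le> \<bar>s\<bar> * (real M * q)" using q by (intro mult_right_mono) auto
    then have "2 powr (s * real (j + L) * q) \<le> 2 powr (\<bar>s\<bar> * real M * q) * 2 powr (s * real (j + L + M) * q)"
      unfolding powr_add[symmetric] by (intro powr_mono) (auto simp: algebra_simps)
    then have "c * (2 powr (s * real (j + L) * q) * peak f a R (j + L + M) x powr q)
      \<le> c * (2 powr (\<bar>s\<bar> * real M * q) * 2 powr (s * real (j + L + M) * q) * peak f a R (j + L + M) x powr q)"
      using c by (intro mult_left_mono mult_right_mono) auto
    also have "\<dots> = (c * 2 powr (\<bar>s\<bar> * real M * q)) * (2 powr (s * real (j + (L + M)) * q) * peak f a R (j + (L + M)) x powr q)"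
      by (simp only: mult_ac add.assoc)
    finally show "ennreal (c * (2 powr (s * real (j + L) * q) * peak f a R (j + L + M) x powr q))
      \<le> ennreal (c * 2 powr (\<bar>s\<bar> * real M * q)) * ?G (L + M)"
      using c by (subst ennreal_mult[symmetric]) (auto intro!: ennreal_leI)
  qed auto
  also have "\<dots> = ennreal (c * 2 powr (\<bar>s\<bar> * real M * q)) * (\<Sum>L. ?G (L + M))" by simp
  also have "\<dots> \<le> ennreal (c * 2 powr (\<bar>s\<bar> * real M * q)) * (\<Sum>L. ?G L)"
    by (intro mult_left_mono suminf_shift_le[of ?G M]) auto
  finally show ?thesis unfolding peak_bracket_def .
qed

text \<open>The weight left by \<open>norm_le_peak_deeper\<close> is at most a constant times the
  inverse of the Peetre factor, since the planar distance to \<open>zeta x\<close> is at most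
  \<open>1 - r\<close> plus a multiple of the arc distance, and \<open>2 ^ l\<close> is at most
  \<open>B / (1 - r)\<close>. The two cancel in the supremum.\<close>

lemma peetre_le_peak:
  assumes a: "a > 0" and A: "A > 0" and B: "B > 0"
  shows "\<exists>M. \<exists>K>0. \<forall>(f :: complex \<Rightarrow> 'a::complex_banach) l x r. analytic_disc f \<longrightarrow> 0 \<le> r \<longrightarrow>
    A / 2 ^ l \<le> 1 - r \<longrightarrow> 1 - r \<le> B / 2 ^ l \<longrightarrow> 0 \<le> x \<longrightarrow> x < 1 \<longrightarrow>
    peetre f a r x \<le> ennreal (K * peak f a R (l + M) x)"
proof -
  from norm_le_peak_deeper[OF a A B] obtain M K where K: "K > 0" and
    le: "\<And>(f :: complex \<Rightarrow> 'a) l x w. analytic_disc f \<Longrightarrow> A / 2 ^ l \<le> 1 - cmod w \<Longrightarrow> 1 - cmod w \<le> B / 2 ^ l \<Longrightarrow>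
    norm (f w) \<le> K * (1 + 2 ^ l * cmod (w - zeta x)) powr a * peak f a R (l + M) x"
    by blast
  define D where "D = 1 + B + 2 * pi * B"
  have D: "D > 0" using B by (simp add: D_def add_pos_nonneg)
  show ?thesis
  proof (rule exI[of _ M], rule exI[of _ "K * D powr a"], intro conjI allI impI)
    show "0 < K * D powr a" using K D by simp
    fix f :: "complex \<Rightarrow> 'a" and l :: nat and x r :: real
    assume f: "analytic_disc f" and r: "0 \<le> r" "A / 2 ^ l \<le> 1 - r" "1 - r \<le> B / 2 ^ l" and x: "0 \<le> x" "x < 1"
    have "0 < A / 2 ^ l" using A by simp
    then have r1: "r < 1" using r by linarith
    show "peetre f a r x \<le> ennreal (K * D powr a * peak f a R (l + M) x)"
      unfolding peetre_def
    proof (intro SUP_least ennreal_leI)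
      fix y :: real assume "y \<in> {0..<1}"
      then have y: "0 \<le> y" "y < 1" by auto
      let ?w = "complex_of_real r * zeta y" and ?t = "tdist x y"
      have nw: "cmod ?w = r" using r by (simp add: norm_mult)
      have t0: "0 \<le> ?t" by (rule norm_zeta_diff_le_tdist(2)[OF x y])
      have "cmod (?w - zeta x) \<le> (1 - r) + 2 * pi * ?t"
      proof -
        have "?w - zeta x = - (complex_of_real (1 - r) * zeta y) + (zeta y - zeta x)" by (simp add: algebra_simps)
        then have "cmod (?w - zeta x) \<le> cmod (- (complex_of_real (1 - r) * zeta y)) + cmod (zeta y - zeta x)"
          by (metis norm_triangle_ineq)
        also have "cmod (- (complex_of_real (1 - r) * zeta y)) = 1 - r"
          using r1 by (simp only: norm_minus_cancel norm_mult norm_zeta norm_of_real) simp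
        finally show ?thesis using norm_zeta_diff_le_tdist(1)[OF x y] by linarith
      qed
      then have "2 ^ l * cmod (?w - zeta x) \<le> 2 ^ l * ((1 - r) + 2 * pi * ?t)" by (intro mult_left_mono) auto
      also have "\<dots> = 2 ^ l * (1 - r) + 2 * pi * ?t * 2 ^ l" by (simp add: algebra_simps)
      also have "\<dots> \<le> B + 2 * pi * ?t * (B / (1 - r))"
        using r(3) r1 t0 by (intro add_mono mult_left_mono) (auto simp: field_simps)
      finally have "1 + 2 ^ l * cmod (?w - zeta x) \<le> (1 + B) + 2 * pi * B * (?t / (1 - r))" by (simp add: mult_ac)
      also have "\<dots> \<le> D * (1 + ?t / (1 - r))"
      proof -
        have T: "0 \<le> ?t / (1 - r)" using t0 r1 by simp
        have "D * (1 + u) = (1 + B) + 2 * pi * B * u + (2 * pi * B + (1 + B) * u)" for u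
          by (simp add: D_def algebra_simps)
        from this[of "?t / (1 - r)"]
        have "D * (1 + ?t / (1 - r)) = (1 + B) + 2 * pi * B * (?t / (1 - r)) + (2 * pi * B + (1 + B) * (?t / (1 - r)))" .
        moreover have "0 \<le> 2 * pi * B + (1 + B) * (?t / (1 - r))" using B T by (intro add_nonneg_nonneg mult_nonneg_nonneg) auto
        ultimately show ?thesis by linarith
      qed
      finally have "(1 + 2 ^ l * cmod (?w - zeta x)) powr a \<le> (D * (1 + ?t / (1 - r))) powr a"
        using a by (intro powr_mono2) auto
      also have "\<dots> = D powr a * (1 + ?t / (1 - r)) powr a" by (rule powr_mult)
      finally have s: "(1 + 2 ^ l * cmod (?w - zeta x)) powr a \<le> D powr a * (1 + ?t / (1 - r)) powr a" .
      have "norm (f ?w) \<le> K * (1 + 2 ^ l * cmod (?w - zeta x)) powr a * peak f a R (l + M) x"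
        by (rule le[OF f]) (use r nw in auto)
      also have "\<dots> \<le> K * (D powr a * (1 + ?t / (1 - r)) powr a) * peak f a R (l + M) x"
        using s K peak_nonneg[OF f] by (intro mult_right_mono mult_left_mono) auto
      finally have "norm (f ?w) \<le> (K * D powr a * peak f a R (l + M) x) * (1 + ?t / (1 - r)) powr a" by (simp add: mult_ac)
      moreover have "0 < (1 + ?t / (1 - r)) powr a"
      proof -
        have "0 \<le> ?t / (1 - r)" using t0 r1 by simp
        then show ?thesis by (subst powr_gt_zero) linarith
      qed
      ultimately show "norm (f ?w) * (1 + ?t / (1 - r)) powr (- a) \<le> K * D powr a * peak f a R (l + M) x"
        by (simp only: powr_minus_divide) (simp add: pos_divide_le_eq)
    qed
  qed
qed

text \<open>The circles of \<open>norm4\<close> and those of the bracket come from two unrelated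
  sequences; only the common order \<open>1 / 2 ^ l\<close> of their distances to the unit circle
  links them.\<close>

lemma norm4_bracket_le:
  assumes a: "a > 0" and q: "q > 0" and c: "c > 0" "C > 0"
    and rs: "\<And>l. 0 \<le> rs l" "\<And>l. c / 2 ^ l \<le> 1 - rs l" "\<And>l. 1 - rs l \<le> C / 2 ^ l"
  shows "\<exists>K>0. \<forall>(f :: complex \<Rightarrow> 'a::complex_banach) x j. analytic_disc f \<longrightarrow> 0 \<le> x \<longrightarrow> x < 1 \<longrightarrow>
    (\<Sum>l. if j \<le> l then ennreal (2 powr (s * real l * q)) * epow (peetre f a (rs l) x) q else 0)
      \<le> ennreal K * peak_bracket s q a R f x j"
proof -
  obtain M K where K: "K > 0" and le: "\<And>(f :: complex \<Rightarrow> 'a) l x r. analytic_disc f \<Longrightarrow> 0 \<le> r \<Longrightarrow>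
    c / 2 ^ l \<le> 1 - r \<Longrightarrow> 1 - r \<le> C / 2 ^ l \<Longrightarrow> 0 \<le> x \<Longrightarrow> x < 1 \<Longrightarrow> peetre f a r x \<le> ennreal (K * peak f a R (l + M) x)"
    using peetre_le_peak[OF a c] by blast
  show ?thesis
  proof (intro exI[of _ "K powr q * 2 powr (\<bar>s\<bar> * real M * q)"] conjI allI impI)
    show "0 < K powr q * 2 powr (\<bar>s\<bar> * real M * q)" using K by simp
    fix f :: "complex \<Rightarrow> 'a" and x :: real and j :: nat
    assume f: "analytic_disc f" and x: "0 \<le> x" "x < 1"
    have "(\<Sum>l. if j \<le> l then ennreal (2 powr (s * real l * q)) * epow (peetre f a (rs l) x) q else 0)
      = (\<Sum>L. ennreal (2 powr (s * real (j + L) * q)) * epow (peetre f a (rs (j + L)) x) q)"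
      by (rule suminf_from)
    also have "\<dots> \<le> (\<Sum>L. ennreal (K powr q * (2 powr (s * real (j + L) * q) * peak f a R (j + L + M) x powr q)))"
    proof (rule suminf_le)
      fix L
      have "epow (peetre f a (rs (j + L)) x) q \<le> epow (ennreal (K * peak f a R (j + L + M) x)) q"
        using q by (intro epow_mono le[OF f] rs x) auto
      also have "\<dots> = ennreal (K powr q * peak f a R (j + L + M) x powr q)"
        using K peak_nonneg[OF f] by (subst epow_ennreal) (auto simp: powr_mult)
      finally have "ennreal (2 powr (s * real (j + L) * q)) * epow (peetre f a (rs (j + L)) x) q
        \<le> ennreal (2 powr (s * real (j + L) * q)) * ennreal (K powr q * peak f a R (j + L + M) x powr q)"
        by (rule mult_left_mono) simp
      also have "\<dots> = ennreal (K powr q * (2 powr (s * real (j + L) * q) * peak f a R (j + L + M) x powr q))"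
        by (simp add: ennreal_mult[symmetric] mult_ac)
      finally show "ennreal (2 powr (s * real (j + L) * q)) * epow (peetre f a (rs (j + L)) x) q
        \<le> ennreal (K powr q * (2 powr (s * real (j + L) * q) * peak f a R (j + L + M) x powr q))" .
    qed auto
    also have "\<dots> \<le> ennreal (K powr q * 2 powr (\<bar>s\<bar> * real M * q)) * peak_bracket s q a R f x j"
      by (rule suminf_peak_shift_le) (use q in auto)
    finally show "(\<Sum>l. if j \<le> l then ennreal (2 powr (s * real l * q)) * epow (peetre f a (rs l) x) q else 0)
      \<le> ennreal (K powr q * 2 powr (\<bar>s\<bar> * real M * q)) * peak_bracket s q a R f x j" .
  qed
qed

text \<open>On the slice where \<open>1 - r\<close> is about \<open>1 / 2 ^ l\<close> the weight has
  size \<open>2 powr ((1 + s * q) * real l)\<close> and the length of the slice is of order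
  \<open>1 / 2 ^ l\<close>; their product is the coefficient of level \<open>l\<close>.\<close>

lemma norm5_bracket_le:
  assumes a: "a > 0" and q: "q > 0"
  shows "\<exists>K>0. \<forall>(f :: complex \<Rightarrow> 'a::complex_banach) x j. analytic_disc f \<longrightarrow> 0 \<le> x \<longrightarrow> x < 1 \<longrightarrow>
    (\<integral>\<^sup>+ r. ennreal ((1 - r) powr (- 1 - s * q)) * epow (peetre f a r x) q * indicator {1 - 2 powr (- real j) ..< 1} r \<partial>lborel)
      \<le> ennreal K * peak_bracket s q a R f x j"
proof -
  have "(1 / 2 :: real) > 0" "(1::real) > 0" by auto
  from peetre_le_peak[OF a this] obtain M K where K: "K > 0" and le: "\<And>(f :: complex \<Rightarrow> 'a) l x r. analytic_disc f \<Longrightarrow> 0 \<le> r \<Longrightarrow>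
    1 / 2 / 2 ^ l \<le> 1 - r \<Longrightarrow> 1 - r \<le> 1 / 2 ^ l \<Longrightarrow> 0 \<le> x \<Longrightarrow> x < 1 \<Longrightarrow> peetre f a r x \<le> ennreal (K * peak f a R (l + M) x)"
    by blast
  define e where "e = - 1 - s * q"
  define c where "c = 2 powr \<bar>e\<bar> * K powr q"
  show ?thesis
  proof (intro exI[of _ "c * 2 powr (\<bar>s\<bar> * real M * q)"] conjI allI impI)
    show "0 < c * 2 powr (\<bar>s\<bar> * real M * q)" unfolding c_def using K by simp
    fix f :: "complex \<Rightarrow> 'a" and x :: real and j :: nat
    assume f: "analytic_disc f" and x: "0 \<le> x" "x < 1"
    define S where "S = (\<lambda>L. {1 - 1 / 2 ^ (j + L) ..< 1 - 1 / 2 ^ (j + L + 1)} :: real set)"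
    define d where "d = (\<lambda>L. 2 powr \<bar>e\<bar> * 2 powr (- e * real (j + L)) * (K powr q * peak f a R (j + L + M) x powr q))"
    have "(\<integral>\<^sup>+ r. ennreal ((1 - r) powr (- 1 - s * q)) * epow (peetre f a r x) q * indicator {1 - 2 powr (- real j) ..< 1} r \<partial>lborel)
      \<le> (\<integral>\<^sup>+ r. (\<Sum>L. ennreal (d L) * indicator (S L) r) \<partial>lborel)"
    proof (rule nn_integral_mono)
      fix r :: real
      show "ennreal ((1 - r) powr (- 1 - s * q)) * epow (peetre f a r x) q * indicator {1 - 2 powr (- real j) ..< 1} r
        \<le> (\<Sum>L. ennreal (d L) * indicator (S L) r)"
      proof (cases "r \<in> {1 - 2 powr (- real j) ..< 1}")
        case True
        then have t: "0 < 1 - r" "1 - r \<le> 1 / 2 ^ j" by (auto simp: powr_minus_divide powr_realpow)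
        then obtain L where L: "1 / 2 ^ (j + L + 1) < 1 - r" "1 - r \<le> 1 / 2 ^ (j + L)"
          using slice_exists by blast
        have "1 / 2 ^ j \<le> (1::real)" by simp
        then have r0: "0 \<le> r" using t(2) by linarith
        have "epow (peetre f a r x) q \<le> epow (ennreal (K * peak f a R (j + L + M) x)) q"
          using q L r0 by (intro epow_mono le[OF f] x) auto
        also have "\<dots> = ennreal (K powr q * peak f a R (j + L + M) x powr q)"
          using K peak_nonneg[OF f] by (subst epow_ennreal) (auto simp: powr_mult)
        finally have "ennreal ((1 - r) powr e) * epow (peetre f a r x) q
          \<le> ennreal (2 powr \<bar>e\<bar> * 2 powr (- e * real (j + L))) * ennreal (K powr q * peak f a R (j + L + M) x powr q)"
          using powr_slice(2)[of "j + L" "1 - r" e] L by (intro mult_mono ennreal_leI) auto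
        also have "\<dots> = ennreal (d L)" unfolding d_def by (subst ennreal_mult) auto
        also have "\<dots> = ennreal (d L) * indicator (S L) r" using L by (simp add: S_def)
        also have "\<dots> \<le> (\<Sum>L. ennreal (d L) * indicator (S L) r)" by (rule term_le_suminf)
        finally show ?thesis using True unfolding e_def by simp
      qed simp
    qed
    also have "\<dots> = (\<Sum>L. \<integral>\<^sup>+ r. ennreal (d L) * indicator (S L) r \<partial>lborel)"
      by (rule nn_integral_suminf) (simp add: S_def)
    also have "\<dots> \<le> (\<Sum>L. ennreal (c * (2 powr (s * real (j + L) * q) * peak f a R (j + L + M) x powr q)))"
    proof (rule suminf_le)
      fix L
      have "(\<integral>\<^sup>+ r. ennreal (d L) * indicator (S L) r \<partial>lborel) = ennreal (d L) * emeasure lborel (S L)"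
        by (rule nn_integral_cmult_indicator) (simp add: S_def)
      also have "emeasure lborel (S L) \<le> ennreal (2 powr (- real (j + L)))"
      proof -
        define h where "h = 1 / (2 :: real) ^ (j + L)"
        have h: "0 < h" "2 powr (- real (j + L)) = h" "S L = {1 - h..<1 - h / 2}"
          unfolding h_def S_def by (simp_all add: powr_minus_divide powr_realpow mult.commute del: of_nat_add)
        then show ?thesis unfolding h(2,3) by (simp add: ennreal_leI)
      qed
      finally have "(\<integral>\<^sup>+ r. ennreal (d L) * indicator (S L) r \<partial>lborel) \<le> ennreal (d L) * ennreal (2 powr (- real (j + L)))"
        by (simp add: mult_left_mono)
      also have "\<dots> = ennreal (c * (2 powr (s * real (j + L) * q) * peak f a R (j + L + M) x powr q))"
      proof -
        have "2 powr (- e * real (j + L)) * 2 powr (- real (j + L)) = 2 powr (s * real (j + L) * q)"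
          unfolding powr_add[symmetric] e_def by (simp add: algebra_simps)
        moreover have "d L * 2 powr (- real (j + L)) = c * ((2 powr (- e * real (j + L)) * 2 powr (- real (j + L))) * peak f a R (j + L + M) x powr q)"
          unfolding d_def c_def by (simp only: mult_ac)
        ultimately have "d L * 2 powr (- real (j + L)) = c * (2 powr (s * real (j + L) * q) * peak f a R (j + L + M) x powr q)"
          by simp
        moreover have "0 \<le> d L" unfolding d_def by simp
        ultimately show ?thesis by (simp only: ennreal_mult[symmetric] powr_ge_zero)
      qed
      finally show "(\<integral>\<^sup>+ r. ennreal (d L) * indicator (S L) r \<partial>lborel)
        \<le> ennreal (c * (2 powr (s * real (j + L) * q) * peak f a R (j + L + M) x powr q))" .
    qed auto
    also have "\<dots> \<le> ennreal (c * 2 powr (\<bar>s\<bar> * real M * q)) * peak_bracket s q a R f x j"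
      by (rule suminf_peak_shift_le) (use q in \<open>auto simp: c_def\<close>)
    finally show "(\<integral>\<^sup>+ r. ennreal ((1 - r) powr (- 1 - s * q)) * epow (peetre f a r x) q * indicator {1 - 2 powr (- real j) ..< 1} r \<partial>lborel)
      \<le> ennreal (c * 2 powr (\<bar>s\<bar> * real M * q)) * peak_bracket s q a R f x j" .
  qed
qed

text \<open>The part of the Stolz angle where \<open>1 - cmod w\<close> is about
  \<open>1 / 2 ^ l\<close> lies in the disc of radius \<open>3 / 2 ^ l\<close> about
  \<open>zeta x\<close>. There the weight of \<open>norm_le_peak_deeper\<close> is at most
  \<open>4 powr a\<close>, and the area, of order \<open>2 powr (- 2 * real l)\<close>, matches the
  exponent \<open>- 2 - s * q\<close>.\<close>

lemma norm1_bracket_le: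
  assumes a: "a > 0" and q: "q > 0"
  shows "\<exists>K>0. \<forall>(f :: complex \<Rightarrow> 'a::complex_banach) x j. analytic_disc f \<longrightarrow>
    (\<integral>\<^sup>+ w. ennreal ((1 - norm w) powr (- 2 - s * q) * norm (f w) powr q)
             * indicator (stolz_trunc (2 powr (- real j)) (zeta x)) w \<partial>lborel)
      \<le> ennreal K * peak_bracket s q a R f x j"
proof -
  have "(1 / 2 :: real) > 0" "(1::real) > 0" by auto
  from norm_le_peak_deeper[OF a this] obtain M K where K: "K > 0" and
    le: "\<And>(f :: complex \<Rightarrow> 'a) l x w. analytic_disc f \<Longrightarrow> 1 / 2 / 2 ^ l \<le> 1 - cmod w \<Longrightarrow> 1 - cmod w \<le> 1 / 2 ^ l \<Longrightarrow>
    norm (f w) \<le> K * (1 + 2 ^ l * cmod (w - zeta x)) powr a * peak f a R (l + M) x"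
    by blast
  define e where "e = - 2 - s * q"
  define V where "V = unit_ball_vol (real DIM(complex))"
  have V: "V > 0" unfolding V_def by (rule unit_ball_vol_pos) simp
  define c where "c = 2 powr \<bar>e\<bar> * (K * 4 powr a) powr q * (V * 9)"
  show ?thesis
  proof (intro exI[of _ "c * 2 powr (\<bar>s\<bar> * real M * q)"] conjI allI impI)
    show "0 < c * 2 powr (\<bar>s\<bar> * real M * q)" unfolding c_def using K V by simp
    fix f :: "complex \<Rightarrow> 'a" and x :: real and j :: nat
    assume f: "analytic_disc f"
    define S where "S = (\<lambda>L. cball (zeta x) (3 / 2 ^ (j + L)))"
    define d where "d = (\<lambda>L. 2 powr \<bar>e\<bar> * 2 powr (- e * real (j + L)) * ((K * 4 powr a) powr q * peak f a R (j + L + M) x powr q))"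
    have d0: "0 \<le> d L" for L unfolding d_def by simp
    have [measurable]: "S L \<in> sets borel" for L by (simp add: S_def)
    have "(\<integral>\<^sup>+ w. ennreal ((1 - norm w) powr (- 2 - s * q) * norm (f w) powr q)
             * indicator (stolz_trunc (2 powr (- real j)) (zeta x)) w \<partial>lborel)
      \<le> (\<integral>\<^sup>+ w. (\<Sum>L. ennreal (d L) * indicator (S L) w) \<partial>lborel)"
    proof (rule nn_integral_mono)
      fix w :: complex
      show "ennreal ((1 - norm w) powr (- 2 - s * q) * norm (f w) powr q) * indicator (stolz_trunc (2 powr (- real j)) (zeta x)) w
        \<le> (\<Sum>L. ennreal (d L) * indicator (S L) w)"
      \<comment> \<open>At a point with \<open>cmod w = 1\<close>, such as the vertex, the integrand
        vanishes because \<open>0 powr e = 0\<close>, so such points fall into the trivial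
        case.\<close>
      proof (cases "w \<in> stolz_trunc (2 powr (- real j)) (zeta x) \<and> cmod w \<noteq> 1")
        case True
        then have w: "w \<in> stolz (zeta x)" "1 - cmod w \<le> 1 / 2 ^ j"
          by (auto simp: stolz_trunc_def powr_minus_divide powr_realpow)
        have st: "cmod (w - zeta x) \<le> 3 * (1 - cmod w)" by (rule norm_stolz_le[OF w(1)]) simp
        have "0 \<le> 3 * (1 - cmod w)" using order_trans[OF norm_ge_zero st] .
        then have t: "0 < 1 - cmod w" using True by simp
        then obtain L where L: "1 / 2 ^ (j + L + 1) < 1 - cmod w" "1 - cmod w \<le> 1 / 2 ^ (j + L)"
          using slice_exists[OF _ w(2)] by blast
        have near: "cmod (w - zeta x) \<le> 3 / 2 ^ (j + L)" using st L(2) by simp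
        have "(1 + 2 ^ (j + L) * cmod (w - zeta x)) powr a \<le> 4 powr a"
          using near a by (intro powr_mono2) (auto simp: field_simps)
        then have "K * (1 + 2 ^ (j + L) * cmod (w - zeta x)) powr a * peak f a R (j + L + M) x \<le> K * 4 powr a * peak f a R (j + L + M) x"
          using K peak_nonneg[OF f] by (intro mult_right_mono mult_left_mono) auto
        then have "norm (f w) \<le> K * 4 powr a * peak f a R (j + L + M) x"
          using le[OF f, of "j + L" w x] L by simp
        then have "norm (f w) powr q \<le> (K * 4 powr a * peak f a R (j + L + M) x) powr q"
          using q by (intro powr_mono2) auto
        also have "\<dots> = (K * 4 powr a) powr q * peak f a R (j + L + M) x powr q" by (rule powr_mult)
        finally have "(1 - norm w) powr e * norm (f w) powr q \<le> d L"
          unfolding d_def using powr_slice(2)[of "j + L" "1 - cmod w" e] L by (intro mult_mono) auto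
        then have "ennreal ((1 - norm w) powr e * norm (f w) powr q) \<le> ennreal (d L) * indicator (S L) w"
          using near by (simp add: S_def dist_norm norm_minus_commute ennreal_leI)
        also have "\<dots> \<le> (\<Sum>L. ennreal (d L) * indicator (S L) w)" by (rule term_le_suminf)
        finally show ?thesis using True unfolding e_def by simp
      next
        case False
        then show ?thesis by (auto simp: indicator_def)
      qed
    qed
    also have "\<dots> = (\<Sum>L. \<integral>\<^sup>+ w. ennreal (d L) * indicator (S L) w \<partial>lborel)"
      by (rule nn_integral_suminf) measurable
    also have "\<dots> \<le> (\<Sum>L. ennreal (c * (2 powr (s * real (j + L) * q) * peak f a R (j + L + M) x powr q)))"
    proof (rule suminf_le)
      fix L
      have "(\<integral>\<^sup>+ w. ennreal (d L) * indicator (S L) w \<partial>lborel) = ennreal (d L) * emeasure lborel (S L)"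
        by (rule nn_integral_cmult_indicator) (simp add: S_def)
      also have "emeasure lborel (S L) = ennreal (V * 9 * 2 powr (- 2 * real (j + L)))"
      proof -
        have "(2::real) powr (- 2 * real (j + L)) = (1 / 2 ^ (j + L))\<^sup>2"
        proof -
          have "(2::real) powr (- 2 * real (j + L)) = (2 powr (- real (j + L))) powr 2" by (simp add: powr_powr mult.commute del: of_nat_add)
          also have "\<dots> = (1 / 2 ^ (j + L)) powr 2" by (simp only: powr_minus_divide powr_realpow[of 2, simplified])
          finally show ?thesis by simp
        qed
        then show ?thesis unfolding S_def V_def by (subst emeasure_cball) (simp_all add: power_divide)
      qed
      also have "ennreal (d L) * \<dots> = ennreal (c * (2 powr (s * real (j + L) * q) * peak f a R (j + L + M) x powr q))"
      proof -
        have e2: "2 powr (- e * real (j + L)) * 2 powr (- 2 * real (j + L)) = 2 powr (s * real (j + L) * q)"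
          unfolding powr_add[symmetric] e_def by (simp add: algebra_simps)
        have "d L * (V * 9 * 2 powr (- 2 * real (j + L))) = c * ((2 powr (- e * real (j + L)) * 2 powr (- 2 * real (j + L))) * peak f a R (j + L + M) x powr q)"
          unfolding d_def c_def by (simp only: mult_ac)
        then show ?thesis unfolding e2 using d0[of L] V by (subst ennreal_mult[symmetric]) auto
      qed
      finally show "(\<integral>\<^sup>+ w. ennreal (d L) * indicator (S L) w \<partial>lborel)
        \<le> ennreal (c * (2 powr (s * real (j + L) * q) * peak f a R (j + L + M) x powr q))" by simp
    qed auto
    also have "\<dots> \<le> ennreal (c * 2 powr (\<bar>s\<bar> * real M * q)) * peak_bracket s q a R f x j"
      by (rule suminf_peak_shift_le) (use q V in \<open>auto simp: c_def\<close>)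
    finally show "(\<integral>\<^sup>+ w. ennreal ((1 - norm w) powr (- 2 - s * q) * norm (f w) powr q)
             * indicator (stolz_trunc (2 powr (- real j)) (zeta x)) w \<partial>lborel)
      \<le> ennreal (c * 2 powr (\<bar>s\<bar> * real M * q)) * peak_bracket s q a R f x j" .
  qed
qed

end

section \<open>Lower bounds\<close>

text \<open>Rank 0 has a single arc, the whole circle, with factor 1; this instance feeds the growth
  estimates.\<close>

lemma dyadic_norm_finiteD:
  assumes "p > 0" "dyadic_norm p q \<tau> G < \<infinity>"
  shows "(\<integral>\<^sup>+ x. epow (G x 0) (p / q) * indicator {0..<1} x \<partial>lborel) < \<infinity>"
proof -
  let ?I = "\<integral>\<^sup>+ x. epow (G x 0) (p / q) * indicator (dyadic 0 0) x \<partial>lborel"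
  have "ennreal (2 powr (real 0 * \<tau>)) * epow ?I (1 / p) \<le> dyadic_norm p q \<tau> G"
    unfolding dyadic_norm_def by (rule SUP_upper2[of 0], simp, rule SUP_upper2[of 0]) simp_all
  then have "epow ?I (1 / p) < \<infinity>" using assms(2) by simp
  then have "?I \<noteq> \<infinity>" by (auto simp: epow_def)
  moreover have "dyadic 0 0 = {0..<1}" by (auto simp: dyadic_def)
  ultimately show ?thesis by (simp add: less_top)
qed

lemma sum_disjoint_indicator_le:
  fixes c :: "nat \<Rightarrow> ennreal"
  assumes "\<And>L. r \<in> T L \<Longrightarrow> c L \<le> F" "\<And>L L'. r \<in> T L \<Longrightarrow> r \<in> T L' \<Longrightarrow> L = L'"
  shows "(\<Sum>L<n. c L * indicator (T L) r) \<le> F"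
proof (cases "\<exists>L<n. r \<in> T L")
  case True
  then obtain L where L: "L < n" "r \<in> T L" by blast
  have "(\<Sum>i<n. c i * indicator (T i) r) = (\<Sum>i<n. if i = L then c L else 0)"
    using L assms(2) by (intro sum.cong) (auto simp: indicator_def)
  then show ?thesis using L assms(1) by simp
qed (simp add: indicator_def)

lemma powr_le_one_plus:
  fixes z e :: real
  assumes "0 \<le> z" "0 \<le> e" "e \<le> 1"
  shows "z powr e \<le> 1 + z"
proof (cases "z \<le> 1")
  case True
  then have "z powr e \<le> 1" using assms by (intro powr_le1) auto
  then show ?thesis using assms by simp
next
  case False
  then have "z powr e \<le> z powr 1" using assms by (intro powr_mono) auto
  then show ?thesis using assms by simp
qed

context radii
begin

text \<open>A circle outside that of radius \<open>R l\<close>, with a gap of order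
  \<open>1 / 2 ^ l\<close>, controls the whole inner disc by the circle mean inequality. The gap
  costs a factor \<open>2 ^ l\<close>, hence \<open>\<gamma> + 1\<close>, and the root of order
  \<open>t\<close> divides the exponent.\<close>

lemma poly_growth_of_circle_means:
  fixes f :: "complex \<Rightarrow> 'a::complex_banach"
  assumes f: "analytic_disc f" and t: "t > 0" and d: "d > 0" and V: "V \<ge> 0"
    and means: "\<And>l. \<exists>\<rho>. R l + d / 2 ^ l \<le> \<rho> \<and> \<rho> < 1 \<and>
      (\<integral>\<^sup>+ x. ennreal (norm (f (complex_of_real \<rho> * zeta x)) powr t) * indicator {0..<1} x \<partial>lborel) \<le> ennreal (V * 2 powr (\<gamma> * real l))"
  shows "poly_growth f R ((\<gamma> + 1) / t)"
  unfolding poly_growth_def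
proof (intro exI[of _ "(2 powr t / d * V) powr (1 / t)"] conjI allI impI)
  fix l v assume v: "cmod v \<le> R l"
  obtain \<rho> where \<rho>: "R l + d / 2 ^ l \<le> \<rho>" "\<rho> < 1" and
    m: "(\<integral>\<^sup>+ x. ennreal (norm (f (complex_of_real \<rho> * zeta x)) powr t) * indicator {0..<1} x \<partial>lborel) \<le> ennreal (V * 2 powr (\<gamma> * real l))"
    using means by blast
  have dl: "d / 2 ^ l > 0" using d by simp
  have \<rho>v: "d / 2 ^ l \<le> \<rho> - cmod v" using v \<rho> by linarith
  have "ennreal (norm (f v) powr t) \<le> ennreal (2 powr t * \<rho> / (\<rho> - cmod (v - 0))) *
    (\<integral>\<^sup>+ x. ennreal (norm (f (0 + complex_of_real \<rho> * zeta x)) powr t) * indicator {0..<1} x \<partial>lborel)"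
    by (rule circle_mean_nn[OF f _ _ t]) (use \<rho>(2) \<rho>v dl in \<open>auto simp: subset_iff\<close>)
  also have "\<dots> \<le> ennreal (2 powr t / d * 2 ^ l) * ennreal (V * 2 powr (\<gamma> * real l))"
  proof (intro mult_mono ennreal_leI)
    have "\<rho> / (\<rho> - cmod v) \<le> 1 / (d / 2 ^ l)" using \<rho>v dl \<rho>(2) by (intro frac_le) auto
    then have "2 powr t * (\<rho> / (\<rho> - cmod v)) \<le> 2 powr t * (1 / (d / 2 ^ l))" by (intro mult_left_mono) auto
    then show "2 powr t * \<rho> / (\<rho> - cmod (v - 0)) \<le> 2 powr t / d * 2 ^ l" by simp
  qed (use m in auto)
  also have "\<dots> = ennreal (2 powr t / d * V * 2 powr ((\<gamma> + 1) * real l))"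
  proof -
    have "2 powr ((\<gamma> + 1) * real l) = 2 powr (\<gamma> * real l) * 2 ^ l"
      by (simp add: distrib_right powr_add powr_realpow)
    then show ?thesis using d V by (subst ennreal_mult[symmetric]) (auto simp: mult_ac)
  qed
  finally have "norm (f v) powr t \<le> 2 powr t / d * V * 2 powr ((\<gamma> + 1) * real l)"
    using d V by (subst (asm) ennreal_le_iff) auto
  then have "(norm (f v) powr t) powr (1 / t) \<le> (2 powr t / d * V * 2 powr ((\<gamma> + 1) * real l)) powr (1 / t)"
    using t by (intro powr_mono2) auto
  moreover have "(A * 2 powr ((\<gamma> + 1) * real l)) powr (1 / t) = A powr (1 / t) * 2 powr ((\<gamma> + 1) / t * real l)" for A
    by (simp add: powr_mult powr_powr)
  moreover have "(norm (f v) powr t) powr (1 / t) = norm (f v)" using t by (simp add: powr_powr)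
  ultimately show "norm (f v) \<le> (2 powr t / d * V) powr (1 / t) * 2 powr ((\<gamma> + 1) / t * real l)"
    by (simp only:)
qed simp

text \<open>The radial infimum is at most the value on the circle of radius \<open>R l\<close>,
  which occurs in the bracket. For the growth, a single term of the series at rank 0 already gives
  the \<open>p\<close>-th mean over one circle.\<close>

lemma peak_norm_le_norm3:
  assumes p: "p > 0" and q: "q > 0" and a: "a > max (1 / p) (1 / q)"
  shows "\<exists>K>0. \<forall>f :: complex \<Rightarrow> 'a::complex_banach. analytic_disc f \<longrightarrow>
    dyadic_norm p q \<tau> (peak_bracket s q a R f) \<le> ennreal K * norm3 R p q s \<tau> f"
  unfolding norm3_def
proof (rule peak_bracket_le_sampled[OF p q a])
  let ?B = "\<lambda>(f :: complex \<Rightarrow> 'a) x j. (\<Sum>l. if j \<le> l then ennreal (2 powr (s * real l * q) * norm (f (complex_of_real (R l) * zeta x)) powr q) else 0)"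
  have Bsum: "?B f x j = (\<Sum>L. ennreal (2 powr (s * real (j + L) * q) * norm (f (complex_of_real (R (j + L)) * zeta x)) powr q))" for f x j
    by (rule suminf_from)
  show "(\<bar>s\<bar> * p + 1) / p \<ge> 0" "(1::real) > 0" using p by auto
  show "\<exists>\<kappa>>0. \<forall>f x j N. analytic_disc f \<longrightarrow> 0 \<le> x \<longrightarrow> x < 1 \<longrightarrow>
      ennreal (\<kappa> * (\<Sum>L\<le>N. 2 powr (s * real (j + L) * q) *
        (INF r\<in>{R (j + L)..R (j + L) + \<delta> / 2 ^ (j + L)}. norm (f (complex_of_real r * zeta x))) powr q)) \<le> ?B f x j"
    if \<delta>: "0 < \<delta>" "\<delta> \<le> 1" for \<delta>
  proof (intro exI[of _ 1] conjI allI impI)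
    fix f :: "complex \<Rightarrow> 'a" and x :: real and j N :: nat
    assume f: "analytic_disc f"
    let ?INF = "\<lambda>l. (INF r\<in>{R l..R l + \<delta> / 2 ^ l}. norm (f (complex_of_real r * zeta x)))"
    have le: "0 \<le> ?INF l" "?INF l \<le> norm (f (complex_of_real (R l) * zeta x))" for l
      using \<delta> by (auto intro!: cINF_greatest cINF_lower bdd_belowI2[where m=0])
    have "ennreal (1 * (\<Sum>L\<le>N. 2 powr (s * real (j + L) * q) * ?INF (j + L) powr q))
      \<le> ennreal (\<Sum>L\<le>N. 2 powr (s * real (j + L) * q) * norm (f (complex_of_real (R (j + L)) * zeta x)) powr q)"
      unfolding mult_1 using q le by (intro ennreal_leI sum_mono mult_left_mono powr_mono2) auto
    also have "\<dots> = (\<Sum>L\<le>N. ennreal (2 powr (s * real (j + L) * q) * norm (f (complex_of_real (R (j + L)) * zeta x)) powr q))"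
      by (rule sum_ennreal[symmetric]) simp
    also have "\<dots> \<le> ?B f x j" unfolding Bsum by (rule sum_le_suminf) auto
    finally show "ennreal (1 * (\<Sum>L\<le>N. 2 powr (s * real (j + L) * q) * ?INF (j + L) powr q)) \<le> ?B f x j" .
  qed simp
  show "poly_growth f R ((\<bar>s\<bar> * p + 1) / p)" if f: "analytic_disc f" and fin: "dyadic_norm p q \<tau> (?B f) < \<infinity>" for f
  proof -
    define V0 where "V0 = (\<integral>\<^sup>+ x. epow (?B f x 0) (p / q) * indicator {0..<1} x \<partial>lborel)"
    have V0: "V0 < \<infinity>" unfolding V0_def by (rule dyadic_norm_finiteD[OF p fin])
    \<comment> \<open>Being \<open>M\<close> levels deeper moves a circle outwards by at least
      \<open>c0 / 2 / 2 ^ l\<close>.\<close>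
    obtain M where M: "C0 / (c0 / 2) < 2 ^ M" using real_arch_pow[of 2 "C0 / (c0 / 2)"] by auto
    show ?thesis
    proof (rule poly_growth_of_circle_means[OF f p])
      show "c0 / 2 > 0" using c0 by simp
      let ?V = "2 powr (\<bar>s\<bar> * p * real M) * enn2real V0"
      show "?V \<ge> 0" by simp
      fix l
      let ?h = "\<lambda>x. norm (f (complex_of_real (R (l + M)) * zeta x))"
      show "\<exists>\<rho>. R l + c0 / 2 / 2 ^ l \<le> \<rho> \<and> \<rho> < 1 \<and>
        (\<integral>\<^sup>+ x. ennreal (norm (f (complex_of_real \<rho> * zeta x)) powr p) * indicator {0..<1} x \<partial>lborel) \<le> ennreal (?V * 2 powr (\<bar>s\<bar> * p * real l))"
      proof (intro exI[of _ "R (l + M)"] conjI R)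
        have "1 - R (l + M) \<le> C0 / 2 ^ (l + M)" by (rule R_upper)
        also have "\<dots> \<le> c0 / 2 / 2 ^ l" using M c0 by (simp add: power_add field_simps)
        finally show "R l + c0 / 2 / 2 ^ l \<le> R (l + M)" using R_lower[of l] by simp
        have "(\<integral>\<^sup>+ x. ennreal (?h x powr p) * indicator {0..<1} x \<partial>lborel)
          \<le> (\<integral>\<^sup>+ x. ennreal (2 powr (\<bar>s\<bar> * p * real (l + M))) * (epow (?B f x 0) (p / q) * indicator {0..<1} x) \<partial>lborel)"
        proof (rule nn_integral_mono)
          fix x :: real
          have "ennreal (2 powr (s * real (l + M) * q) * ?h x powr q) \<le> ?B f x 0"
            unfolding Bsum using term_le_suminf[of "\<lambda>L. ennreal (2 powr (s * real (0 + L) * q) * norm (f (complex_of_real (R (0 + L)) * zeta x)) powr q)" "l + M"] by simp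
          then have "epow (ennreal (2 powr (s * real (l + M) * q) * ?h x powr q)) (p / q) \<le> epow (?B f x 0) (p / q)"
            using p q by (intro epow_mono) auto
          then have 1: "ennreal (2 powr (s * real (l + M) * p) * ?h x powr p) \<le> epow (?B f x 0) (p / q)"
            using p q by (subst (asm) epow_ennreal) (auto simp: powr_mult powr_powr mult.assoc simp del: of_nat_add)
          have "1 \<le> 2 powr (\<bar>s\<bar> * p * real (l + M)) * 2 powr (s * real (l + M) * p)"
          proof -
            have "- s * (real (l + M) * p) \<le> \<bar>s\<bar> * (real (l + M) * p)" using p by (intro mult_right_mono) auto
            then have "0 \<le> \<bar>s\<bar> * p * real (l + M) + s * real (l + M) * p" by (simp add: mult_ac del: of_nat_add)
            then show ?thesis unfolding powr_add[symmetric] by (intro ge_one_powr_ge_zero) auto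
          qed
          then have "1 * ?h x powr p \<le> (2 powr (\<bar>s\<bar> * p * real (l + M)) * 2 powr (s * real (l + M) * p)) * ?h x powr p"
            by (rule mult_right_mono) simp
          then have "ennreal (?h x powr p) \<le> ennreal (2 powr (\<bar>s\<bar> * p * real (l + M)) * (2 powr (s * real (l + M) * p) * ?h x powr p))"
            by (intro ennreal_leI) (simp only: mult_1 mult.assoc)
          also have "\<dots> = ennreal (2 powr (\<bar>s\<bar> * p * real (l + M))) * ennreal (2 powr (s * real (l + M) * p) * ?h x powr p)"
            by (rule ennreal_mult) auto
          also have "\<dots> \<le> ennreal (2 powr (\<bar>s\<bar> * p * real (l + M))) * epow (?B f x 0) (p / q)"
            by (rule mult_left_mono[OF 1]) simp
          finally show "ennreal (?h x powr p) * indicator {0..<1} x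
              \<le> ennreal (2 powr (\<bar>s\<bar> * p * real (l + M))) * (epow (?B f x 0) (p / q) * indicator {0..<1} x)"
            by (simp add: indicator_def)
        qed
        also have "\<dots> \<le> ennreal (2 powr (\<bar>s\<bar> * p * real (l + M))) * V0"
          unfolding V0_def by (rule nn_integral_cmult_le) simp
        also have "\<dots> = ennreal (?V * 2 powr (\<bar>s\<bar> * p * real l))"
        proof -
          have "V0 = ennreal (enn2real V0)" using V0 by simp
          moreover have "2 powr (\<bar>s\<bar> * p * real (l + M)) * enn2real V0 = ?V * 2 powr (\<bar>s\<bar> * p * real l)"
            by (simp add: powr_add distrib_left)
          ultimately show ?thesis by (metis ennreal_mult enn2real_nonneg powr_ge_zero)
        qed
        finally show "(\<integral>\<^sup>+ x. ennreal (?h x powr p) * indicator {0..<1} x \<partial>lborel) \<le> ennreal (?V * 2 powr (\<bar>s\<bar> * p * real l))" .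
      qed
    qed
  qed
qed

end

text \<open>The factor \<open>3 / 4\<close> puts the circle inside the slice
  \<open>1 / 2 ^ (l + 1) \<le> 1 - r \<le> 1 / 2 ^ l\<close>, with outward room
  \<open>1 / 4 / 2 ^ l\<close> for radial intervals and room on both sides for discs, so that those
  of different levels are disjoint.\<close>

definition std_radii :: "nat \<Rightarrow> real" where
  "std_radii l = 1 - 3 / 4 / 2 ^ l"

lemma std_radii: "radii std_radii (3 / 4) (3 / 4)"
proof
  fix l
  have "(1::real) \<le> 2 ^ l" by simp
  then have "3 \<le> 4 * (2::real) ^ l" by linarith
  then show "0 \<le> std_radii l" unfolding std_radii_def by simp
qed (simp_all add: std_radii_def)

interpretation std: radii std_radii "3 / 4" "3 / 4"
  by (rule std_radii)

text \<open>\<open>w = (1 - \<rho>) b + \<rho> z\<close> with \<open>cmod b \<le> 1 / 2\<close>.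
  Since the Stolz angle is a hull over a circle, \<open>b\<close> is first written as a point on a
  diameter of that circle.\<close>

lemma cball_subset_stolz:
  assumes z: "cmod z = 1" and \<rho>: "0 \<le> \<rho>" "\<rho> < 1" and w: "cmod (w - complex_of_real \<rho> * z) \<le> (1 - \<rho>) / 2"
  shows "w \<in> stolz z"
proof -
  define b where "b = (1 / (1 - \<rho>)) *\<^sub>R (w - complex_of_real \<rho> * z)"
  have "cmod b = cmod (w - complex_of_real \<rho> * z) / (1 - \<rho>)" unfolding b_def norm_scaleR using \<rho> by simp
  then have "cmod b \<le> 1 / 2" using w \<rho> by (simp add: pos_divide_le_eq)
  have "b \<in> convex hull (sphere 0 (1 / 2))"
  proof -
    obtain u where u: "cmod u = 1" "b = complex_of_real (cmod b) * u"
    proof (cases "b = 0")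
      case True
      then show ?thesis using that[of 1] by simp
    next
      case False
      then show ?thesis using that[of "sgn b"] by (simp add: sgn_eq norm_divide)
    qed
    define \<nu> where "\<nu> = 1 / 2 + cmod b"
    have "b = (1 - \<nu>) *\<^sub>R (- u / 2) + \<nu> *\<^sub>R (u / 2)"
      by (subst u(2)) (simp add: \<nu>_def scaleR_conv_of_real algebra_simps)
    moreover have "- u / 2 \<in> convex hull (sphere 0 (1 / 2))" "u / 2 \<in> convex hull (sphere 0 (1 / 2))"
      using u(1) by (auto intro!: hull_inc simp: norm_divide)
    ultimately show ?thesis
      using \<open>cmod b \<le> 1 / 2\<close> convexD[OF convex_convex_hull, of "- u / 2" _ "u / 2" "1 - \<nu>" \<nu>]
      by (simp add: \<nu>_def)
  qed
  then have "b \<in> stolz z" unfolding stolz_def using hull_mono[of "sphere 0 (1 / 2)" "insert z (sphere 0 (1 / 2))" convex] by blast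
  moreover have "z \<in> stolz z" unfolding stolz_def by (intro hull_inc) simp
  moreover have "convex (stolz z)" unfolding stolz_def by simp
  ultimately have "(1 - \<rho>) *\<^sub>R b + \<rho> *\<^sub>R z \<in> stolz z" using \<rho> by (intro convexD) auto
  moreover have "(1 - \<rho>) *\<^sub>R b + \<rho> *\<^sub>R z = w" using \<rho> by (simp add: b_def scaleR_conv_of_real)
  ultimately show ?thesis by simp
qed

text \<open>Discs of radius \<open>h L / 8\<close> around the sample points lie in the truncated
  Stolz angle and are disjoint for different levels, so the disc mean inequality turns the sum into
  a single integral. The lower bound for \<open>norm1\<close>, including the growth, is then
  inherited from \<open>norm3\<close>.\<close>

lemma norm3_std_le_norm1:
  assumes p: "p > 0" and q: "q > 0"
  shows "\<exists>K>0. \<forall>f :: complex \<Rightarrow> 'a::complex_banach. analytic_disc f \<longrightarrow>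
    norm3 std_radii p q s \<tau> f \<le> ennreal K * norm1 p q s \<tau> f"
proof -
  obtain K where K: "K > 0" and mean: "\<And>(f :: complex \<Rightarrow> 'a) w \<rho>. analytic_disc f \<Longrightarrow> cball w \<rho> \<subseteq> ball 0 1 \<Longrightarrow> \<rho> > 0 \<Longrightarrow>
    ennreal (norm (f w) powr q) \<le> ennreal (K / \<rho>\<^sup>2) * (\<integral>\<^sup>+ v. ennreal (norm (f v) powr q) * indicator (cball w \<rho>) v \<partial>lborel)"
    using disc_mean[OF q] by blast
  define e where "e = - 2 - s * q"
  define c where "c = K * 64 * 2 powr \<bar>e\<bar>"
  have c: "c > 0" using K by (simp add: c_def)
  show ?thesis
  proof (intro exI[of _ "c powr (1 / q)"] conjI allI impI)
    show "0 < c powr (1 / q)" using c by simp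
    fix f :: "complex \<Rightarrow> 'a" assume f: "analytic_disc f"
    show "norm3 std_radii p q s \<tau> f \<le> ennreal (c powr (1 / q)) * norm1 p q s \<tau> f"
      unfolding norm3_def norm1_def
    proof (rule dyadic_norm_le_pointwise[OF p q c])
      fix x :: real and j :: nat
      define h where "h = (\<lambda>L. 1 / 2 ^ (j + L) :: real)"
      have h: "0 < h L" for L by (simp add: h_def)
      have h1: "h L \<le> 1 / 2 ^ j" for L unfolding h_def by (intro divide_left_mono power_increasing) auto
      have hh: "h L' \<le> h L / 2" if "L < L'" for L L'
      proof -
        have "1 / 2 ^ (j + L') \<le> 1 / (2 ^ (j + L + 1) :: real)" using that by (intro divide_left_mono power_increasing) auto
        then show ?thesis by (simp add: h_def)
      qed
      define w where "w = (\<lambda>L. complex_of_real (std_radii (j + L)) * zeta x)"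
      define T where "T = (\<lambda>L. cball (w L) (h L / 8))"
      have nw: "cmod (w L) = 1 - 3 / 4 * h L" for L
      proof -
        have "cmod (w L) = std_radii (j + L)"
          unfolding w_def norm_mult norm_of_real norm_zeta using std.R(1)[of "j + L"] by simp
        then show ?thesis by (simp add: std_radii_def h_def)
      qed
      have T: "5 / 8 * h L \<le> 1 - cmod v" "1 - cmod v \<le> 7 / 8 * h L" if "v \<in> T L" for v L
        using that norm_triangle_ineq2[of v "w L"] norm_triangle_ineq2[of "w L" v] nw[of L]
        unfolding T_def by (auto simp: dist_norm norm_minus_commute)
      have Tball: "T L \<subseteq> ball 0 1" for L
      proof
        fix v assume "v \<in> T L"
        from T(1)[OF this] show "v \<in> ball 0 1" using h[of L] by simp
      qed
      have Tst: "v \<in> stolz_trunc (2 powr (- real j)) (zeta x)" if "v \<in> T L" for v L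
      proof -
        have "cmod (v - w L) \<le> h L / 8" using that by (simp add: T_def dist_norm norm_minus_commute)
        also have "\<dots> \<le> (1 - std_radii (j + L)) / 2"
        proof -
          have "1 - std_radii (j + L) = 3 / 4 * h L" by (simp add: std_radii_def h_def)
          then show ?thesis using h[of L] by simp
        qed
        finally have "v \<in> stolz (zeta x)" unfolding w_def by (intro cball_subset_stolz[OF _ std.R]) simp_all
        moreover have "1 - cmod v \<le> 2 powr (- real j)"
          using T(2)[OF that] h1[of L] h[of L] by (simp add: powr_minus_divide powr_realpow)
        ultimately show ?thesis by (simp add: stolz_trunc_def)
      qed
      have Tdisj: "L = L'" if "v \<in> T L" "v \<in> T L'" for v L L'
      proof (rule ccontr)
        assume "L \<noteq> L'"
        then consider "L < L'" | "L' < L" by linarith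
        then show False
          using T[OF that(1)] T[OF that(2)] hh[of L L'] hh[of L' L] h[of L] h[of L'] by cases linarith+
      qed
      define F where "F = (\<lambda>v. ennreal ((1 - norm v) powr e * norm (f v) powr q))"
      have cf: "continuous_on (T L) (\<lambda>v. (1 - norm v) powr e * norm (f v) powr q)" for L
      proof (rule continuous_on_mult)
        have "1 - cmod v \<noteq> 0" if "v \<in> T L" for v using T(1)[OF that] h[of L] by linarith
        then show "continuous_on (T L) (\<lambda>v. (1 - norm v) powr e)"
          by (intro continuous_on_powr continuous_intros) auto
        show "continuous_on (T L) (\<lambda>v. norm (f v) powr q)"
          by (intro continuous_on_powr' continuous_intros analytic_disc_continuous[OF f Tball]) (use q in auto)
      qed
      have FT [measurable]: "(\<lambda>v. F v * indicator (T L) v) \<in> borel_measurable borel" for L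
        unfolding F_def by (rule measurable_ennreal_indicator[OF cf]) (simp add: T_def)
      have em: "ennreal A * (ennreal B * X) = ennreal (A * B) * X" if "0 \<le> A" "0 \<le> B" for A B X
        by (simp add: that ennreal_mult mult.assoc)
      have level: "ennreal (2 powr (s * real (j + L) * q) * norm (f (w L)) powr q)
          \<le> ennreal c * (\<integral>\<^sup>+ v. F v * indicator (T L) v \<partial>lborel)" for L
      proof -
        have "ennreal (norm (f (w L)) powr q) \<le> ennreal (K / (h L / 8)\<^sup>2) * (\<integral>\<^sup>+ v. ennreal (norm (f v) powr q) * indicator (T L) v \<partial>lborel)"
          unfolding T_def by (rule mean[OF f]) (use Tball[of L] h[of L] in \<open>auto simp: T_def\<close>)
        also have "\<dots> \<le> ennreal (K / (h L / 8)\<^sup>2) * (\<integral>\<^sup>+ v. ennreal (2 powr \<bar>e\<bar> * 2 powr (e * real (j + L))) * (F v * indicator (T L) v) \<partial>lborel)"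
        proof (intro mult_left_mono nn_integral_mono)
          fix v
          show "ennreal (norm (f v) powr q) * indicator (T L) v \<le> ennreal (2 powr \<bar>e\<bar> * 2 powr (e * real (j + L))) * (F v * indicator (T L) v)"
          proof (cases "v \<in> T L")
            case True
            have "2 powr (- \<bar>e\<bar>) * 2 powr (- e * real (j + L)) \<le> (1 - cmod v) powr e"
              using T[OF True] h[of L] by (intro powr_slice(1)) (auto simp: h_def)
            then have "(2 powr \<bar>e\<bar> * 2 powr (e * real (j + L))) * (2 powr (- \<bar>e\<bar>) * 2 powr (- e * real (j + L)))
                \<le> (2 powr \<bar>e\<bar> * 2 powr (e * real (j + L))) * (1 - cmod v) powr e" by (rule mult_left_mono) simp
            also have "(2 powr \<bar>e\<bar> * 2 powr (e * real (j + L))) * (2 powr (- \<bar>e\<bar>) * 2 powr (- e * real (j + L))) = 1"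
              unfolding powr_add[symmetric] by simp
            finally have "1 * norm (f v) powr q \<le> (2 powr \<bar>e\<bar> * 2 powr (e * real (j + L))) * (1 - cmod v) powr e * norm (f v) powr q"
              by (rule mult_right_mono) simp
            then have "ennreal (norm (f v) powr q) \<le> ennreal ((2 powr \<bar>e\<bar> * 2 powr (e * real (j + L))) * ((1 - cmod v) powr e * norm (f v) powr q))"
              by (intro ennreal_leI) (simp only: mult_1 mult.assoc)
            also have "\<dots> = ennreal (2 powr \<bar>e\<bar> * 2 powr (e * real (j + L))) * F v"
              unfolding F_def by (rule ennreal_mult) auto
            finally show ?thesis using True by simp
          qed simp
        qed simp
        also have "\<dots> = ennreal (K / (h L / 8)\<^sup>2) * (ennreal (2 powr \<bar>e\<bar> * 2 powr (e * real (j + L))) * (\<integral>\<^sup>+ v. F v * indicator (T L) v \<partial>lborel))"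
          using FT[of L] by (subst nn_integral_cmult) auto
        also have "\<dots> = ennreal (K / (h L / 8)\<^sup>2 * (2 powr \<bar>e\<bar> * 2 powr (e * real (j + L)))) * (\<integral>\<^sup>+ v. F v * indicator (T L) v \<partial>lborel)"
          using K by (intro em) auto
        finally have 1: "ennreal (norm (f (w L)) powr q)
          \<le> ennreal (K / (h L / 8)\<^sup>2 * (2 powr \<bar>e\<bar> * 2 powr (e * real (j + L)))) * (\<integral>\<^sup>+ v. F v * indicator (T L) v \<partial>lborel)" .
        have "2 powr (s * real (j + L) * q) * (K / (h L / 8)\<^sup>2 * (2 powr \<bar>e\<bar> * 2 powr (e * real (j + L)))) = c"
        proof -
          have "1 / (h L)\<^sup>2 = 2 powr (2 * real (j + L))"
          proof -
            have "2 powr (2 * real (j + L)) = (2 powr real (j + L)) powr 2" by (simp add: powr_powr mult.commute del: of_nat_add)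
            also have "\<dots> = (2 ^ (j + L)) powr 2" by (simp only: powr_realpow[of 2, simplified])
            finally show ?thesis by (simp add: h_def power_divide)
          qed
          moreover have "K / (h L / 8)\<^sup>2 = K * 64 * (1 / (h L)\<^sup>2)" by (simp add: power_divide)
          ultimately have "K / (h L / 8)\<^sup>2 = K * 64 * 2 powr (2 * real (j + L))" by simp
          then have "2 powr (s * real (j + L) * q) * (K / (h L / 8)\<^sup>2 * (2 powr \<bar>e\<bar> * 2 powr (e * real (j + L))))
            = c * (2 powr (s * real (j + L) * q) * 2 powr (2 * real (j + L)) * 2 powr (e * real (j + L)))"
            unfolding c_def by (simp only: mult_ac)
          also have "2 powr (s * real (j + L) * q) * 2 powr (2 * real (j + L)) * 2 powr (e * real (j + L)) = 1"
            unfolding powr_add[symmetric] e_def by (simp add: algebra_simps)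
          finally show ?thesis by simp
        qed
        note ceq = this
        have "ennreal (2 powr (s * real (j + L) * q) * norm (f (w L)) powr q) = ennreal (2 powr (s * real (j + L) * q)) * ennreal (norm (f (w L)) powr q)"
          by (rule ennreal_mult) auto
        also have "\<dots> \<le> ennreal (2 powr (s * real (j + L) * q)) *
          (ennreal (K / (h L / 8)\<^sup>2 * (2 powr \<bar>e\<bar> * 2 powr (e * real (j + L)))) * (\<integral>\<^sup>+ v. F v * indicator (T L) v \<partial>lborel))"
          by (rule mult_left_mono[OF 1]) simp
        also have "\<dots> = ennreal c * (\<integral>\<^sup>+ v. F v * indicator (T L) v \<partial>lborel)"
          unfolding ceq[symmetric] using K by (intro em) auto
        finally show ?thesis .
      qed
      have "(\<Sum>l. if j \<le> l then ennreal (2 powr (s * real l * q) * norm (f (complex_of_real (std_radii l) * zeta x)) powr q) else 0)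
        = (\<Sum>L. ennreal (2 powr (s * real (j + L) * q) * norm (f (w L)) powr q))"
        unfolding w_def by (rule suminf_from)
      also have "\<dots> \<le> (\<Sum>L. ennreal c * (\<integral>\<^sup>+ v. F v * indicator (T L) v \<partial>lborel))"
        by (intro suminf_le level) auto
      also have "\<dots> = ennreal c * (\<integral>\<^sup>+ v. (\<Sum>L. F v * indicator (T L) v) \<partial>lborel)"
        by (subst nn_integral_suminf) auto
      also have "\<dots> \<le> ennreal c * (\<integral>\<^sup>+ v. F v * indicator (stolz_trunc (2 powr (- real j)) (zeta x)) v \<partial>lborel)"
      proof (intro mult_left_mono nn_integral_mono suminf_leI)
        fix v n
        show "(\<Sum>L<n. F v * indicator (T L) v) \<le> F v * indicator (stolz_trunc (2 powr (- real j)) (zeta x)) v"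
          by (rule sum_disjoint_indicator_le) (use Tst Tdisj in auto)
      qed simp
      finally show "(\<Sum>l. if j \<le> l then ennreal (2 powr (s * real l * q) * norm (f (complex_of_real (std_radii l) * zeta x)) powr q) else 0)
        \<le> ennreal c * (\<integral>\<^sup>+ w. ennreal ((1 - norm w) powr (- 2 - s * q) * norm (f w) powr q)
             * indicator (stolz_trunc (2 powr (- real j)) (zeta x)) w \<partial>lborel)"
        unfolding F_def e_def .
    qed
  qed
qed

text \<open>The growth estimate needs the radial and the circular integral interchanged, which the
  outer power \<open>p / q\<close> prevents. The exponent \<open>t = min p q\<close> removes it:
  \<open>t \<le> q\<close> bounds \<open>g powr t\<close> linearly in \<open>g powr q\<close>, and
  \<open>t \<le> p\<close> makes the result at most linear in the power \<open>p / q\<close> of the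
  integral. Additive constants are harmless for growth.\<close>

lemma powr_int_slice_mean:
  assumes p: "p > 0" and q: "q > 0"
  defines "t \<equiv> min p q"
  fixes g :: "real \<Rightarrow> real" and S :: "real set"
  assumes S [measurable]: "S \<in> sets borel" and S1: "emeasure lborel S \<le> 1"
    and g [measurable]: "(\<lambda>r. ennreal (g r powr q) * indicator S r) \<in> borel_measurable borel"
    and g0: "\<And>r. 0 \<le> g r"
  shows "(\<integral>\<^sup>+ r. ennreal (g r powr t) * indicator S r \<partial>lborel)
    \<le> 8 + 4 * epow (\<integral>\<^sup>+ r. ennreal (g r powr q) * indicator S r \<partial>lborel) (p / q)"
proof (cases "(\<integral>\<^sup>+ r. ennreal (g r powr q) * indicator S r \<partial>lborel)")
  case top
  then show ?thesis by (simp add: epow_def ennreal_mult_top)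
next
  case (real Y)
  have YI: "(\<integral>\<^sup>+ r. ennreal (g r powr q) * indicator S r \<partial>lborel) = ennreal Y" and Y0: "0 \<le> Y"
    using real by auto
  have t: "0 < t" "t \<le> p" "t \<le> q" using p q by (auto simp: t_def)
  define e where "e = t / q"
  have e: "0 < e" "e \<le> 1" using t q by (auto simp: e_def)
  define c where "c = 1 + Y"
  have c: "c \<ge> 1" using Y0 by (simp add: c_def)
  have pt: "g r powr t \<le> c powr e * (1 + 1 / c * g r powr q)" for r
  proof -
    have "g r powr t = c powr e * (1 / c * g r powr q) powr e"
      using c q g0[of r] by (simp add: powr_mult powr_divide powr_powr e_def)
    also have "\<dots> \<le> c powr e * (1 + 1 / c * g r powr q)"
      using c e by (intro mult_left_mono powr_le_one_plus) auto
    finally show ?thesis .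
  qed
  have "(\<integral>\<^sup>+ r. ennreal (g r powr t) * indicator S r \<partial>lborel)
    \<le> (\<integral>\<^sup>+ r. ennreal (c powr e) * (indicator S r + ennreal (1 / c) * (ennreal (g r powr q) * indicator S r)) \<partial>lborel)"
  proof (rule nn_integral_mono)
    fix r
    have "ennreal (g r powr t) \<le> ennreal (c powr e * (1 + 1 / c * g r powr q))" by (rule ennreal_leI[OF pt])
    also have "\<dots> = ennreal (c powr e) * (1 + ennreal (1 / c) * ennreal (g r powr q))"
    proof -
      have "ennreal (1 + 1 / c * g r powr q) = 1 + ennreal (1 / c * g r powr q)"
        using c by (subst ennreal_plus) auto
      also have "ennreal (1 / c * g r powr q) = ennreal (1 / c) * ennreal (g r powr q)"
        using c by (intro ennreal_mult) auto
      finally show ?thesis using c by (subst ennreal_mult) auto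
    qed
    finally show "ennreal (g r powr t) * indicator S r
      \<le> ennreal (c powr e) * (indicator S r + ennreal (1 / c) * (ennreal (g r powr q) * indicator S r))"
      by (simp add: indicator_def)
  qed
  also have "\<dots> = ennreal (c powr e) * (emeasure lborel S + ennreal (1 / c) * ennreal Y)"
    using S g unfolding YI[symmetric] by (simp add: nn_integral_cmult nn_integral_add)
  also have "\<dots> \<le> ennreal (c powr e) * (1 + 1)"
  proof (intro mult_left_mono add_mono S1)
    have "1 / c * Y \<le> 1" using c Y0 by (simp add: c_def)
    then show "ennreal (1 / c) * ennreal Y \<le> 1"
      using c Y0 by (subst ennreal_mult[symmetric]) (auto simp: ennreal_le_1)
  qed simp
  also have "\<dots> = ennreal (c powr e * 2)"
    by (simp add: ennreal_mult)
  also have "\<dots> \<le> ennreal (8 + 4 * Y powr (p / q))"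
  proof (rule ennreal_leI)
    have "c powr e \<le> 2 powr e * (1 powr e + Y powr e)"
      unfolding c_def using Y0 e by (intro powr_add_le) auto
    also have "\<dots> \<le> 2 powr 1 * (1 powr e + Y powr e)" using e by (intro mult_right_mono powr_mono) auto
    finally have 1: "c powr e \<le> 2 * (1 + Y powr e)" by simp
    have "Y powr e = (Y powr (p / q)) powr (t / p)" using p by (simp add: powr_powr e_def)
    also have "\<dots> \<le> 1 + Y powr (p / q)" using p t by (intro powr_le_one_plus) auto
    finally have "2 * (1 + Y powr e) \<le> 2 * (1 + (1 + Y powr (p / q)))" by (intro mult_left_mono add_left_mono) auto
    from order_trans[OF 1 this] have "c powr e \<le> 2 * (1 + (1 + Y powr (p / q)))" .
    then show "c powr e * 2 \<le> 8 + 4 * Y powr (p / q)" by simp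
  qed
  also have "\<dots> = 8 + 4 * epow (ennreal Y) (p / q)"
    using Y0 by (simp add: epow_ennreal ennreal_mult)
  finally show ?thesis unfolding YI .
qed

text \<open>The radial intervals above the sampling circles are disjoint, so the integral dominates
  the weighted sum of the infima. Growth comes from a pigeonhole argument: a slice of circles whose
  \<open>t\<close>-means have a controlled integral contains a circle with a controlled
  \<open>t\<close>-mean.\<close>

lemma peak_norm_le_norm2:
  assumes p: "p > 0" and q: "q > 0" and a: "a > max (1 / p) (1 / q)"
  shows "\<exists>K>0. \<forall>f :: complex \<Rightarrow> 'a::complex_banach. analytic_disc f \<longrightarrow>
    dyadic_norm p q \<tau> (peak_bracket s q a std_radii f) \<le> ennreal K * norm2 p q s \<tau> f"
  unfolding norm2_def
proof (rule std.peak_bracket_le_sampled[OF p q a])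
  define e where "e = - 1 - s * q"
  let ?F = "\<lambda>(f :: complex \<Rightarrow> 'a) x r. ennreal ((1 - r) powr (- 1 - s * q) * norm (f (complex_of_real r * zeta x)) powr q)"
  let ?B = "\<lambda>(f :: complex \<Rightarrow> 'a) x j. \<integral>\<^sup>+ r. ?F f x r * indicator {1 - 2 powr (- real j) ..< 1} r \<partial>lborel"
  define t where "t = min p q"
  have t: "t > 0" using p q by (simp add: t_def)
  \<comment> \<open>\<open>\<bar>e\<bar> * (p / q)\<close> is the loss from the radial weight; of
    the summand 2, one unit pays for the length \<open>h / 4\<close> of the slice.\<close>
  define \<gamma> where "\<gamma> = \<bar>e\<bar> * (p / q) + 2"
  show "(\<gamma> + 1) / t \<ge> 0" unfolding \<gamma>_def using t p q by simp
  show "(1 / 4 :: real) > 0" by simp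
  show "\<exists>\<kappa>>0. \<forall>f x j N. analytic_disc f \<longrightarrow> 0 \<le> x \<longrightarrow> x < 1 \<longrightarrow>
      ennreal (\<kappa> * (\<Sum>L\<le>N. 2 powr (s * real (j + L) * q) *
        (INF r\<in>{std_radii (j + L)..std_radii (j + L) + \<delta> / 2 ^ (j + L)}. norm (f (complex_of_real r * zeta x))) powr q)) \<le> ?B f x j"
    if \<delta>: "0 < \<delta>" "\<delta> \<le> 1 / 4" for \<delta>
  proof (intro exI[of _ "2 powr (- \<bar>e\<bar>) * \<delta>"] conjI allI impI)
    show "0 < 2 powr (- \<bar>e\<bar>) * \<delta>" using \<delta> by simp
    fix f :: "complex \<Rightarrow> 'a" and x :: real and j N :: nat
    assume f: "analytic_disc f"
    define h where "h = (\<lambda>L. 1 / 2 ^ (j + L) :: real)"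
    have h: "0 < h L" for L by (simp add: h_def)
    have h1: "h L \<le> 1 / 2 ^ j" for L unfolding h_def by (intro divide_left_mono power_increasing) auto
    have hh: "h L' \<le> h L / 2" if "L < L'" for L L'
    proof -
      have "1 / 2 ^ (j + L') \<le> 1 / (2 ^ (j + L + 1) :: real)" using that by (intro divide_left_mono power_increasing) auto
      then show ?thesis by (simp add: h_def)
    qed
    define T where "T = (\<lambda>L. {std_radii (j + L)..std_radii (j + L) + \<delta> / 2 ^ (j + L)})"
    have Teq: "T L = {1 - 3 / 4 * h L .. 1 - 3 / 4 * h L + \<delta> * h L}" for L
      unfolding T_def std_radii_def h_def by simp
    have dh: "\<delta> * h L \<le> 1 / 4 * h L" for L using \<delta> h[of L] by (intro mult_right_mono) auto
    have T: "1 / 2 * h L \<le> 1 - r" "1 - r \<le> 3 / 4 * h L" if "r \<in> T L" for r L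
      using that dh[of L] unfolding Teq by auto
    have Tdisj: "L = L'" if "r \<in> T L" "r \<in> T L'" for r L L'
    proof (rule ccontr)
      assume "L \<noteq> L'"
      then consider "L < L'" | "L' < L" by linarith
      then show False
        using T[OF that(1)] T[OF that(2)] hh[of L L'] hh[of L' L] h[of L] h[of L'] by cases linarith+
    qed
    define I where "I = (\<lambda>L. (INF r\<in>T L. norm (f (complex_of_real r * zeta x))) powr q)"
    define d where "d = (\<lambda>L. 2 powr (- \<bar>e\<bar>) * 2 powr (- e * real (j + L)) * I L)"
    have point: "(\<Sum>L<Suc N. ennreal (d L) * indicator (T L) r) \<le> ?F f x r * indicator {1 - 2 powr (- real j) ..< 1} r" for r
    proof (rule sum_disjoint_indicator_le[OF _ Tdisj])
      fix L assume r: "r \<in> T L"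
      have "2 powr (- \<bar>e\<bar>) * 2 powr (- e * real (j + L)) \<le> (1 - r) powr e"
        using T[OF r] h[of L] by (intro powr_slice(1)) (auto simp: h_def)
      moreover have "I L \<le> norm (f (complex_of_real r * zeta x)) powr q"
        unfolding I_def using q r by (intro powr_mono2 cINF_lower cINF_greatest bdd_belowI2[where m=0]) auto
      ultimately have "d L \<le> (1 - r) powr e * norm (f (complex_of_real r * zeta x)) powr q"
        unfolding d_def by (intro mult_mono) (auto simp: I_def)
      moreover have "r \<in> {1 - 2 powr (- real j) ..< 1}"
        using T[OF r] h[of L] h1[of L] by (simp add: powr_minus_divide powr_realpow)
      ultimately show "ennreal (d L) \<le> ?F f x r * indicator {1 - 2 powr (- real j) ..< 1} r"
        unfolding e_def by (simp add: ennreal_leI)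
    qed
    have level: "(\<integral>\<^sup>+ r. ennreal (d L) * indicator (T L) r \<partial>lborel) = ennreal (2 powr (- \<bar>e\<bar>) * \<delta> * (2 powr (s * real (j + L) * q) * I L))" for L
    proof -
      have "(\<integral>\<^sup>+ r. ennreal (d L) * indicator (T L) r \<partial>lborel) = ennreal (d L) * emeasure lborel (T L)"
        by (rule nn_integral_cmult_indicator) (simp add: T_def)
      also have "emeasure lborel (T L) = ennreal (\<delta> * h L)"
        unfolding Teq using \<delta> h[of L] by simp
      also have "ennreal (d L) * ennreal (\<delta> * h L) = ennreal (d L * (\<delta> * h L))"
        using \<delta> h[of L] by (intro ennreal_mult[symmetric]) (auto simp: d_def I_def)
      also have "d L * (\<delta> * h L) = 2 powr (- \<bar>e\<bar>) * \<delta> * (2 powr (s * real (j + L) * q) * I L)"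
      proof -
        have "h L = 2 powr (- real (j + L))" by (simp add: h_def powr_minus_divide powr_realpow del: of_nat_add)
        then have "2 powr (- e * real (j + L)) * h L = 2 powr (s * real (j + L) * q)"
          by (simp only: powr_add[symmetric] e_def) (simp add: algebra_simps)
        moreover have "d L * (\<delta> * h L) = 2 powr (- \<bar>e\<bar>) * \<delta> * ((2 powr (- e * real (j + L)) * h L) * I L)"
          unfolding d_def by (simp only: mult_ac)
        ultimately show ?thesis by simp
      qed
      finally show ?thesis .
    qed
    have "ennreal (2 powr (- \<bar>e\<bar>) * \<delta> * (\<Sum>L\<le>N. 2 powr (s * real (j + L) * q) * I L))
      = (\<Sum>L<Suc N. ennreal (2 powr (- \<bar>e\<bar>) * \<delta> * (2 powr (s * real (j + L) * q) * I L)))"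
      unfolding sum_distrib_left lessThan_Suc_atMost using \<delta> by (intro sum_ennreal[symmetric]) (auto simp: I_def)
    also have "\<dots> = (\<Sum>L<Suc N. \<integral>\<^sup>+ r. ennreal (d L) * indicator (T L) r \<partial>lborel)"
      unfolding level ..
    also have "\<dots> = (\<integral>\<^sup>+ r. (\<Sum>L<Suc N. ennreal (d L) * indicator (T L) r) \<partial>lborel)"
      by (rule nn_integral_sum[symmetric]) (simp add: T_def)
    also have "\<dots> \<le> ?B f x j" by (rule nn_integral_mono[OF point])
    finally show "ennreal (2 powr (- \<bar>e\<bar>) * \<delta> * (\<Sum>L\<le>N. 2 powr (s * real (j + L) * q) *
        (INF r\<in>{std_radii (j + L)..std_radii (j + L) + \<delta> / 2 ^ (j + L)}. norm (f (complex_of_real r * zeta x))) powr q)) \<le> ?B f x j"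
      unfolding I_def T_def .
  qed
  show "poly_growth f std_radii ((\<gamma> + 1) / t)" if f: "analytic_disc f" and fin: "dyadic_norm p q \<tau> (?B f) < \<infinity>" for f
  proof -
    define V0 where "V0 = (\<integral>\<^sup>+ x. epow (?B f x 0) (p / q) * indicator {0..<1} x \<partial>lborel)"
    have V0: "V0 < \<infinity>" unfolding V0_def by (rule dyadic_norm_finiteD[OF p fin])
    \<comment> \<open>Measurability at rank 0 is used below to split the integral of a sum. The
      integrand is a function continuous on the disc, cut off outside, in polar coordinates.\<close>
    have Bmeas [measurable]: "(\<lambda>x. ?B f x 0) \<in> borel_measurable borel"
    proof -
      define H where "H = (\<lambda>v. ennreal ((1 - norm v) powr e * norm (f v) powr q) * indicator (ball 0 1) v)"
      have "continuous_on (ball 0 1) (\<lambda>v. (1 - norm v) powr e * norm (f v) powr q)"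
      proof (rule continuous_on_mult)
        show "continuous_on (ball 0 1) (\<lambda>v::complex. (1 - norm v) powr e)"
          by (intro continuous_on_powr continuous_intros) auto
        show "continuous_on (ball 0 1) (\<lambda>v. norm (f v) powr q)"
          by (intro continuous_on_powr' continuous_intros analytic_disc_continuous[OF f]) (use q in auto)
      qed
      then have [measurable]: "H \<in> borel_measurable borel"
        unfolding H_def by (rule measurable_ennreal_indicator) simp
      have "?F f x r * indicator {1 - 2 powr (- real 0) ..< 1} r = H (complex_of_real r * zeta x) * indicator {0..<1} r" for x r
        unfolding H_def e_def by (auto simp: indicator_def norm_mult)
      then have "(\<lambda>x. ?B f x 0) = (\<lambda>x. \<integral>\<^sup>+ r. H (complex_of_real r * zeta x) * indicator {0..<1} r \<partial>lborel)" by simp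
      also have "\<dots> \<in> borel_measurable borel" by measurable
      finally show ?thesis .
    qed
    define D where "D = (2 powr (2 * \<bar>e\<bar>)) powr (p / q)"
    \<comment> \<open>Chosen so that \<open>V / 8\<close>, times the exponential factor, dominates
      the bound \<open>W\<close> for the double integral; a slice with all means above
      \<open>V * 2 powr (\<gamma> * real l)\<close> then gives a contradiction.\<close>
    define V where "V = 8 * (8 + 4 * (D * enn2real V0))"
    have D: "D > 0" by (simp add: D_def)
    have V: "V > 0" unfolding V_def using D by (simp add: add_pos_nonneg)
    show ?thesis
    proof (rule std.poly_growth_of_circle_means[OF f t])
      show "(1 / 4 :: real) > 0" by simp
      show "V \<ge> 0" using V by simp
      fix l :: nat
      define h where "h = 1 / (2 :: real) ^ l"
      have h: "0 < h" "h \<le> 1" unfolding h_def by simp_all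
      \<comment> \<open>The slice begins exactly at \<open>std_radii l + 1 / 4 / 2 ^ l\<close>, the
        smallest radius that the growth criterion with gap constant \<open>1 / 4\<close>
        admits.\<close>
      define S where "S = {1 - h / 2 .. 1 - h / 4}"
      have Sm: "S \<in> sets borel" "emeasure lborel S = ennreal (h / 4)" unfolding S_def using h by simp_all
      have Sr: "0 < r" "h / 4 \<le> 1 - r" "1 - r \<le> h / 2" if "r \<in> S" for r using that h unfolding S_def by auto
      define G where "G = (\<lambda>v. ennreal (norm (f v) powr t) * indicator (cball 0 (1 - h / 4)) v)"
      define Gq where "Gq = (\<lambda>v. ennreal (norm (f v) powr q) * indicator (cball 0 (1 - h / 4)) v)"
      have meas: "(\<lambda>v. ennreal (norm (f v) powr b) * indicator (cball 0 (1 - h / 4)) v) \<in> borel_measurable borel" if b: "b > 0" for b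
      proof -
        have "cball (0::complex) (1 - h / 4) \<subseteq> ball 0 1" using h by auto
        then have c: "continuous_on (cball 0 (1 - h / 4)) (\<lambda>v. norm (f v) powr b)"
          by (intro continuous_on_powr' continuous_intros analytic_disc_continuous[OF f]) (use b in auto)
        show ?thesis by (rule measurable_ennreal_indicator[OF c]) simp
      qed
      have G [measurable]: "G \<in> borel_measurable borel" "Gq \<in> borel_measurable borel"
        unfolding G_def Gq_def using meas t q by auto
      note Sm(1) [measurable]
      have inb: "complex_of_real r * zeta x \<in> cball 0 (1 - h / 4)" if "r \<in> S" for r x
        using Sr[OF that] by (simp add: norm_mult)
      have Geq: "ennreal (norm (f (complex_of_real r * zeta x)) powr t) * indicator S r = G (complex_of_real r * zeta x) * indicator S r"
        and Gqeq: "ennreal (norm (f (complex_of_real r * zeta x)) powr q) * indicator S r = Gq (complex_of_real r * zeta x) * indicator S r" for r x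
        using inb[of r x] by (auto simp: G_def Gq_def indicator_def)
      define W where "W = 8 + 4 * (D * 2 powr (\<bar>e\<bar> * (p / q) * real l) * enn2real V0)"
      have "(\<integral>\<^sup>+ r. (\<integral>\<^sup>+ x. G (complex_of_real r * zeta x) * indicator S r * indicator {0..<1} x \<partial>lborel) \<partial>lborel)
        = (\<integral>\<^sup>+ x. (\<integral>\<^sup>+ r. G (complex_of_real r * zeta x) * indicator S r * indicator {0..<1} x \<partial>lborel) \<partial>lborel)"
        by (rule lborel_pair.Fubini') measurable
      also have "\<dots> \<le> (\<integral>\<^sup>+ x. 8 * indicator {0..<1} x + 4 * ennreal (D * 2 powr (\<bar>e\<bar> * (p / q) * real l)) * (epow (?B f x 0) (p / q) * indicator {0..<1} x) \<partial>lborel)"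
      proof (rule nn_integral_mono)
        fix x :: real
        let ?g = "\<lambda>r. norm (f (complex_of_real r * zeta x))"
        have "(\<integral>\<^sup>+ r. ennreal (?g r powr q) * indicator S r \<partial>lborel)
          \<le> (\<integral>\<^sup>+ r. ennreal (2 powr (2 * \<bar>e\<bar>) * 2 powr (\<bar>e\<bar> * real l)) * (?F f x r * indicator {1 - 2 powr (- real 0) ..< 1} r) \<partial>lborel)"
        proof (rule nn_integral_mono)
          fix r
          show "ennreal (?g r powr q) * indicator S r
            \<le> ennreal (2 powr (2 * \<bar>e\<bar>) * 2 powr (\<bar>e\<bar> * real l)) * (?F f x r * indicator {1 - 2 powr (- real 0) ..< 1} r)"
          proof (cases "r \<in> S")
            case True
            have "e * real (l + 1) \<le> \<bar>e\<bar> * real (l + 1)" by (rule mult_right_mono) auto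
            then have "2 powr (- (2 * \<bar>e\<bar> + \<bar>e\<bar> * real l)) \<le> 2 powr (- \<bar>e\<bar>) * 2 powr (- e * real (l + 1))"
              unfolding powr_add[symmetric] by (intro powr_mono) (auto simp: algebra_simps)
            also have "\<dots> \<le> (1 - r) powr e"
              using Sr[OF True] by (intro powr_slice(1)) (auto simp: h_def)
            finally have "(2 powr (2 * \<bar>e\<bar>) * 2 powr (\<bar>e\<bar> * real l)) * 2 powr (- (2 * \<bar>e\<bar> + \<bar>e\<bar> * real l))
                \<le> (2 powr (2 * \<bar>e\<bar>) * 2 powr (\<bar>e\<bar> * real l)) * (1 - r) powr e" by (rule mult_left_mono) simp
            also have "(2 powr (2 * \<bar>e\<bar>) * 2 powr (\<bar>e\<bar> * real l)) * 2 powr (- (2 * \<bar>e\<bar> + \<bar>e\<bar> * real l)) = 1"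
              unfolding powr_add[symmetric] by simp
            finally have "1 * ?g r powr q \<le> (2 powr (2 * \<bar>e\<bar>) * 2 powr (\<bar>e\<bar> * real l)) * (1 - r) powr e * ?g r powr q"
              by (rule mult_right_mono) simp
            then have "ennreal (?g r powr q) \<le> ennreal ((2 powr (2 * \<bar>e\<bar>) * 2 powr (\<bar>e\<bar> * real l)) * ((1 - r) powr e * ?g r powr q))"
              by (intro ennreal_leI) (simp only: mult_1 mult.assoc)
            also have "\<dots> = ennreal (2 powr (2 * \<bar>e\<bar>) * 2 powr (\<bar>e\<bar> * real l)) * ?F f x r"
              unfolding e_def by (rule ennreal_mult) auto
            finally show ?thesis using True Sr[OF True] h by simp
          qed simp
        qed
        also have "\<dots> \<le> ennreal (2 powr (2 * \<bar>e\<bar>) * 2 powr (\<bar>e\<bar> * real l)) * ?B f x 0"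
          by (rule nn_integral_cmult_le) simp
        finally have "epow (\<integral>\<^sup>+ r. ennreal (?g r powr q) * indicator S r \<partial>lborel) (p / q)
          \<le> epow (ennreal (2 powr (2 * \<bar>e\<bar>) * 2 powr (\<bar>e\<bar> * real l)) * ?B f x 0) (p / q)"
          using p q by (intro epow_mono) auto
        also have "\<dots> = ennreal ((2 powr (2 * \<bar>e\<bar>) * 2 powr (\<bar>e\<bar> * real l)) powr (p / q)) * epow (?B f x 0) (p / q)"
          by (rule epow_cmult) simp
        also have "(2 powr (2 * \<bar>e\<bar>) * 2 powr (\<bar>e\<bar> * real l)) powr (p / q) = D * 2 powr (\<bar>e\<bar> * (p / q) * real l)"
          unfolding D_def powr_mult by (simp add: powr_powr mult_ac)
        finally have ep: "epow (\<integral>\<^sup>+ r. ennreal (?g r powr q) * indicator S r \<partial>lborel) (p / q)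
          \<le> ennreal (D * 2 powr (\<bar>e\<bar> * (p / q) * real l)) * epow (?B f x 0) (p / q)" .
        have S1: "emeasure lborel S \<le> 1" unfolding Sm(2) using h by (simp add: ennreal_le_1)
        have mq: "(\<lambda>r. ennreal (?g r powr q) * indicator S r) \<in> borel_measurable borel"
          unfolding Gqeq by measurable
        have "(\<integral>\<^sup>+ r. G (complex_of_real r * zeta x) * indicator S r * indicator {0..<1} x \<partial>lborel)
          = (\<integral>\<^sup>+ r. ennreal (?g r powr t) * indicator S r \<partial>lborel) * indicator {0..<1} x"
          unfolding Geq by (rule nn_integral_multc) measurable
        also have "\<dots> \<le> (8 + 4 * epow (\<integral>\<^sup>+ r. ennreal (?g r powr q) * indicator S r \<partial>lborel) (p / q)) * indicator {0..<1} x"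
          unfolding t_def by (intro mult_right_mono powr_int_slice_mean[OF p q Sm(1) S1 mq]) auto
        also have "\<dots> \<le> (8 + 4 * (ennreal (D * 2 powr (\<bar>e\<bar> * (p / q) * real l)) * epow (?B f x 0) (p / q))) * indicator {0..<1} x"
          by (intro mult_right_mono add_left_mono mult_left_mono ep) auto
        also have "\<dots> = 8 * indicator {0..<1} x + 4 * ennreal (D * 2 powr (\<bar>e\<bar> * (p / q) * real l)) * (epow (?B f x 0) (p / q) * indicator {0..<1} x)"
          by (simp add: indicator_def mult.assoc)
        finally show "(\<integral>\<^sup>+ r. G (complex_of_real r * zeta x) * indicator S r * indicator {0..<1} x \<partial>lborel)
          \<le> 8 * indicator {0..<1} x + 4 * ennreal (D * 2 powr (\<bar>e\<bar> * (p / q) * real l)) * (epow (?B f x 0) (p / q) * indicator {0..<1} x)" .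
      qed
      also have "\<dots> = 8 + 4 * ennreal (D * 2 powr (\<bar>e\<bar> * (p / q) * real l)) * V0"
        unfolding V0_def using Bmeas by (simp add: nn_integral_add nn_integral_cmult)
      also have "\<dots> = ennreal W"
      proof -
        have "V0 = ennreal (enn2real V0)" using V0 by simp
        then have "4 * ennreal (D * 2 powr (\<bar>e\<bar> * (p / q) * real l)) * V0 = ennreal (4 * (D * 2 powr (\<bar>e\<bar> * (p / q) * real l) * enn2real V0))"
          using D by (metis (no_types, lifting) ennreal_mult ennreal_numeral enn2real_nonneg less_imp_le mult.assoc mult_nonneg_nonneg powr_ge_zero zero_le_numeral)
        then show ?thesis unfolding W_def using D by (subst ennreal_plus) auto
      qed
      finally have tot: "(\<integral>\<^sup>+ r. (\<integral>\<^sup>+ x. G (complex_of_real r * zeta x) * indicator S r * indicator {0..<1} x \<partial>lborel) \<partial>lborel) \<le> ennreal W" .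
      show "\<exists>\<rho>. std_radii l + 1 / 4 / 2 ^ l \<le> \<rho> \<and> \<rho> < 1 \<and>
        (\<integral>\<^sup>+ x. ennreal (norm (f (complex_of_real \<rho> * zeta x)) powr t) * indicator {0..<1} x \<partial>lborel) \<le> ennreal (V * 2 powr (\<gamma> * real l))"
      proof (rule ccontr)
        assume neg: "\<not> ?thesis"
        have large: "ennreal (V * 2 powr (\<gamma> * real l)) \<le> (\<integral>\<^sup>+ x. ennreal (norm (f (complex_of_real r * zeta x)) powr t) * indicator {0..<1} x \<partial>lborel)"
          if "r \<in> S" for r
        proof -
          have "std_radii l + 1 / 4 / 2 ^ l = 1 - h / 2" by (simp add: std_radii_def h_def)
          then have "std_radii l + 1 / 4 / 2 ^ l \<le> r" "r < 1" using that h unfolding S_def by auto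
          then show ?thesis using neg by (meson linear)
        qed
        have "ennreal (V * 2 powr (\<gamma> * real l) * (h / 4)) = ennreal (V * 2 powr (\<gamma> * real l)) * emeasure lborel S"
          unfolding Sm(2) using V h by (intro ennreal_mult) auto
        also have "\<dots> = (\<integral>\<^sup>+ r. ennreal (V * 2 powr (\<gamma> * real l)) * indicator S r \<partial>lborel)"
          using Sm(1) by (intro nn_integral_cmult_indicator[symmetric]) simp
        also have "\<dots> \<le> (\<integral>\<^sup>+ r. (\<integral>\<^sup>+ x. G (complex_of_real r * zeta x) * indicator S r * indicator {0..<1} x \<partial>lborel) \<partial>lborel)"
        proof (rule nn_integral_mono)
          fix r
          show "ennreal (V * 2 powr (\<gamma> * real l)) * indicator S r \<le> (\<integral>\<^sup>+ x. G (complex_of_real r * zeta x) * indicator S r * indicator {0..<1} x \<partial>lborel)"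
            unfolding Geq[symmetric] using large[of r] by (cases "r \<in> S") simp_all
        qed
        also note tot
        finally have "V * 2 powr (\<gamma> * real l) * (h / 4) \<le> W"
          using D by (subst (asm) ennreal_le_iff) (auto simp: W_def)
        moreover have "W \<le> V / 8 * 2 powr (\<bar>e\<bar> * (p / q) * real l)"
        proof -
          have "1 \<le> 2 powr (\<bar>e\<bar> * (p / q) * real l)" using p q by (intro ge_one_powr_ge_zero) auto
          then show ?thesis unfolding W_def V_def by (simp add: algebra_simps)
        qed
        moreover have "V * 2 powr (\<gamma> * real l) * (h / 4) = V / 4 * 2 powr ((\<bar>e\<bar> * (p / q) + 1) * real l)"
        proof -
          have "h = 2 powr (- real l)" by (simp add: h_def powr_minus_divide powr_realpow)
          then have "2 powr (\<gamma> * real l) * h = 2 powr ((\<bar>e\<bar> * (p / q) + 1) * real l)"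
            by (simp only: powr_add[symmetric] \<gamma>_def) (simp add: algebra_simps)
          then show ?thesis by simp
        qed
        moreover have "V / 8 * 2 powr (\<bar>e\<bar> * (p / q) * real l) < V / 4 * 2 powr ((\<bar>e\<bar> * (p / q) + 1) * real l)"
        proof -
          have "V / 8 * 2 powr (\<bar>e\<bar> * (p / q) * real l) < V / 4 * 2 powr (\<bar>e\<bar> * (p / q) * real l)"
            using V by (intro mult_strict_right_mono) auto
          also have "\<dots> \<le> V / 4 * 2 powr ((\<bar>e\<bar> * (p / q) + 1) * real l)"
            using V by (intro mult_left_mono powr_mono mult_right_mono) auto
          finally show ?thesis .
        qed
        ultimately show False by linarith
      qed
    qed
  qed
qed

section \<open>Chains of comparisons between the quasi-norms\<close>

definition dominated :: "((complex \<Rightarrow> 'a::complex_banach) \<Rightarrow> ennreal) \<Rightarrow> ((complex \<Rightarrow> 'a) \<Rightarrow> ennreal) \<Rightarrow> bool" where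
  "dominated A B \<longleftrightarrow> (\<exists>K>0. \<forall>f. analytic_disc f \<longrightarrow> A f \<le> ennreal K * B f)"

lemma dominated_trans:
  assumes "dominated A B" "dominated B C"
  shows "dominated A C"
proof -
  obtain K where K: "K > 0" "\<And>f. analytic_disc f \<Longrightarrow> A f \<le> ennreal K * B f" using assms(1) unfolding dominated_def by blast
  obtain K' where K': "K' > 0" "\<And>f. analytic_disc f \<Longrightarrow> B f \<le> ennreal K' * C f" using assms(2) unfolding dominated_def by blast
  have "A f \<le> ennreal (K * K') * C f" if f: "analytic_disc f" for f
  proof -
    have "A f \<le> ennreal K * (ennreal K' * C f)"
      using K(2)[OF f] mult_left_mono[OF K'(2)[OF f], of "ennreal K"] by (meson order_trans zero_le)
    then show ?thesis using K K' by (simp add: ennreal_mult mult.assoc)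
  qed
  then show ?thesis unfolding dominated_def using K(1) K'(1) by (intro exI[of _ "K * K'"]) auto
qed

lemma dominated_pointwise:
  assumes "p > 0" "q > 0"
    and "\<exists>K>0. \<forall>f x j. analytic_disc f \<longrightarrow> 0 \<le> x \<longrightarrow> x < 1 \<longrightarrow> G f x j \<le> ennreal K * H f x j"
  shows "dominated (\<lambda>f. dyadic_norm p q \<tau> (G f)) (\<lambda>f. dyadic_norm p q \<tau> (H f))"
proof -
  obtain K where K: "K > 0" "\<And>f x j. analytic_disc f \<Longrightarrow> 0 \<le> x \<Longrightarrow> x < 1 \<Longrightarrow> G f x j \<le> ennreal K * H f x j"
    using assms(3) by blast
  have "dyadic_norm p q \<tau> (G f) \<le> ennreal (K powr (1 / q)) * dyadic_norm p q \<tau> (H f)" if f: "analytic_disc f" for f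
    by (rule dyadic_norm_le_pointwise[OF assms(1,2) K(1) K(2)[OF f]])
  then show ?thesis unfolding dominated_def using K(1) by (intro exI[of _ "K powr (1 / q)"]) auto
qed

lemma norm_le_peetre:
  assumes "0 \<le> x" "x < 1"
  shows "ennreal (norm (f (complex_of_real r * zeta x))) \<le> peetre f a r x"
proof -
  have "ennreal (norm (f (complex_of_real r * zeta x)) * (1 + tdist x x / (1 - r)) powr (- a)) \<le> peetre f a r x"
    unfolding peetre_def by (rule SUP_upper) (use assms in simp)
  then show ?thesis by (simp add: tdist_def)
qed

lemma powr_norm_le_epow_peetre:
  assumes "0 \<le> x" "x < 1" "q > 0" "0 \<le> c"
  shows "ennreal (c * norm (f (complex_of_real r * zeta x)) powr q) \<le> ennreal c * epow (peetre f a r x) q"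
proof -
  have "ennreal (norm (f (complex_of_real r * zeta x)) powr q) = epow (ennreal (norm (f (complex_of_real r * zeta x)))) q"
    by (simp add: epow_ennreal)
  also have "\<dots> \<le> epow (peetre f a r x) q" using assms by (intro epow_mono norm_le_peetre) auto
  finally have "ennreal c * ennreal (norm (f (complex_of_real r * zeta x)) powr q) \<le> ennreal c * epow (peetre f a r x) q"
    by (rule mult_left_mono) simp
  then show ?thesis using assms by (simp add: ennreal_mult)
qed

lemma norm3_le_norm4:
  assumes "p > 0" "q > 0"
  shows "dominated (norm3 rs p q s \<tau>) (norm4 rs a p q s \<tau> :: (complex \<Rightarrow> 'a::complex_banach) \<Rightarrow> ennreal)"
  unfolding norm3_def norm4_def
  by (rule dominated_pointwise[OF assms])
    (use assms in \<open>auto intro!: exI[of _ 1] suminf_le powr_norm_le_epow_peetre\<close>)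

lemma norm2_le_norm5:
  assumes "p > 0" "q > 0"
  shows "dominated (norm2 p q s \<tau>) (norm5 a p q s \<tau> :: (complex \<Rightarrow> 'a::complex_banach) \<Rightarrow> ennreal)"
  unfolding norm2_def norm5_def
  by (rule dominated_pointwise[OF assms])
    (use assms in \<open>auto intro!: exI[of _ 1] nn_integral_mono mult_right_mono powr_norm_le_epow_peetre\<close>)

theorem theorem10:
  fixes p q s \<tau> a c C :: real and rs :: "nat \<Rightarrow> real"
  assumes "0 < p" and "0 < q" and "0 \<le> \<tau>"
    and "a > max (1 / p) (1 / q)"
    and "\<And>l. 0 \<le> rs l \<and> rs l < 1"
    and "0 < c" and "c \<le> C"
    and "\<And>l. c * 2 powr (- real l) \<le> 1 - rs l \<and> 1 - rs l \<le> C * 2 powr (- real l)"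
  shows "\<exists>K::real. K \<ge> 1 \<and>
    (\<forall>f :: complex \<Rightarrow> 'a::complex_banach. analytic_disc f \<longrightarrow>
      (\<forall>j \<in> {1..5::nat}. \<forall>k \<in> {1..5::nat}.
         the_norms rs a p q s \<tau> j f \<le> ennreal K * the_norms rs a p q s \<tau> k f))"
proof -
  note p = assms(1) and q = assms(2) and a = assms(4)
  have a0: "a > 0" using a p by (smt (verit) divide_pos_pos max.cobounded1)
  have rs: "c / 2 ^ l \<le> 1 - rs l" "1 - rs l \<le> C / 2 ^ l" for l
    using assms(8)[of l] by (simp_all add: powr_minus_divide powr_realpow)
  have C0: "C > 0" using assms(6,7) by linarith
  interpret rs: radii rs c C
    by unfold_locales (use assms(5-7) rs in auto)
  define D :: "(nat \<Rightarrow> real) \<Rightarrow> (complex \<Rightarrow> 'a) \<Rightarrow> ennreal" where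
    "D = (\<lambda>R f. dyadic_norm p q \<tau> (peak_bracket s q a R f))"
  \<comment> \<open>These bounds hold for every admissible sequence of radii; those for
    \<open>norm2\<close> and \<open>norm3\<close> follow through \<open>norm5\<close> and
    \<open>norm4\<close>, whose suprema include the point itself.\<close>
  have upper: "dominated (norm1 p q s \<tau>) (D R) \<and> dominated (norm4 rs a p q s \<tau>) (D R) \<and> dominated (norm5 a p q s \<tau>) (D R)"
    if R: "radii R c0 C0" for R c0 C0
    unfolding D_def norm1_def norm4_def norm5_def
  proof (intro conjI dominated_pointwise[OF p q])
    interpret radii R c0 C0 by (rule R)
    show "\<exists>K>0. \<forall>(f :: complex \<Rightarrow> 'a) x j. analytic_disc f \<longrightarrow> 0 \<le> x \<longrightarrow> x < 1 \<longrightarrow>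
      (\<integral>\<^sup>+ w. ennreal ((1 - norm w) powr (- 2 - s * q) * norm (f w) powr q)
             * indicator (stolz_trunc (2 powr (- real j)) (zeta x)) w \<partial>lborel) \<le> ennreal K * peak_bracket s q a R f x j"
      using norm1_bracket_le[OF a0 q] by blast
    show "\<exists>K>0. \<forall>(f :: complex \<Rightarrow> 'a) x j. analytic_disc f \<longrightarrow> 0 \<le> x \<longrightarrow> x < 1 \<longrightarrow>
      (\<Sum>l. if j \<le> l then ennreal (2 powr (s * real l * q)) * epow (peetre f a (rs l) x) q else 0) \<le> ennreal K * peak_bracket s q a R f x j"
      by (rule norm4_bracket_le[OF a0 q assms(6) C0 rs.R(1) rs])
    show "\<exists>K>0. \<forall>(f :: complex \<Rightarrow> 'a) x j. analytic_disc f \<longrightarrow> 0 \<le> x \<longrightarrow> x < 1 \<longrightarrow>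
      (\<integral>\<^sup>+ r. ennreal ((1 - r) powr (- 1 - s * q)) * epow (peetre f a r x) q * indicator {1 - 2 powr (- real j) ..< 1} r \<partial>lborel)
      \<le> ennreal K * peak_bracket s q a R f x j"
      by (rule norm5_bracket_le[OF a0 q])
  qed
  have L3: "dominated (D rs) (norm3 rs p q s \<tau>)"
    unfolding D_def dominated_def by (rule rs.peak_norm_le_norm3[OF p q a])
  have L2: "dominated (D std_radii) (norm2 p q s \<tau>)"
    unfolding D_def dominated_def by (rule peak_norm_le_norm2[OF p q a])
  have L1: "dominated (D std_radii) (norm1 p q s \<tau>)"
  proof (rule dominated_trans)
    show "dominated (D std_radii) (norm3 std_radii p q s \<tau>)"
      unfolding D_def dominated_def by (rule std.peak_norm_le_norm3[OF p q a])
    show "dominated (norm3 std_radii p q s \<tau>) (norm1 p q s \<tau> :: (complex \<Rightarrow> 'a) \<Rightarrow> ennreal)"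
      unfolding dominated_def by (rule norm3_std_le_norm1[OF p q])
  qed
  let ?N = "\<lambda>j. the_norms rs a p q s \<tau> j :: (complex \<Rightarrow> 'a) \<Rightarrow> ennreal"
  have N: "?N 1 = norm1 p q s \<tau>" "?N 2 = norm2 p q s \<tau>" "?N 3 = norm3 rs p q s \<tau>"
    "?N 4 = norm4 rs a p q s \<tau>" "?N 5 = norm5 a p q s \<tau>"
    by (simp_all add: the_norms_def fun_eq_iff)
  have cases5: "j = 1 \<or> j = 2 \<or> j = 3 \<or> j = 4 \<or> j = 5" if "j \<in> {1..5}" for j :: nat
    using that by auto
  note le34 = norm3_le_norm4[OF p q, of rs s \<tau> a, where ?'a='a]
    and le25 = norm2_le_norm5[OF p q, of s \<tau> a, where ?'a='a]
  have up: "dominated (?N j) (D R)" if j: "j \<in> {1..5}" and R: "radii R c0 C0" for j R c0 C0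
    using cases5[OF j] upper[OF R] dominated_trans[OF le34, of "D R"] dominated_trans[OF le25, of "D R"]
    by (elim disjE) (simp_all only: N)
  \<comment> \<open>The sequence depends on \<open>k\<close>: the given radii for
    \<open>norm3\<close> and \<open>norm4\<close>, the fixed ones otherwise. As the upper bounds
    hold for both, \<open>D rs\<close> and \<open>D std_radii\<close> are never compared with each
    other.\<close>
  have low: "\<exists>R c0 C0. radii R c0 C0 \<and> dominated (D R) (?N k)" if k: "k \<in> {1..5}" for k
  proof -
    have "dominated (D rs) (?N k) \<or> dominated (D std_radii) (?N k)"
      using cases5[OF k] L1 L2 L3 dominated_trans[OF L3 le34] dominated_trans[OF L2 le25]
      by (elim disjE) (simp_all only: N simp_thms)
    then show ?thesis using rs.radii_axioms std_radii by blast
  qed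
  have "\<exists>K>0. \<forall>f. analytic_disc f \<longrightarrow> ?N j f \<le> ennreal K * ?N k f" if "j \<in> {1..5}" "k \<in> {1..5}" for j k
    using up[OF that(1)] low[OF that(2)] dominated_trans unfolding dominated_def[symmetric] by blast
  then have "\<forall>jk\<in>{1..5} \<times> {1..5}. \<exists>K>0. \<forall>f. analytic_disc f \<longrightarrow> ?N (fst jk) f \<le> ennreal K * ?N (snd jk) f" by auto
  from bchoice[OF this] obtain K where
    "\<forall>jk\<in>{1..5} \<times> {1..5}. K jk > 0 \<and> (\<forall>f. analytic_disc f \<longrightarrow> ?N (fst jk) f \<le> ennreal (K jk) * ?N (snd jk) f)"
    by (rule exE)
  note K = this[rule_format]
  define K0 where "K0 = 1 + (\<Sum>jk\<in>{1..5} \<times> {1..5}. K jk)"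
  have KK0: "K jk \<le> K0" if "jk \<in> {1..5} \<times> {1..5}" for jk
  proof -
    have "K jk \<le> (\<Sum>jk\<in>{1..5} \<times> {1..5}. K jk)"
      using that K by (intro member_le_sum) (auto simp del: atLeastAtMost_iff intro!: less_imp_le)
    then show ?thesis unfolding K0_def by simp
  qed
  show ?thesis
  proof (intro exI[of _ K0] conjI allI impI ballI)
    have "0 \<le> (\<Sum>jk\<in>{1..5} \<times> {1..5}. K jk)" using K by (intro sum_nonneg less_imp_le) blast
    then show "1 \<le> K0" unfolding K0_def by simp
    fix f :: "complex \<Rightarrow> 'a" and j k :: nat
    assume f: "analytic_disc f" and jk: "j \<in> {1..5}" "k \<in> {1..5}"
    have "?N j f \<le> ennreal (K (j, k)) * ?N k f" using K[of "(j, k)"] jk f by (simp del: atLeastAtMost_iff)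
    also have "\<dots> \<le> ennreal K0 * ?N k f" using KK0[of "(j, k)"] jk by (intro mult_right_mono ennreal_leI) auto
    finally show "?N j f \<le> ennreal K0 * ?N k f" .
  qed
qed

end
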